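(* Let $n,k\ge 1$ be integers. Let $X$ be a random vector in $\mathbb{R}^n$ with $\frac1n\mathbb{E}[\|X\|^2]=\gamma\in(0,\infty)$, let $\Theta$ be a $k\times n$ random matrix whose entries are i.i.d. Gaussian with mean zero and variance $1/n$, and let $N\sim\mathcal{N}(0,I_k)$, with $X,\Theta,N$ independent. For $t\in(0,\infty)$ let $Y=\Theta X+\sqrt t\,N$, let $P_{Y\mid\Theta}$ be the conditional distribution of $Y$ given $\Theta$, and let $G_Y=\mathcal{N}(0,(\gamma+t)I_k)$ (the Gaussian distribution with the same mean and covariance as $Y$). Then for all $t\in(0,\infty)$ and $\epsilon\in(0,1]$, $$\mathbb{E}\left[D(P_{Y\mid\Theta}\,\|\,G_Y)\right]\le C\,k\log\left(1+\frac{\gamma}{t}\right)\frac{\alpha(X)}{\epsilon\gamma}+C\,k^{3/4}\left(\frac{\beta_1(X)}{\gamma}\right)^{1/2}+C\,k^{1/4}\left(1+\frac{(2+\epsilon)\gamma}{t}\right)^{k/4}\frac{\beta_2(X)}{\gamma},$$ where the expectation is with respect to $\Theta$ and $C$ is a universal constant; in particular, the inequality holds with $C=3$.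
   Context: $\|\cdot\|$ is the Euclidean norm and $\langle\cdot,\cdot\rangle$ the Euclidean inner product; logarithms are natural. For a random vector $X$ in $\mathbb{R}^n$ with $\mathbb{E}\|X\|^2<\infty$, define $$\alpha(X)=\frac1n\mathbb{E}\left[\left|\|X\|^2-\mathbb{E}[\|X\|^2]\right|\right],\qquad \beta_r(X)=\frac1n\left(\mathbb{E}\left[|\langle X_1,X_2\rangle|^r\right]\right)^{1/r},\quad r\in\{1,2\},$$ where $X_1,X_2$ are independent copies of $X$. $D(P\|Q)=\int\log\left(\frac{dP}{dQ}\right)dP$ is the relative entropy. *)

theory Defs
  imports "HOL-Probability.Probability"
begin

definition alpha :: "'a measure \<Rightarrow> ('a \<Rightarrow> real ^ 'n) \<Rightarrow> real" where
  "alpha M X = 1 / real CARD('n) *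
     (\<integral>\<omega>. \<bar>(norm (X \<omega>))\<^sup>2 - (\<integral>\<omega>'. (norm (X \<omega>'))\<^sup>2 \<partial>M)\<bar> \<partial>M)"

text \<open>The independent copies of X are realised on the product space as
  X composed with the two projections.\<close>

definition beta :: "nat \<Rightarrow> 'a measure \<Rightarrow> ('a \<Rightarrow> real ^ 'n) \<Rightarrow> real" where
  "beta r M X = 1 / real CARD('n) *
     root r (\<integral>\<omega>. \<bar>X (fst \<omega>) \<bullet> X (snd \<omega>)\<bar> ^ r \<partial>(M \<Otimes>\<^sub>M M))"

text \<open>Mutual independence of three random variables. The library's indep_var and
  indep_vars require a common value type. The cases A = space S etc. give the pairs.\<close>

definition indep_triple ::
  "'a measure \<Rightarrow> 'x measure \<Rightarrow> ('a \<Rightarrow> 'x) \<Rightarrow> 'y measure \<Rightarrow> ('a \<Rightarrow> 'y) \<Rightarrow>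
   'z measure \<Rightarrow> ('a \<Rightarrow> 'z) \<Rightarrow> bool" where
  "indep_triple M S X T Y U Z \<longleftrightarrow>
     X \<in> measurable M S \<and> Y \<in> measurable M T \<and> Z \<in> measurable M U \<and>
     (\<forall>A\<in>sets S. \<forall>B\<in>sets T. \<forall>C\<in>sets U.
        measure M {\<omega> \<in> space M. X \<omega> \<in> A \<and> Y \<omega> \<in> B \<and> Z \<omega> \<in> C} =
        measure M {\<omega> \<in> space M. X \<omega> \<in> A} *
        measure M {\<omega> \<in> space M. Y \<omega> \<in> B} *
        measure M {\<omega> \<in> space M. Z \<omega> \<in> C})"

text \<open>Nondegenerate Gaussian distribution; meaningful for positive definite covariance S.\<close>

definition mv_normal :: "real ^ 'k \<Rightarrow> real ^ 'k ^ 'k \<Rightarrow> (real ^ 'k) measure" where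
  "mv_normal m S = density lborel (\<lambda>x. ennreal
     (exp (- ((x - m) \<bullet> (matrix_inv S *v (x - m))) / 2) /
      sqrt ((2 * pi) ^ CARD('k) * det S)))"

text \<open>Relative entropy D(P || Q) of probability measures on the same measurable space.
  Note the argument order of \<^const>\<open>KL_divergence\<close>, whose first measure is the reference
  measure Q. Being a Bochner integral, it would be 0 where the true value is infinite. The
  negative part of the log-density is always P-integrable, so non-integrability means
  that D(P || Q) is infinite.\<close>

definition rel_entropy :: "'b measure \<Rightarrow> 'b measure \<Rightarrow> ennreal" where
  "rel_entropy P Q =
     (if absolutely_continuous Q P \<and> integrable P (entropy_density (exp 1) Q P)
      then ennreal (KL_divergence (exp 1) Q P) else \<infinity>)"

text \<open>K is a regular conditional distribution of Y (with values in T) given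
  Z (with values in S).\<close>

definition regular_cond_distr ::
  "'a measure \<Rightarrow> 'z measure \<Rightarrow> ('a \<Rightarrow> 'z) \<Rightarrow> 'y measure \<Rightarrow> ('a \<Rightarrow> 'y) \<Rightarrow> ('z \<Rightarrow> 'y measure) \<Rightarrow> bool" where
  "regular_cond_distr M S Z T Y K \<longleftrightarrow>
     K \<in> measurable S (prob_algebra T) \<and>
     (\<forall>A\<in>sets S. \<forall>B\<in>sets T.
        emeasure M {\<omega> \<in> space M. Z \<omega> \<in> A \<and> Y \<omega> \<in> B} =
        (\<integral>\<^sup>+\<omega>. emeasure (K (Z \<omega>)) B * indicator A (Z \<omega>) \<partial>M))"

end

theory Submission
  imports Defs
begin

text \<open>
  Write \<open>\<tau> = |X|\<^sup>2 / n\<close>, let \<open>A\<close> be the event \<open>|\<tau> - \<gamma>| \<le> \<epsilon> \<gamma> / 2\<close>, and split the conditional density of \<open>Y\<close>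
  given \<open>\<Theta>\<close> into the contributions \<open>f1\<close> of \<open>A\<close> and \<open>f2\<close> of its complement. Convexity of relative
  entropy separates the two. The complement has probability at most \<open>2 \<alpha> / (\<epsilon> \<gamma>)\<close>, and by convexity
  again it costs at most the mean divergence of the Gaussian components. On \<open>A\<close>, with \<open>m = E f1\<close>, the
  divergence of \<open>f1\<close> from \<open>m\<close> is at most \<open>m ln (1 + Var f1 / m\<^sup>2) \<le> sqrt (Var f1)\<close> pointwise, while the
  divergence of \<open>m\<close> from the target is of order \<open>\<alpha>\<close>.

  The second moment of \<open>f1\<close> at \<open>y\<close> is an average over two copies of \<open>X\<close> of the density at \<open>(y, y)\<close> of a
  Gaussian pair with correlation \<open>\<rho> = \<langle>X1, X2\<rangle> / n\<close>, hence radial in \<open>y\<close>. Polar coordinates and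
  Cauchy--Schwarz with the weight \<open>1 + (r / s)\<^sup>2\<close>, \<open>s\<close> of order \<open>sqrt (k (\<gamma> + t))\<close>, reduce the integral of
  \<open>sqrt (Var f1)\<close> to explicit Gaussian moments. Comparing these for \<open>\<rho>\<close> and for \<open>0\<close> gives a term linear
  and a term quadratic in \<open>\<rho>\<close>, which produce \<open>\<beta>\<close> of order one and two.
\<close>

text \<open>A chi-square estimate would leave the variance divided by a density. The bound
  \<open>ln (1 + x) \<le> sqrt x\<close> cancels the mean instead, and only the Lebesgue integral of
  a standard deviation remains. Cauchy--Schwarz undoes that square root: the reciprocal of the
  weight has a finite integral over the half line, and the weight itself asks for only two Gaussian
  moments, which the choice of \<open>s\<close> makes equally large. The truncation to
  \<open>A\<close> produces the exponential factor. It forces 2 \<rho> to be at most (2 +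
  \<epsilon>) \<gamma>, and with z = 2 \<rho> / (sum of the two variances) the ratio (1 + z) / (1 -
  z) is then at most R = 1 + (2 + \<epsilon>) \<gamma> / t. The squared bound has the shape sqrt k *
  (k * b1 + R^(k/2) * b2^2) with bi the normalized \<beta> of order i. Its root explains the powers
  k^(3/4), k^(1/4) and R^(k/4). The constant 3 is sqrt (9/4 * 4): 9/4 from the polar constant, 4
  from the quadratic coefficient. The other two terms have slack.\<close>

section \<open>Real inequalities\<close>

text \<open>The integrand of relative entropy, made nonnegative by adding a term whose integral vanishes for
  probability densities, so that all integrals below can be exchanged freely.\<close>
definition ell :: "real \<Rightarrow> real \<Rightarrow> real" where
  "ell a b = a * ln (a / b) - a + b"

text \<open>\<open>ell\<close> is convex and homogeneous of degree one, so its tangent plane at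
  \<open>(A, B)\<close> passes through the origin; the left side is that plane. The inequality is
  \<open>ln w \<le> w - 1\<close> at \<open>w = (b / a) * (A / B)\<close>. Both convexity facts, for
  sums and for integrals, come from it.\<close>

lemma ell_tangent:
  assumes "0 \<le> a" "0 < b" "0 < A" "0 < B"
  shows "a * ln (A / B) + b * (1 - A / B) \<le> ell a b"
proof (cases "a = 0")
  case True
  then show ?thesis using assms by (simp add: ell_def field_simps)
next
  case False
  define w where "w = (b / a) * (A / B)"
  have w: "w > 0" using assms False by (simp add: w_def)
  have "ln w \<le> w - 1" using ln_le_minus_one[OF w] .
  moreover have "ln w = ln (A / B) - ln (a / b)"
    using assms False by (simp add: w_def ln_mult ln_div)
  ultimately have "a * (ln (A / B) - ln (a / b)) \<le> a * (w - 1)"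
    using assms by (intro mult_left_mono) auto
  also have "a * (w - 1) = b * (A / B) - a"
    using False by (simp add: w_def field_simps)
  finally show ?thesis by (simp add: ell_def algebra_simps)
qed

lemma ell_nonneg:
  assumes "0 \<le> a" "0 < b" shows "0 \<le> ell a b"
  using ell_tangent[OF assms, of 1 1] by simp

text \<open>Log-sum inequality: both summands lie above the tangent plane at the sum, where that
  plane touches \<open>ell\<close>.\<close>

lemma ell_add_le:
  assumes "0 \<le> a" "0 \<le> a'" "0 < b" "0 < b'"
  shows "ell (a + a') (b + b') \<le> ell a b + ell a' b'"
proof (cases "a + a' = 0")
  case True
  then have "a = 0" "a' = 0" using assms by auto
  then show ?thesis by (simp add: ell_def)
next
  case False
  let ?A = "a + a'" and ?B = "b + b'"
  have p: "0 < ?A" "0 < ?B" using assms False by auto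
  have "ell ?A ?B = ?A * ln (?A / ?B) + ?B * (1 - ?A / ?B)"
    using p by (simp add: ell_def right_diff_distrib)
  also have "\<dots> = (a * ln (?A / ?B) + b * (1 - ?A / ?B)) + (a' * ln (?A / ?B) + b' * (1 - ?A / ?B))"
    by (simp only: distrib_right)
  also have "\<dots> \<le> ell a b + ell a' b'"
    using assms p by (intro add_mono ell_tangent)
  finally show ?thesis .
qed

text \<open>With \<open>u = sqrt x\<close>, the derivative of \<open>u - ln (1 + u\<^sup>2)\<close>
  is \<open>(1 - u)\<^sup>2 / (1 + u\<^sup>2)\<close>.\<close>

lemma ln_one_plus_le_sqrt:
  assumes "0 \<le> (x::real)" shows "ln (1 + x) \<le> sqrt x"
proof -
  define f where "f = (\<lambda>u::real. u - ln (1 + u\<^sup>2))"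
  have "f 0 \<le> f (sqrt x)"
  proof (rule DERIV_nonneg_imp_nondecreasing[of 0 "sqrt x" f])
    show "0 \<le> sqrt x" using assms by simp
    fix u :: real assume "0 \<le> u" "u \<le> sqrt x"
    have p: "0 < 1 + u\<^sup>2" by (smt (verit) zero_le_power2)
    have "(f has_real_derivative (1 - (2 * u) / (1 + u\<^sup>2))) (at u)"
      unfolding f_def using p by (auto intro!: derivative_eq_intros)
    moreover have "2 * u \<le> 1 + u\<^sup>2" using zero_le_power2[of "u - 1"] by (simp add: power2_diff)
    then have "0 \<le> 1 - (2 * u) / (1 + u\<^sup>2)" using p by simp
    ultimately show "\<exists>y. (f has_real_derivative y) (at u) \<and> 0 \<le> y" by blast
  qed
  then show ?thesis using assms by (simp add: f_def)
qed

text \<open>The bound \<open>F(z) \<le> 1 + a z + (z / z0)\<^sup>2 (F(z0) - 1 - a z0)\<close> holds for power series with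
  nonnegative coefficients; it is stable under products.\<close>
lemma quadratic_bound_mult:
  fixes f g :: real
  assumes f: "f \<le> 1 + a * z + w * (F - 1 - a * z0)" "0 \<le> F - 1 - a * z0" "0 \<le> a"
    and g: "g \<le> 1 + b * z + w * (G - 1 - b * z0)" "0 \<le> G - 1 - b * z0" "0 \<le> b"
    and fg: "0 \<le> f" "0 \<le> g"
    and z: "0 \<le> z" "z \<le> z0" "0 < z0" and w: "w = (z / z0)\<^sup>2"
  shows "f * g \<le> 1 + (a + b) * z + w * (F * G - 1 - (a + b) * z0)"
    and "0 \<le> F * G - 1 - (a + b) * z0"
proof -
  define A where "A = F - 1 - a * z0"
  define B where "B = G - 1 - b * z0"
  have AB: "0 \<le> A" "0 \<le> B" using f g by (auto simp: A_def B_def)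
  have w01: "0 \<le> w" "w \<le> 1" using z by (auto simp: w power_le_one)
  have zz: "z\<^sup>2 = w * z0\<^sup>2" using z by (simp add: w power_divide)
  \<comment> \<open>The second-order part of the product is a sum of nonnegative terms. Each of its
    counterparts at \<open>z\<close> carries a factor \<open>w\<close>, after which a spare
    \<open>z\<close> is raised to \<open>z0\<close> and a spare \<open>w\<close> to 1.\<close>
  have FG: "F * G - 1 - (a + b) * z0 = a * b * z0\<^sup>2 + A + B + z0 * (a * B + b * A) + A * B"
    unfolding A_def B_def by (simp add: algebra_simps power2_eq_square)
  have "f * g \<le> (1 + a * z + w * A) * (1 + b * z + w * B)"
    using f g fg AB w01 z unfolding A_def[symmetric] B_def[symmetric] by (intro mult_mono) auto
  also have "\<dots> = 1 + (a + b) * z + (a * b * z\<^sup>2 + w * (A + B) + z * (w * (a * B + b * A)) + w * (w * (A * B)))"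
    by (simp add: algebra_simps power2_eq_square)
  also have "\<dots> \<le> 1 + (a + b) * z + (a * b * (w * z0\<^sup>2) + w * (A + B) + z0 * (w * (a * B + b * A)) + 1 * (w * (A * B)))"
    unfolding zz using AB w01 z f g by (intro add_mono mult_right_mono order_refl) auto
  also have "\<dots> = 1 + (a + b) * z + w * (F * G - 1 - (a + b) * z0)"
    unfolding FG by (simp add: algebra_simps)
  finally show "f * g \<le> 1 + (a + b) * z + w * (F * G - 1 - (a + b) * z0)" .
  show "0 \<le> F * G - 1 - (a + b) * z0" unfolding FG using AB f g z by auto
qed

section \<open>Powers of the correlation factor\<close>

text \<open>With \<open>z = 2 \<rho> / u\<close>, where \<open>u\<close> is the sum of the two
  variances, this bounds the factor by which correlation raises
  \<open>sqrt D / (u - 2 \<rho>)\<close> above its value at correlation zero; \<open>D\<close> is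
  the determinant of the covariance matrix.\<close>

definition psi_root :: "real \<Rightarrow> real" where
  "psi_root z = sqrt (1 + z) / sqrt (1 - z)"

text \<open>With \<open>v = sqrt (1 - z\<^sup>2)\<close> the function is \<open>(1 + z) / v\<close>,
  and \<open>z\<^sup>2 = (1 - v) * (1 + v)\<close> pulls a square out of what remains beyond first
  order. The cofactor of \<open>z\<^sup>2\<close> visibly increases, which replaces a power series
  argument.\<close>

lemma psi_root_eq:
  assumes "0 \<le> z" "z < 1"
  shows "psi_root z = 1 + z + z\<^sup>2 * ((1 + z) / (sqrt (1 - z\<^sup>2) * (1 + sqrt (1 - z\<^sup>2))))"
proof -
  define v where "v = sqrt (1 - z\<^sup>2)"
  have z2: "z\<^sup>2 < 1" using assms by (simp add: power_less_one_iff abs_square_less_1)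
  have v: "0 < v" "v\<^sup>2 = 1 - z\<^sup>2" using z2 by (auto simp: v_def)
  have "psi_root z = (sqrt (1 + z) * sqrt (1 + z)) / (sqrt (1 - z) * sqrt (1 + z))"
    using assms unfolding psi_root_def by (subst mult_divide_mult_cancel_right) auto
  also have "sqrt (1 - z) * sqrt (1 + z) = v"
    by (simp add: v_def real_sqrt_mult[symmetric] algebra_simps power2_eq_square)
  also have "sqrt (1 + z) * sqrt (1 + z) = 1 + z" using assms by simp
  finally have 1: "psi_root z = (1 + z) / v" .
  have zv: "z\<^sup>2 = (1 - v) * (1 + v)" using v by (simp add: algebra_simps power2_eq_square)
  have nz: "1 + v \<noteq> 0" using v by linarith
  have "z\<^sup>2 * ((1 + z) / (v * (1 + v))) = (1 - v) * (1 + z) / v"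
    unfolding zv using v nz by (simp add: divide_simps)
  also have "\<dots> = (1 + z) / v - (1 + z)" using v by (simp add: field_simps)
  finally show ?thesis unfolding 1 v_def[symmetric] by simp
qed

lemma psi_root_quadratic_bound:
  assumes z: "0 \<le> z" "z \<le> z0" "0 < z0" "z0 < 1"
  shows "psi_root z \<le> 1 + 1 * z + (z / z0)\<^sup>2 * (psi_root z0 - 1 - 1 * z0)"
    and "0 \<le> psi_root z0 - 1 - 1 * z0"
proof -
  define h where "h = (\<lambda>z. (1 + z) / (sqrt (1 - z\<^sup>2) * (1 + sqrt (1 - z\<^sup>2))))"
  have z2: "z0\<^sup>2 < 1" using z by (simp add: power_less_one_iff abs_square_less_1)
  have zz: "z\<^sup>2 \<le> z0\<^sup>2" using z by (simp add: power_mono)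
  have s: "0 < sqrt (1 - z0\<^sup>2)" using z2 by simp
  have hm: "h z \<le> h z0" unfolding h_def
    using z s zz z2 order_trans[OF zz less_imp_le[OF z2]]
    by (intro frac_le mult_mono add_mono mult_pos_pos add_pos_pos) auto
  have h0: "0 \<le> h z0" unfolding h_def using z s by auto
  have e: "psi_root z = 1 + z + z\<^sup>2 * h z" "psi_root z0 = 1 + z0 + z0\<^sup>2 * h z0"
    using psi_root_eq[of z] psi_root_eq[of z0] z by (auto simp: h_def)
  have "z\<^sup>2 * h z \<le> z\<^sup>2 * h z0" using hm by (simp add: mult_left_mono)
  also have "\<dots> = (z / z0)\<^sup>2 * (psi_root z0 - 1 - 1 * z0)"
    using z by (simp add: e power_divide)
  finally show "psi_root z \<le> 1 + 1 * z + (z / z0)\<^sup>2 * (psi_root z0 - 1 - 1 * z0)" by (simp add: e)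
  show "0 \<le> psi_root z0 - 1 - 1 * z0" using h0 by (simp add: e)
qed

lemma psi_root_nonneg: "- 1 \<le> z \<Longrightarrow> z < 1 \<Longrightarrow> 0 \<le> psi_root z"
  by (simp add: psi_root_def)

lemma psi_root_power_quadratic_bound:
  assumes z: "0 \<le> z" "z \<le> z0" "0 < z0" "z0 < 1"
  shows "psi_root z ^ k \<le> 1 + real k * z + (z / z0)\<^sup>2 * (psi_root z0 ^ k - 1 - real k * z0)
    \<and> 0 \<le> psi_root z0 ^ k - 1 - real k * z0"
proof (induction k)
  case (Suc k)
  have nn: "0 \<le> psi_root z" using psi_root_nonneg z by simp
  note q = quadratic_bound_mult[OF psi_root_quadratic_bound[OF z] _ conjunct1[OF Suc.IH] conjunct2[OF Suc.IH] _ _ _ z(1-3) refl]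
  show ?case using q nn by (simp add: algebra_simps)
qed simp

text \<open>Only the leading part \<open>psi_root z0 ^ k\<close> of the quadratic coefficient is
  kept; the subtracted terms are dropped. The factor 3 / 2 bounds \<open>1 + z0 / 2\<close>.\<close>

lemma psi_root_power_bounds:
  assumes z: "0 \<le> z" "z \<le> z0" "0 < z0" "z0 < 1"
  shows "psi_root z ^ k \<le> 1 + real k * z + (z / z0)\<^sup>2 * psi_root z0 ^ k"
    and "psi_root z ^ k * sqrt (1 + z) \<le> 1 + (real k + 1 / 2) * z + 3 / 2 * ((z / z0)\<^sup>2 * psi_root z0 ^ k)"
proof -
  note P = psi_root_power_quadratic_bound[OF z, of k]
  have nn: "0 \<le> psi_root z ^ k" "0 \<le> psi_root z0 ^ k" using psi_root_nonneg z by simp_all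
  have "(z / z0)\<^sup>2 * (psi_root z0 ^ k - 1 - real k * z0) \<le> (z / z0)\<^sup>2 * psi_root z0 ^ k"
    proof (intro mult_left_mono)
    have "0 \<le> real k * z0" using z by simp
    then show "psi_root z0 ^ k - 1 - real k * z0 \<le> psi_root z0 ^ k" by linarith
  qed simp
  then show "psi_root z ^ k \<le> 1 + real k * z + (z / z0)\<^sup>2 * psi_root z0 ^ k" using P by linarith
  have sq: "sqrt (1 + z) \<le> 1 + z / 2"
    using z by (intro real_le_lsqrt) (auto simp: power2_eq_square algebra_simps)
  have "psi_root z ^ k * sqrt (1 + z) \<le> psi_root z ^ k * (1 + z / 2)"
    using nn sq by (intro mult_left_mono)
  \<comment> \<open>\<open>1 + z / 2\<close> meets the quadratic bound with no second-order part, so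
    the product lemma applies to it.\<close>
  also have "\<dots> \<le> 1 + (real k + 1/2) * z + (z / z0)\<^sup>2 * (psi_root z0 ^ k * (1 + z0/2) - 1 - (real k + 1/2) * z0)"
    using P nn z by (intro quadratic_bound_mult(1)) auto
  also have "\<dots> \<le> 1 + (real k + 1/2) * z + (z / z0)\<^sup>2 * (psi_root z0 ^ k * (3/2))"
  proof -
    have "psi_root z0 ^ k * (1 + z0/2) \<le> psi_root z0 ^ k * (3/2)" using z nn by (intro mult_left_mono) auto
    moreover have "0 \<le> (real k + 1/2) * z0" using z by simp
    ultimately show ?thesis by (intro add_left_mono mult_left_mono) auto
  qed
  finally show "psi_root z ^ k * sqrt (1 + z) \<le> 1 + (real k + 1 / 2) * z + 3 / 2 * ((z / z0)\<^sup>2 * psi_root z0 ^ k)"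
    by simp
qed

text \<open>The two radial moments bring the powers \<open>k - 1\<close> and \<open>k + 1\<close>.
  Trading a factor \<open>sqrt (1 - z)\<close> for \<open>sqrt (1 + z)\<close> brings both to the
  power \<open>k\<close>, so that one estimate serves them.\<close>

lemma psi_root_split:
  assumes "- 1 < z" "z < 1" "1 \<le> k"
  shows "psi_root z ^ (k - 1) / sqrt (1 - z) = psi_root z ^ k / sqrt (1 + z)"
    and "psi_root z ^ (k + 1) * sqrt (1 - z) = psi_root z ^ k * sqrt (1 + z)"
proof -
  have p: "0 < sqrt (1 + z)" "0 < sqrt (1 - z)" using assms by auto
  obtain j where j: "k = Suc j" using assms by (cases k) auto
  show "psi_root z ^ (k - 1) / sqrt (1 - z) = psi_root z ^ k / sqrt (1 + z)"
    using p unfolding j by (simp add: psi_root_def)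
  show "psi_root z ^ (k + 1) * sqrt (1 - z) = psi_root z ^ k * sqrt (1 + z)"
    using p by (simp add: psi_root_def)
qed

text \<open>The left sides are the only correlation-dependent factors of the two moments in
  \<open>radial_weight\<close>; the first terms on the right are their values at correlation zero.
  The linear part of the excess \<open>F\<close> is the source of \<beta> of order one, the
  quadratic part that of order two. The powers of 1 / 2 bound those of
  \<open>sqrt (a * b) / u\<close> by the arithmetic-geometric mean.\<close>

lemma correlation_bounds:
  fixes \<gamma> t \<epsilon> \<tau>1 \<tau>2 \<rho> :: real
  assumes pos: "0 < \<gamma>" "0 < t" "0 < \<epsilon>" "\<epsilon> \<le> 1"
    and \<tau>1: "\<bar>\<tau>1 - \<gamma>\<bar> \<le> \<epsilon> * \<gamma> / 2" and \<tau>2: "\<bar>\<tau>2 - \<gamma>\<bar> \<le> \<epsilon> * \<gamma> / 2"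
    and \<rho>: "\<rho>\<^sup>2 \<le> \<tau>1 * \<tau>2" and k: "1 \<le> k"
  defines "a \<equiv> t + \<tau>1" and "b \<equiv> t + \<tau>2"
  defines "u \<equiv> a + b" and "D \<equiv> a * b - \<rho>\<^sup>2"
  defines "F \<equiv> 2 * real k * (\<bar>\<rho>\<bar> / \<gamma>) + 4 * (\<rho> / \<gamma>)\<^sup>2 * sqrt (1 + (2 + \<epsilon>) * \<gamma> / t) ^ k"
  shows "(sqrt D / (u - 2 * \<rho>)) ^ (k - 1) / sqrt (u - 2 * \<rho>)
      \<le> (sqrt (a * b) / u) ^ (k - 1) / sqrt u + (1 / 2) ^ (k - 1) / sqrt u * F"
    and "(sqrt D / (u - 2 * \<rho>)) ^ (k + 1) * sqrt (u - 2 * \<rho>)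
      \<le> (sqrt (a * b) / u) ^ (k + 1) * sqrt u + (1 / 2) ^ (k + 1) * sqrt u * (3 / 2 * F)"
proof -
  have eg: "\<epsilon> * \<gamma> \<le> \<gamma>" "0 < \<epsilon> * \<gamma>" using pos by auto
  have t1: "\<tau>1 \<le> \<gamma> + \<epsilon> * \<gamma> / 2" "\<gamma> - \<epsilon> * \<gamma> / 2 \<le> \<tau>1" "0 < \<tau>1" using \<tau>1 eg unfolding abs_le_iff by linarith+
  have t2: "\<tau>2 \<le> \<gamma> + \<epsilon> * \<gamma> / 2" "\<gamma> - \<epsilon> * \<gamma> / 2 \<le> \<tau>2" "0 < \<tau>2" using \<tau>2 eg unfolding abs_le_iff by linarith+
  have am: "(2 * \<bar>\<rho>\<bar>)\<^sup>2 \<le> (\<tau>1 + \<tau>2)\<^sup>2"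
    using \<rho> zero_le_power2[of "\<tau>1 - \<tau>2"] by (simp add: power2_eq_square algebra_simps)
  have r2: "2 * \<bar>\<rho>\<bar> \<le> \<tau>1 + \<tau>2" using power2_le_imp_le[OF am] t1 t2 by linarith
  have u: "0 < u" "2 * t + 2 * \<bar>\<rho>\<bar> \<le> u" "2 * t + (2 * \<gamma> - \<epsilon> * \<gamma>) \<le> u" "\<gamma> \<le> u"
    using r2 t1 t2 pos eg by (auto simp: u_def a_def b_def)
  have ab: "0 < a" "0 < b" using t1 t2 pos by (auto simp: a_def b_def)
  have ab4: "a * b \<le> (u / 2)\<^sup>2"
    using zero_le_power2[of "a - b"] by (simp add: u_def power2_eq_square algebra_simps)
  define z where "z = 2 * \<rho> / u"
  have uz: "u - 2 * \<rho> = u * (1 - z)" using u by (simp add: z_def field_simps)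
  have z1: "\<bar>z\<bar> < 1" using u pos by (simp add: z_def abs_mult)
  have zp: "-1 < z" "z < 1" using z1 by auto
  define d0 where "d0 = sqrt (a * b) / u"
  have d0: "0 \<le> d0" "d0 \<le> 1 / 2"
  proof -
    show "0 \<le> d0" using ab u by (simp add: d0_def)
    have "sqrt (a * b) \<le> u / 2" using ab4 u by (intro real_le_lsqrt) auto
    then show "d0 \<le> 1 / 2" using u by (simp add: d0_def field_simps)
  qed
  \<comment> \<open>Since \<open>a * b / u\<^sup>2 \<le> 1 / 4\<close>, the loss
    \<open>\<rho>\<^sup>2 = z\<^sup>2 * u\<^sup>2 / 4\<close> in the determinant is at least
    \<open>a * b * z\<^sup>2\<close>. The resulting factor \<open>(1 - z) * (1 + z)\<close> partly
    cancels against the denominator.\<close>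
  have Dle: "D \<le> a * b * (1 - z\<^sup>2)"
  proof -
    have "a * b * z\<^sup>2 = 4 * \<rho>\<^sup>2 * ((a * b) / u\<^sup>2)" by (simp add: z_def power_divide power_mult_distrib)
    also have "(a * b) / u\<^sup>2 \<le> 1 / 4" using ab4 u by (simp add: field_simps power2_eq_square)
    finally have "a * b * z\<^sup>2 \<le> \<rho>\<^sup>2" by (simp add: mult_left_mono) 
    then show ?thesis by (simp add: D_def algebra_simps)
  qed
  have D0: "0 \<le> D"
  proof -
    have "0 \<le> \<tau>1 * t" "0 \<le> \<tau>2 * t" "0 \<le> t * t" using t1 t2 pos by auto
    moreover have "D = \<tau>1 * \<tau>2 - \<rho>\<^sup>2 + (\<tau>1 * t + \<tau>2 * t + t * t)"
      unfolding D_def a_def b_def by (simp add: algebra_simps)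
    ultimately show ?thesis using \<rho> by linarith
  qed
  \<comment> \<open>the quotient is compared with its value \<open>d0\<close> at correlation 0, at the cost of \<open>sqrt ((1 + z) / (1 - z))\<close>\<close>
  have d_le: "sqrt D / (u - 2 * \<rho>) \<le> d0 * psi_root z"
  proof -
    have "sqrt D \<le> sqrt (a * b * ((1 - z) * (1 + z)))" using Dle by (simp add: algebra_simps power2_eq_square)
    also have "\<dots> = sqrt (a * b) * (sqrt (1 - z) * sqrt (1 + z))" by (simp add: real_sqrt_mult)
    finally have "sqrt D / (u - 2 * \<rho>) \<le> sqrt (a * b) * (sqrt (1 - z) * sqrt (1 + z)) / (u * (1 - z))"
      unfolding uz using u zp by (intro divide_right_mono) auto
    also have "\<dots> = d0 * (sqrt (1 + z) * (sqrt (1 - z) / (1 - z)))" by (simp add: d0_def)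
    also have "sqrt (1 - z) / (1 - z) = 1 / sqrt (1 - z)"
    proof -
      have "sqrt (1 - z) / (sqrt (1 - z) * sqrt (1 - z)) = 1 / sqrt (1 - z)"
        using zp by (subst divide_divide_eq_left[symmetric]) simp
      then show ?thesis using zp by simp
    qed
    finally show ?thesis by (simp add: psi_root_def)
  qed
  have dn: "0 \<le> sqrt D / (u - 2 * \<rho>)" unfolding uz using D0 u zp by simp
  have T1: "(sqrt D / (u - 2 * \<rho>)) ^ (k - 1) / sqrt (u - 2 * \<rho>) \<le> d0 ^ (k - 1) / sqrt u * (psi_root z ^ k / sqrt (1 + z))"
  proof -
    have "(sqrt D / (u - 2 * \<rho>)) ^ (k - 1) / sqrt (u - 2 * \<rho>) \<le> (d0 * psi_root z) ^ (k - 1) / (sqrt u * sqrt (1 - z))"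
      using dn d_le u zp by (auto simp: uz real_sqrt_mult intro!: divide_right_mono power_mono)
    also have "\<dots> = d0 ^ (k - 1) / sqrt u * (psi_root z ^ (k - 1) / sqrt (1 - z))"
      by (simp add: power_mult_distrib)
    finally show ?thesis unfolding psi_root_split(1)[OF zp k] .
  qed
  have T2: "(sqrt D / (u - 2 * \<rho>)) ^ (k + 1) * sqrt (u - 2 * \<rho>) \<le> d0 ^ (k + 1) * sqrt u * (psi_root z ^ k * sqrt (1 + z))"
  proof -
    have "(sqrt D / (u - 2 * \<rho>)) ^ (k + 1) * sqrt (u - 2 * \<rho>) \<le> (d0 * psi_root z) ^ (k + 1) * (sqrt u * sqrt (1 - z))"
      using dn d_le u zp unfolding uz real_sqrt_mult by (intro mult_right_mono power_mono) auto
    also have "\<dots> = d0 ^ (k + 1) * sqrt u * (psi_root z ^ (k + 1) * sqrt (1 - z))"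
      by (simp add: power_mult_distrib)
    finally show ?thesis unfolding psi_root_split(2)[OF zp k] .
  qed
  have F0: "0 \<le> F" using pos by (auto simp: F_def)
  have G: "psi_root z ^ k / sqrt (1 + z) \<le> 1 + F \<and> psi_root z ^ k * sqrt (1 + z) \<le> 1 + 3 / 2 * F"
  proof (cases "0 \<le> z")
    \<comment> \<open>Negative correlation only helps: both products are at most 1.\<close>
    case False
    have "psi_root z \<le> 1" using False zp by (simp add: psi_root_def)
    then have a: "psi_root z ^ k \<le> 1" "psi_root z ^ (k - 1) \<le> 1" using psi_root_nonneg[of z] zp by (auto intro: power_le_one)
    have "psi_root z ^ (k - 1) / sqrt (1 - z) \<le> 1 / 1"
      using a False zp psi_root_nonneg[of z] by (intro frac_le) auto
    moreover have "psi_root z ^ k * sqrt (1 + z) \<le> 1 * 1"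
      using a False zp psi_root_nonneg[of z] by (intro mult_mono) auto
    ultimately show ?thesis using psi_root_split(1)[OF zp k] F0 by simp
  next
    case True
    define R where "R = 1 + (2 + \<epsilon>) * \<gamma> / t"
    \<comment> \<open>\<open>z0\<close> solves \<open>(1 + z0) / (1 - z0) = R\<close> and bounds every admissible \<open>z\<close>\<close>
    define z0 where "z0 = (2 + \<epsilon>) * \<gamma> / (2 * t + (2 + \<epsilon>) * \<gamma>)"
    have r0: "0 \<le> \<rho>" using True u by (simp add: z_def zero_le_divide_iff)
    have q: "0 < (2 + \<epsilon>) * \<gamma>" using pos by simp
    have z0: "0 < z0" "z0 < 1" using q pos by (auto simp: z0_def field_simps)
    have "(1 + z0) / (1 - z0) = R"
    proof -
      define W where "W = 2 * t + (2 + \<epsilon>) * \<gamma>"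
      have W: "0 < W" using q pos unfolding W_def by linarith
      have "1 - z0 = (W - (2 + \<epsilon>) * \<gamma>) / W" "1 + z0 = (W + (2 + \<epsilon>) * \<gamma>) / W"
        using W unfolding z0_def W_def[symmetric] by (simp_all add: diff_divide_distrib add_divide_distrib)
      then have "(1 + z0) / (1 - z0) = (W + (2 + \<epsilon>) * \<gamma>) / (W - (2 + \<epsilon>) * \<gamma>)" using W by simp
      also have "\<dots> = (2 * t + 2 * ((2 + \<epsilon>) * \<gamma>)) / (2 * t)" by (simp add: W_def)
      also have "\<dots> = R" using pos by (simp add: R_def add_divide_distrib)
      finally show ?thesis .
    qed
    then have psi0: "psi_root z0 = sqrt R" by (simp add: psi_root_def real_sqrt_divide[symmetric])
    have den: "0 < 2 * t + (2 + \<epsilon>) * \<gamma>" using q pos by linarith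
    have zz0: "z \<le> z0"
    proof -
      \<comment> \<open>The truncation gives \<open>2 * \<rho> \<le> \<tau>1 + \<tau>2 \<le> (2 +
        \<epsilon>) * \<gamma>\<close>, and \<open>x / (2 * t + x)\<close> increases with
        \<open>x\<close>.\<close>
      have rr: "2 * \<rho> \<le> (2 + \<epsilon>) * \<gamma>" using r2 t1 t2 r0 by (simp add: algebra_simps)
      have "z \<le> 2 * \<rho> / (2 * t + 2 * \<rho>)" unfolding z_def using u r0 pos by (intro frac_le) auto
      also have "\<dots> \<le> z0"
        unfolding z0_def using mult_right_mono[OF rr, of "2 * t"] r0 pos den by (simp add: field_simps)
      finally show ?thesis .
    qed
    have zr: "z \<le> 2 * (\<rho> / \<gamma>)" unfolding z_def using mult_left_mono[OF u(4) r0] u pos by (simp add: field_simps)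
    \<comment> \<open>Replacing \<open>u\<close> by its lower bound
      \<open>2 * t + (2 - \<epsilon>) * \<gamma>\<close> leaves a quotient that must be at most 1.
      Its denominator exceeds its numerator because \<epsilon> \<le> 1.\<close>
    have zzr: "z / z0 \<le> 2 * (\<rho> / \<gamma>)"
    proof -
      have low: "0 < 2 * t + (2 * \<gamma> - \<epsilon> * \<gamma>)" using pos eg by linarith
      have "z \<le> 2 * \<rho> / (2 * t + (2 * \<gamma> - \<epsilon> * \<gamma>))" unfolding z_def using u r0 low by (intro frac_le) auto
      then have "z / z0 \<le> 2 * \<rho> / (2 * t + (2 * \<gamma> - \<epsilon> * \<gamma>)) / z0" using z0 by (intro divide_right_mono) auto
      also have "\<dots> = (2 * \<rho> / \<gamma>) * ((2 * t + (2 + \<epsilon>) * \<gamma>) / ((2 + \<epsilon>) * (2 * t + (2 * \<gamma> - \<epsilon> * \<gamma>))))"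
        using pos by (simp add: z0_def)
      also have "\<dots> \<le> (2 * \<rho> / \<gamma>) * 1"
      proof (intro mult_left_mono)
        have "0 \<le> \<gamma> * (1 - \<epsilon>)" using pos by simp
        then have "0 \<le> 2 * t + 2 * (\<epsilon> * t) + 2 * (\<gamma> * (1 - \<epsilon>)) + \<epsilon> * (\<gamma> * (1 - \<epsilon>))"
          using pos by (intro add_nonneg_nonneg mult_nonneg_nonneg) auto
        also have "\<dots> = (2 + \<epsilon>) * (2 * t + (2 * \<gamma> - \<epsilon> * \<gamma>)) - (2 * t + (2 + \<epsilon>) * \<gamma>)"
          by (simp add: algebra_simps)
        finally have "2 * t + (2 + \<epsilon>) * \<gamma> \<le> (2 + \<epsilon>) * (2 * t + (2 * \<gamma> - \<epsilon> * \<gamma>))" by simp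
        then show "(2 * t + (2 + \<epsilon>) * \<gamma>) / ((2 + \<epsilon>) * (2 * t + (2 * \<gamma> - \<epsilon> * \<gamma>))) \<le> 1"
          using pos low by simp
        show "0 \<le> 2 * \<rho> / \<gamma>" using r0 pos by simp
      qed
      finally show ?thesis by simp
    qed
    have sqz: "(z / z0)\<^sup>2 \<le> (2 * (\<rho> / \<gamma>))\<^sup>2" using zzr True z0 by (intro power_mono) auto
    have sR: "0 \<le> sqrt R ^ k" using pos by (simp add: R_def)
    note B = psi_root_power_bounds[OF True zz0 z0, of k, unfolded psi0]
    have "(z / z0)\<^sup>2 * sqrt R ^ k \<le> (2 * (\<rho> / \<gamma>))\<^sup>2 * sqrt R ^ k" using sqz sR by (rule mult_right_mono)
    also have "\<dots> = 4 * (\<rho> / \<gamma>)\<^sup>2 * sqrt R ^ k" by (simp add: power2_eq_square)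
    finally have quad: "(z / z0)\<^sup>2 * sqrt R ^ k \<le> 4 * (\<rho> / \<gamma>)\<^sup>2 * sqrt R ^ k" .
    have lin: "real k * z \<le> 2 * real k * (\<bar>\<rho>\<bar> / \<gamma>)" using mult_left_mono[OF zr, of "real k"] r0 by (simp add: mult_ac)
    \<comment> \<open>\<open>k + 1 / 2 \<le> 3 / 2 * k\<close> as \<open>k\<close> is at least 1, so
      the factor 3 / 2 of the quadratic part covers the linear part as well.\<close>
    have "(real k + 1/2) * z \<le> (3 / 2 * real k) * z" using k True by (intro mult_right_mono) auto
    then have lin2: "(real k + 1/2) * z \<le> 3 / 2 * (2 * real k * (\<bar>\<rho>\<bar> / \<gamma>))"
      using lin by (intro order_trans[OF _ mult_left_mono[OF lin, of "3 / 2"]]) auto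
    have Fe: "F = 2 * real k * (\<bar>\<rho>\<bar> / \<gamma>) + 4 * (\<rho> / \<gamma>)\<^sup>2 * sqrt R ^ k" by (simp add: F_def R_def)
    have "psi_root z ^ k \<le> 1 + F" using B(1) quad lin unfolding Fe by linarith
    moreover have "psi_root z ^ k / sqrt (1 + z) \<le> psi_root z ^ k / 1"
      using True zp psi_root_nonneg[of z] by (intro divide_left_mono) auto
    ultimately have "psi_root z ^ k / sqrt (1 + z) \<le> 1 + F" by simp
    moreover have "psi_root z ^ k * sqrt (1 + z) \<le> 1 + 3 / 2 * F"
      using B(2) quad lin2 unfolding Fe by (simp add: algebra_simps)
    ultimately show ?thesis by blast
  qed
  have "d0 ^ (k - 1) / sqrt u * (psi_root z ^ k / sqrt (1 + z)) \<le> d0 ^ (k - 1) / sqrt u * (1 + F)"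
    using G d0 u by (intro mult_left_mono) auto
  also have "\<dots> = d0 ^ (k - 1) / sqrt u + d0 ^ (k - 1) / sqrt u * F" by (simp only: distrib_left mult_1_right)
  also have "\<dots> \<le> d0 ^ (k - 1) / sqrt u + (1 / 2) ^ (k - 1) / sqrt u * F"
    using d0 u F0 by (intro add_left_mono mult_right_mono divide_right_mono power_mono) auto
  finally show "(sqrt D / (u - 2 * \<rho>)) ^ (k - 1) / sqrt (u - 2 * \<rho>)
      \<le> (sqrt (a * b) / u) ^ (k - 1) / sqrt u + (1 / 2) ^ (k - 1) / sqrt u * F"
    using T1 by (simp add: d0_def)
  have "d0 ^ (k + 1) * sqrt u * (psi_root z ^ k * sqrt (1 + z)) \<le> d0 ^ (k + 1) * sqrt u * (1 + 3 / 2 * F)"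
    using G d0 u by (intro mult_left_mono) auto
  also have "\<dots> = d0 ^ (k + 1) * sqrt u + d0 ^ (k + 1) * sqrt u * (3 / 2 * F)" by (simp add: algebra_simps)
  also have "\<dots> \<le> d0 ^ (k + 1) * sqrt u + (1 / 2) ^ (k + 1) * sqrt u * (3 / 2 * F)"
    using d0 u F0 by (intro add_left_mono mult_right_mono power_mono) auto
  finally show "(sqrt D / (u - 2 * \<rho>)) ^ (k + 1) * sqrt (u - 2 * \<rho>)
      \<le> (sqrt (a * b) / u) ^ (k + 1) * sqrt u + (1 / 2) ^ (k + 1) * sqrt u * (3 / 2 * F)"
    using T2 by (simp add: d0_def)
qed

section \<open>Gaussian densities\<close>

definition gauss :: "real \<Rightarrow> real ^ 'k \<Rightarrow> real" where
  "gauss v y = exp (- (y \<bullet> y) / (2 * v)) / sqrt ((2 * pi * v) ^ CARD('k))"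

lemma gauss_pos: "0 < v \<Longrightarrow> 0 < gauss v y"
  by (simp add: gauss_def)

lemma gauss_nonneg: "0 < v \<Longrightarrow> 0 \<le> gauss v y"
  by (simp add: gauss_def)

lemma gauss_le: "0 < v \<Longrightarrow> gauss v (y :: real ^ 'k) \<le> 1 / sqrt ((2 * pi * v) ^ CARD('k))"
  unfolding gauss_def by (intro divide_right_mono) auto

lemma borel_measurable_gauss [measurable]: "gauss v \<in> borel_measurable borel"
  unfolding gauss_def[abs_def] by measurable

lemma gauss_shift_eq_prod:
  fixes y \<mu> :: "real ^ 'k"
  assumes "0 < v"
  shows "gauss v (y - \<mu>) = (\<Prod>i\<in>UNIV. normal_density (\<mu> $ i) (sqrt v) (y $ i))"
proof -
  have "(\<Prod>i\<in>UNIV. normal_density (\<mu> $ i) (sqrt v) (y $ i))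
      = (\<Prod>i\<in>(UNIV::'k set). 1 / sqrt (2 * pi * v)) * (\<Prod>i\<in>UNIV. exp (- (y $ i - \<mu> $ i)\<^sup>2 / (2 * v)))"
    using assms by (simp add: normal_density_def prod_dividef power_divide)
  also have "(\<Prod>i\<in>UNIV. exp (- (y $ i - \<mu> $ i)\<^sup>2 / (2 * v))) = exp (\<Sum>i\<in>UNIV. - (y $ i - \<mu> $ i)\<^sup>2 / (2 * v))"
    by (simp add: exp_sum)
  also have "(\<Sum>i\<in>UNIV. - (y $ i - \<mu> $ i)\<^sup>2 / (2 * v)) = - ((y - \<mu>) \<bullet> (y - \<mu>)) / (2 * v)"
    by (simp add: inner_vec_def sum_divide_distrib[symmetric] sum_negf power2_eq_square)
  finally show ?thesis by (simp add: gauss_def real_sqrt_power power_divide)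
qed

lemma mat_mult_mat: "(mat a :: real ^ 'k ^ 'k) ** B = (\<chi> i j. a * B $ i $ j)"
  by (simp add: matrix_matrix_mult_def mat_def vec_eq_iff if_distrib[where f="\<lambda>x. x * _"] sum.delta cong: if_cong)

text \<open>\<open>matrix_inv\<close> is defined by choice: the scalar inverse shows that a choice
  exists, and the equation it satisfies determines its entries.\<close>

lemma matrix_inv_mat:
  assumes "v \<noteq> (0::real)"
  shows "matrix_inv (mat v :: real ^ 'k ^ 'k) = mat (1 / v)"
proof -
  have "(mat v :: real^'k^'k) ** mat (1/v) = mat 1 \<and> (mat (1/v) :: real^'k^'k) ** mat v = mat 1"
    using assms by (simp add: mat_mult_mat) (simp add: mat_def vec_eq_iff)
  then have "\<exists>A'. (mat v :: real^'k^'k) ** A' = mat 1 \<and> A' ** mat v = mat 1" by blast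
  then have "(mat v :: real^'k^'k) ** matrix_inv (mat v) = mat 1"
    unfolding matrix_inv_def by (rule someI2_ex) simp
  then have e: "v * matrix_inv (mat v :: real^'k^'k) $ i $ j = (mat 1 :: real^'k^'k) $ i $ j" for i j
    by (simp add: mat_mult_mat vec_eq_iff)
  have "matrix_inv (mat v :: real^'k^'k) $ i $ j = (mat (1/v) :: real^'k^'k) $ i $ j" for i j
    using e[of i j] assms by (cases "i = j") (auto simp: mat_def field_simps)
  then show ?thesis by (simp add: vec_eq_iff)
qed

lemma mv_normal_mat:
  assumes "0 < v"
  shows "mv_normal 0 (mat v :: real ^ 'k ^ 'k) = density lborel (\<lambda>y. ennreal (gauss v y))"
proof -
  have 1: "mat (1 / v) *v y = (1 / v) *\<^sub>R y" for y :: "real ^ 'k"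
    by (simp add: matrix_vector_mult_def mat_def vec_eq_iff if_distrib[where f="\<lambda>x. x * _"] sum.delta cong: if_cong)
  have "det (mat v :: real ^ 'k ^ 'k) = (\<Prod>i\<in>(UNIV::'k set). (mat v :: real ^ 'k ^ 'k) $ i $ i)"
    by (rule det_diagonal) (simp add: mat_def)
  then have 2: "det (mat v :: real ^ 'k ^ 'k) = v ^ CARD('k)" by (simp add: mat_def)
  show ?thesis using assms
    by (simp add: mv_normal_def matrix_inv_mat 1 2 gauss_def[abs_def] power_mult_distrib mult_ac)
qed

section \<open>Moments of isotropic Gaussian densities\<close>

lemma nn_integral_vec_prod:
  fixes f :: "'k::finite \<Rightarrow> real \<Rightarrow> ennreal"
  assumes [measurable]: "\<And>i. f i \<in> borel_measurable borel"
  shows "(\<integral>\<^sup>+x. (\<Prod>i\<in>UNIV. f i (x $ i)) \<partial>(lborel :: (real ^ 'k) measure)) = (\<Prod>i\<in>UNIV. \<integral>\<^sup>+x. f i x \<partial>lborel)"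
proof -
  \<comment> \<open>The library formula is indexed by basis vectors; the description operator
    recovers the coordinate from the vector.\<close>
  define F where "F = (\<lambda>b::real ^ 'k. f (THE i. b = axis i 1))"
  have ax: "(THE j. (axis i 1 :: real ^ 'k) = axis j 1) = i" for i
    by (rule the_equality) (auto simp: axis_eq_axis)
  have Fa: "F (axis i 1) = f i" for i by (simp add: F_def ax)
  have B: "(Basis :: (real ^ 'k) set) = (\<lambda>i. axis i 1) ` UNIV"
    by (auto simp: Basis_vec_def)
  have inj: "inj (\<lambda>i::'k. axis i (1::real))" by (auto simp: inj_def axis_eq_axis)
  have "(\<integral>\<^sup>+x. (\<Prod>b\<in>Basis. F b (x \<bullet> b)) \<partial>(lborel :: (real ^ 'k) measure)) = (\<Prod>b\<in>Basis. \<integral>\<^sup>+x. F b x \<partial>lborel)"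
    by (rule nn_integral_lborel_prod) (auto simp: F_def)
  then show ?thesis
    unfolding B prod.reindex[OF inj] o_def Fa by (simp add: inner_axis)
qed

lemma normal_second_moment:
  assumes "0 < v"
  shows "(\<integral>\<^sup>+x. ennreal (normal_density \<mu> (sqrt v) x) \<partial>lborel) = 1"
    and "(\<integral>\<^sup>+x. ennreal (normal_density \<mu> (sqrt v) x * (x - c)\<^sup>2) \<partial>lborel) = ennreal (v + (\<mu> - c)\<^sup>2)"
proof -
  have s: "0 < sqrt v" using assms by simp
  show "(\<integral>\<^sup>+x. ennreal (normal_density \<mu> (sqrt v) x) \<partial>lborel) = 1"
    using s by (subst nn_integral_eq_integral) auto
  have e: "normal_density \<mu> (sqrt v) x * (x - \<mu>)\<^sup>2 + (2 * (\<mu> - c) * (normal_density \<mu> (sqrt v) x * x)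
       + (c\<^sup>2 - \<mu>\<^sup>2) * normal_density \<mu> (sqrt v) x) = normal_density \<mu> (sqrt v) x * (x - c)\<^sup>2" for x
    by (simp add: power2_eq_square algebra_simps)
  have h0: "has_bochner_integral lborel (normal_density \<mu> (sqrt v)) 1"
    using s by (simp add: has_bochner_integral_iff)
  have h2: "has_bochner_integral lborel (\<lambda>x. normal_density \<mu> (sqrt v) x * (x - \<mu>)\<^sup>2) v"
    using normal_moment_even[OF s, of \<mu> 1] assms by (simp add: numeral_2_eq_2)
  have "has_bochner_integral lborel (\<lambda>x. normal_density \<mu> (sqrt v) x * (x - \<mu>)\<^sup>2 + (2 * (\<mu> - c) * (normal_density \<mu> (sqrt v) x * x)
       + (c\<^sup>2 - \<mu>\<^sup>2) * normal_density \<mu> (sqrt v) x)) (v + (2 * (\<mu> - c) * \<mu> + (c\<^sup>2 - \<mu>\<^sup>2) * 1))"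
    by (intro has_bochner_integral_add has_bochner_integral_mult_right h2 h0 normal_moment_nz_1 s)
  then have "has_bochner_integral lborel (\<lambda>x. normal_density \<mu> (sqrt v) x * (x - c)\<^sup>2) (v + (\<mu> - c)\<^sup>2)"
    unfolding e by (simp add: power2_eq_square algebra_simps)
  then show "(\<integral>\<^sup>+x. ennreal (normal_density \<mu> (sqrt v) x * (x - c)\<^sup>2) \<partial>lborel) = ennreal (v + (\<mu> - c)\<^sup>2)"
    by (subst nn_integral_eq_integral) (auto simp: has_bochner_integral_iff)
qed

lemma gauss_integral:
  fixes \<mu> :: "real ^ 'k"
  assumes "0 < v"
  shows "has_bochner_integral lborel (\<lambda>y. gauss v (y - \<mu>)) 1"
proof -
  have "(\<integral>\<^sup>+y. ennreal (gauss v (y - \<mu>)) \<partial>lborel) = 1"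
    using assms unfolding gauss_shift_eq_prod[OF assms] prod_ennreal[OF normal_density_nonneg, symmetric]
    by (subst nn_integral_vec_prod) (auto simp: normal_second_moment)
  then show ?thesis
    using assms by (intro has_bochner_integral_nn_integral) (auto simp: gauss_nonneg)
qed

lemma gauss_second_moment:
  fixes \<mu> c :: "real ^ 'k" and v :: real
  assumes "0 < v"
  shows "has_bochner_integral lborel (\<lambda>y. gauss v (y - \<mu>) * ((y - c) \<bullet> (y - c))) (real CARD('k) * v + (\<mu> - c) \<bullet> (\<mu> - c))"
proof -
  \<comment> \<open>Density times squared distance is a sum over \<open>i\<close> of products over
    \<open>j\<close> in which only the factor \<open>j = i\<close> carries a square, so each summand
    integrates coordinatewise.\<close>
  define h where "h = (\<lambda>i j x. normal_density (\<mu> $ j) (sqrt v) x * (if j = i then (x - c $ j)\<^sup>2 else 1))"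
  have hn: "0 \<le> h i j x" for i j x by (simp add: h_def)
  have hm[measurable]: "h i j \<in> borel_measurable borel" for i j unfolding h_def by measurable
  have eq: "gauss v (y - \<mu>) * ((y - c) \<bullet> (y - c)) = (\<Sum>i\<in>UNIV. \<Prod>j\<in>UNIV. h i j (y $ j))" for y
  proof -
    have "(\<Prod>j\<in>UNIV. h i j (y $ j)) = gauss v (y - \<mu>) * (y $ i - c $ i)\<^sup>2" for i
      using assms by (simp add: h_def prod.distrib gauss_shift_eq_prod prod.delta)
    then show ?thesis by (simp add: sum_distrib_left inner_vec_def power2_eq_square)
  qed
  have int: "(\<integral>\<^sup>+x. ennreal (h i j x) \<partial>lborel) = ennreal (if j = i then v + (\<mu> $ j - c $ j)\<^sup>2 else 1)" for i j
    using assms by (simp add: h_def normal_second_moment)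
  have "(\<integral>\<^sup>+y. ennreal (gauss v (y - \<mu>) * ((y - c) \<bullet> (y - c))) \<partial>lborel)
      = (\<integral>\<^sup>+y. (\<Sum>i\<in>UNIV. \<Prod>j\<in>UNIV. ennreal (h i j (y $ j))) \<partial>lborel)"
    unfolding eq by (simp add: sum_ennreal prod_ennreal prod_nonneg hn)
  also have "\<dots> = (\<Sum>i\<in>UNIV. \<integral>\<^sup>+y. (\<Prod>j\<in>UNIV. ennreal (h i j (y $ j))) \<partial>lborel)"
    by (rule nn_integral_sum) measurable
  also have "\<dots> = (\<Sum>i\<in>UNIV. \<Prod>j\<in>UNIV. ennreal (if j = i then v + (\<mu> $ j - c $ j)\<^sup>2 else 1))"
    by (subst nn_integral_vec_prod) (simp_all add: int)
  also have "\<dots> = (\<Sum>i\<in>UNIV. ennreal (v + (\<mu> $ i - c $ i)\<^sup>2))"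
    using assms by (subst prod_ennreal) (auto simp: prod.delta)
  also have "\<dots> = ennreal (real CARD('k) * v + (\<mu> - c) \<bullet> (\<mu> - c))"
    using assms by (subst sum_ennreal) (auto simp: sum.distrib inner_vec_def power2_eq_square)
  finally show ?thesis
    using assms by (intro has_bochner_integral_nn_integral) (auto simp: gauss_nonneg)
qed

section \<open>Averaging Gaussian pairs over Gaussian coefficients\<close>

text \<open>Density of a centred Gaussian pair with variances \<open>a\<close>, \<open>b\<close> and covariance \<open>c\<close>.\<close>
definition bivariate :: "real \<Rightarrow> real \<Rightarrow> real \<Rightarrow> real \<Rightarrow> real \<Rightarrow> real" where
  "bivariate a b c x y = exp (- (b * x\<^sup>2 - 2 * c * x * y + a * y\<^sup>2) / (2 * (a * b - c\<^sup>2))) / (2 * pi * sqrt (a * b - c\<^sup>2))"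

text \<open>Adding \<open>s\<close> times the outer square of \<open>(x1, x2)\<close> to the
  covariance raises the determinant by \<open>s * P\<close>, and \<open>a * P\<close> is a completed
  square plus the old determinant times a square.\<close>

lemma bivariate_det_step:
  fixes a b c s x1 x2 :: real
  assumes "0 < s" "0 < a" "0 < a * b - c\<^sup>2"
  shows "0 < (a + s * x1\<^sup>2) * (b + s * x2\<^sup>2) - (c + s * (x1 * x2))\<^sup>2"
proof -
  define P where "P = b * x1\<^sup>2 - 2 * c * x1 * x2 + a * x2\<^sup>2"
  have "a * P = (a * x2 - c * x1)\<^sup>2 + (a * b - c\<^sup>2) * x1\<^sup>2"
    unfolding P_def by algebra
  also have "\<dots> \<ge> 0" using assms by simp
  finally have "0 \<le> P" using assms by (simp add: zero_le_mult_iff)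
  moreover have "(a + s * x1\<^sup>2) * (b + s * x2\<^sup>2) - (c + s * (x1 * x2))\<^sup>2 = (a * b - c\<^sup>2) + s * P"
    unfolding P_def by algebra
  ultimately show ?thesis using assms by (simp add: add_pos_nonneg)
qed

text \<open>A common Gaussian coefficient \<theta> along \<open>(x1, x2)\<close> updates the
  covariance matrix by a rank-one term. Completing the square in \<theta> splits the product of
  densities into the updated density and a normal density in \<theta>, which integrates to
  1.\<close>

lemma bivariate_step:
  fixes a b c s x1 x2 y1 y2 :: real
  assumes s: "0 < s" and a: "0 < a" and D: "0 < a * b - c\<^sup>2"
  shows "(\<integral>\<^sup>+\<theta>. ennreal (bivariate a b c (y1 - \<theta> * x1) (y2 - \<theta> * x2)) \<partial>density lborel (\<lambda>\<theta>. ennreal (normal_density 0 (sqrt s) \<theta>)))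
    = ennreal (bivariate (a + s * x1\<^sup>2) (b + s * x2\<^sup>2) (c + s * (x1 * x2)) y1 y2)"
proof -
  define D where "D = a * b - c\<^sup>2"
  define D' where "D' = (a + s * x1\<^sup>2) * (b + s * x2\<^sup>2) - (c + s * (x1 * x2))\<^sup>2"
  define E where "E = b * x1 * y1 - c * (x1 * y2 + x2 * y1) + a * x2 * y2"
  define P where "P = b * x1\<^sup>2 - 2 * c * x1 * x2 + a * x2\<^sup>2"
  define Q where "Q = b * y1\<^sup>2 - 2 * c * y1 * y2 + a * y2\<^sup>2"
  define Q' where "Q' = (b + s * x2\<^sup>2) * y1\<^sup>2 - 2 * (c + s * (x1 * x2)) * y1 * y2 + (a + s * x1\<^sup>2) * y2\<^sup>2"
  have Dp: "0 < D" "0 < D'" using bivariate_det_step[OF s a D] D by (auto simp: D_def D'_def)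
  have D'e: "D' = D + s * P" unfolding D'_def D_def P_def by algebra
  \<comment> \<open>Quadratic form of the inverse of a rank-one update (Sherman--Morrison), with
    denominators cleared.\<close>
  have QQ: "Q * D' = s * E\<^sup>2 + Q' * D" unfolding D'_def D_def Q_def Q'_def E_def by algebra
  have Qt: "b * (y1 - \<theta> * x1)\<^sup>2 - 2 * c * (y1 - \<theta> * x1) * (y2 - \<theta> * x2) + a * (y2 - \<theta> * x2)\<^sup>2 = Q - 2 * \<theta> * E + \<theta>\<^sup>2 * P" for \<theta>
    unfolding Q_def E_def P_def by algebra
  \<comment> \<open>\<open>v\<close> and \<open>m\<close> are the variance and mean of \<theta>
    given the two observed values.\<close>
  define v where "v = s * D / D'"
  define m where "m = s * E / D'"
  have v: "0 < v" using s Dp by (simp add: v_def)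
  have ex: "- \<theta>\<^sup>2 / (2 * s) + - (Q - 2 * \<theta> * E + \<theta>\<^sup>2 * P) / (2 * D) = - (\<theta> - m)\<^sup>2 / (2 * v) + - Q' / (2 * D')" for \<theta>
  proof -
    have Q'e: "Q' = (Q * D' - s * E\<^sup>2) / D" using QQ Dp by (simp add: field_simps)
    have "- (\<theta> - m)\<^sup>2 / (2 * v) = - (\<theta>\<^sup>2 * D' / (s * D) - 2 * \<theta> * E / D + s * E\<^sup>2 / (D * D')) / 2"
      using s Dp by (simp add: v_def m_def field_simps power2_eq_square)
    moreover have "\<theta>\<^sup>2 * D' / (s * D) = \<theta>\<^sup>2 / s + \<theta>\<^sup>2 * P / D" unfolding D'e using s Dp by (simp add: field_simps)
    moreover have "Q' / D' = Q / D - s * E\<^sup>2 / (D * D')" unfolding Q'e using Dp by (simp add: field_simps)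
    moreover have "- Q' / (2 * D') = - (Q' / D') / 2" by simp
    moreover have "- (Q - 2 * \<theta> * E + \<theta>\<^sup>2 * P) / (2 * D) = - (Q / D - 2 * \<theta> * E / D + \<theta>\<^sup>2 * P / D) / 2"
      by (simp add: diff_divide_distrib add_divide_distrib)
    moreover have "- \<theta>\<^sup>2 / (2 * s) = - (\<theta>\<^sup>2 / s) / 2" by simp
    \<comment> \<open>With the quotients above as atoms, the identity of the exponents is
      linear.\<close>
    moreover have "\<And>A B C F G H L q r w z. \<lbrakk>(L::real) = - (A - B + C) / 2; A = H + F; q = G - C; r = - q / 2;
       w = - (G - B + F) / 2; z = - H / 2\<rbrakk> \<Longrightarrow> z + w = L + r" by (simp add: field_simps)
    ultimately show ?thesis by metis
  qed
  have nm: "sqrt (2 * pi * s) * (2 * pi * sqrt D) = sqrt (2 * pi * v) * (2 * pi * sqrt D')"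
  proof -
    have "s * D = v * D'" using Dp by (simp add: v_def)
    then have "sqrt (s * D) = sqrt (v * D')" by simp
    then show ?thesis by (simp add: real_sqrt_mult mult_ac)
  qed
  have eq: "normal_density 0 (sqrt s) \<theta> * bivariate a b c (y1 - \<theta> * x1) (y2 - \<theta> * x2)
      = bivariate (a + s * x1\<^sup>2) (b + s * x2\<^sup>2) (c + s * (x1 * x2)) y1 y2 * normal_density m (sqrt v) \<theta>" for \<theta>
  proof -
    have "normal_density 0 (sqrt s) \<theta> * bivariate a b c (y1 - \<theta> * x1) (y2 - \<theta> * x2)
       = exp (- \<theta>\<^sup>2 / (2 * s) + - (Q - 2 * \<theta> * E + \<theta>\<^sup>2 * P) / (2 * D)) / (sqrt (2 * pi * s) * (2 * pi * sqrt D))"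
      using s unfolding exp_add bivariate_def Qt D_def[symmetric] normal_density_def by simp
    also have "\<dots> = exp (- (\<theta> - m)\<^sup>2 / (2 * v)) * exp (- Q' / (2 * D')) / (sqrt (2 * pi * v) * (2 * pi * sqrt D'))"
      unfolding ex nm exp_add ..
    finally show ?thesis
      using v unfolding bivariate_def D'_def[symmetric] Q'_def[symmetric] normal_density_def
      by (simp add: mult_ac)
  qed
  have nn: "0 \<le> bivariate (a + s * x1\<^sup>2) (b + s * x2\<^sup>2) (c + s * (x1 * x2)) y1 y2"
    using Dp unfolding bivariate_def D'_def[symmetric] by simp
  have [measurable]: "(\<lambda>\<theta>. bivariate a b c (y1 - \<theta> * x1) (y2 - \<theta> * x2)) \<in> borel_measurable borel"
    unfolding bivariate_def by measurable
  have "(\<integral>\<^sup>+\<theta>. ennreal (bivariate a b c (y1 - \<theta> * x1) (y2 - \<theta> * x2)) \<partial>density lborel (\<lambda>\<theta>. ennreal (normal_density 0 (sqrt s) \<theta>)))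
    = (\<integral>\<^sup>+\<theta>. ennreal (normal_density 0 (sqrt s) \<theta> * bivariate a b c (y1 - \<theta> * x1) (y2 - \<theta> * x2)) \<partial>lborel)"
    by (subst nn_integral_density) (auto simp: ennreal_mult')
  also have "\<dots> = (\<integral>\<^sup>+\<theta>. ennreal (bivariate (a + s * x1\<^sup>2) (b + s * x2\<^sup>2) (c + s * (x1 * x2)) y1 y2) * ennreal (normal_density m (sqrt v) \<theta>) \<partial>lborel)"
    unfolding eq using nn by (simp add: ennreal_mult')
  also have "\<dots> = ennreal (bivariate (a + s * x1\<^sup>2) (b + s * x2\<^sup>2) (c + s * (x1 * x2)) y1 y2)"
    using normal_second_moment(1)[OF v] by (subst nn_integral_cmult) auto
  finally show ?thesis .
qed

text \<open>Entries are integrated one at a time: the entry at \<open>(i, j)\<close> meets only row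
  \<open>i\<close>, where \<open>bivariate_step\<close> turns it into a rank-one update.
  \<open>y1\<close> and \<open>y2\<close> are arbitrary in the induction because an entry shifts
  them, and positivity of the determinants travels along because each step requires it.\<close>

lemma nn_integral_PiM_bivariate:
  fixes x1 x2 :: "'n::finite \<Rightarrow> real" and y1 y2 :: "'k::finite \<Rightarrow> real" and S :: "('k \<times> 'n) set"
  assumes s: "0 < s" and t: "0 < t"
  shows "(\<integral>\<^sup>+\<theta>. (\<Prod>i\<in>UNIV. ennreal (bivariate t t 0
           (y1 i - (\<Sum>p\<in>S. if fst p = i then \<theta> p * x1 (snd p) else 0))
           (y2 i - (\<Sum>p\<in>S. if fst p = i then \<theta> p * x2 (snd p) else 0))))
         \<partial>PiM S (\<lambda>_. density lborel (\<lambda>\<theta>. ennreal (normal_density 0 (sqrt s) \<theta>))))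
    = (\<Prod>i\<in>UNIV. ennreal (bivariate (t + s * (\<Sum>p\<in>S. if fst p = i then (x1 (snd p))\<^sup>2 else 0))
        (t + s * (\<Sum>p\<in>S. if fst p = i then (x2 (snd p))\<^sup>2 else 0))
        (s * (\<Sum>p\<in>S. if fst p = i then x1 (snd p) * x2 (snd p) else 0)) (y1 i) (y2 i)))
      \<and> (\<forall>i. 0 < (t + s * (\<Sum>p\<in>S. if fst p = i then (x1 (snd p))\<^sup>2 else 0)) *
        (t + s * (\<Sum>p\<in>S. if fst p = i then (x2 (snd p))\<^sup>2 else 0)) -
        (s * (\<Sum>p\<in>S. if fst p = i then x1 (snd p) * x2 (snd p) else 0))\<^sup>2)"
  (is "?I S y1 y2 = ?R S y1 y2 \<and> ?D S")
proof -
  define G where "G = density lborel (\<lambda>\<theta>. ennreal (normal_density 0 (sqrt s) \<theta>))"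
  have pG: "prob_space G" unfolding G_def using s by (intro prob_space_normal_density) simp
  interpret product_sigma_finite "\<lambda>_::'k \<times> 'n. G"
    unfolding product_sigma_finite_def using pG by (simp add: prob_space_imp_sigma_finite)
  have [measurable_cong]: "sets G = sets borel" by (simp add: G_def)
  have fin: "finite S" by simp
  then show ?thesis unfolding G_def[symmetric]
  proof (induction S arbitrary: y1 y2 rule: finite_induct)
    case empty
    show ?case using t by (simp add: PiM_empty)
  next
    case (insert q S)
    obtain i0 j0 where q: "q = (i0, j0)" by (cases q)
    let ?A = "\<lambda>x::'n\<Rightarrow>real. \<lambda>i. \<Sum>p\<in>S. if fst p = i then (x (snd p))\<^sup>2 else 0"
    let ?C = "\<lambda>i. \<Sum>p\<in>S. if fst p = i then x1 (snd p) * x2 (snd p) else 0"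
    let ?T = "\<lambda>x::'n\<Rightarrow>real. \<lambda>\<theta> i. \<Sum>p\<in>S. if fst p = i then \<theta> p * x (snd p) else 0"
    let ?Ti = "\<lambda>x::'n\<Rightarrow>real. \<lambda>\<theta> i. \<Sum>p\<in>insert q S. if fst p = i then \<theta> p * x (snd p) else 0"
    have Tup: "?Ti x (\<theta>(q := z)) i = (if i = i0 then z * x j0 else 0) + ?T x \<theta> i" for x \<theta> z i
    proof -
      have "?T x (\<theta>(q := z)) i = ?T x \<theta> i" using insert(2) by (intro sum.cong) auto
      then show ?thesis using insert(1,2) q by simp
    qed
    define Y1 where "Y1 = (\<lambda>z i. y1 i - (if i = i0 then z * x1 j0 else 0))"
    define Y2 where "Y2 = (\<lambda>z i. y2 i - (if i = i0 then z * x2 j0 else 0))"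
    let ?B = "\<lambda>i. bivariate (t + s * ?A x1 i) (t + s * ?A x2 i) (s * ?C i)"
    have [measurable]: "(\<lambda>\<theta>. bivariate t t 0 (y1 i - ?Ti x1 \<theta> i) (y2 i - ?Ti x2 \<theta> i)) \<in> borel_measurable (PiM (insert q S) (\<lambda>_. G))" for i
      unfolding bivariate_def by measurable
    have [measurable]: "(\<lambda>z. ?B i (y - z * c) (y' - z * c')) \<in> borel_measurable borel" for i y c y' c'
      unfolding bivariate_def by measurable
    have "(\<integral>\<^sup>+\<theta>. (\<Prod>i\<in>UNIV. ennreal (bivariate t t 0 (y1 i - ?Ti x1 \<theta> i) (y2 i - ?Ti x2 \<theta> i))) \<partial>PiM (insert q S) (\<lambda>_. G))
      = (\<integral>\<^sup>+z. (\<integral>\<^sup>+\<theta>. (\<Prod>i\<in>UNIV. ennreal (bivariate t t 0 (y1 i - ?Ti x1 (\<theta>(q := z)) i) (y2 i - ?Ti x2 (\<theta>(q := z)) i))) \<partial>PiM S (\<lambda>_. G)) \<partial>G)"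
      by (rule product_nn_integral_insert_rev[OF insert(1,2)]) measurable
    also have "\<dots> = (\<integral>\<^sup>+z. (\<integral>\<^sup>+\<theta>. (\<Prod>i\<in>UNIV. ennreal (bivariate t t 0 (Y1 z i - ?T x1 \<theta> i) (Y2 z i - ?T x2 \<theta> i))) \<partial>PiM S (\<lambda>_. G)) \<partial>G)"
      unfolding Tup Y1_def Y2_def diff_diff_eq ..
    also have "\<dots> = (\<integral>\<^sup>+z. (\<Prod>i\<in>UNIV. ennreal (?B i (Y1 z i) (Y2 z i))) \<partial>G)"
      using insert.IH by simp
    also have "\<dots> = (\<integral>\<^sup>+z. (\<Prod>i\<in>UNIV - {i0}. ennreal (?B i (y1 i) (y2 i))) * ennreal (?B i0 (y1 i0 - z * x1 j0) (y2 i0 - z * x2 j0)) \<partial>G)"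
    proof (intro nn_integral_cong)
      fix z
      have "(\<Prod>i\<in>UNIV. ennreal (?B i (Y1 z i) (Y2 z i))) = ennreal (?B i0 (Y1 z i0) (Y2 z i0)) * (\<Prod>i\<in>UNIV - {i0}. ennreal (?B i (Y1 z i) (Y2 z i)))"
        by (rule prod.remove) auto
      also have "(\<Prod>i\<in>UNIV - {i0}. ennreal (?B i (Y1 z i) (Y2 z i))) = (\<Prod>i\<in>UNIV - {i0}. ennreal (?B i (y1 i) (y2 i)))"
        by (intro prod.cong) (auto simp: Y1_def Y2_def)
      finally show "(\<Prod>i\<in>UNIV. ennreal (?B i (Y1 z i) (Y2 z i))) = (\<Prod>i\<in>UNIV - {i0}. ennreal (?B i (y1 i) (y2 i))) * ennreal (?B i0 (y1 i0 - z * x1 j0) (y2 i0 - z * x2 j0))"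
        by (simp add: Y1_def Y2_def mult.commute)
    qed
    also have "\<dots> = (\<Prod>i\<in>UNIV - {i0}. ennreal (?B i (y1 i) (y2 i))) * (\<integral>\<^sup>+z. ennreal (?B i0 (y1 i0 - z * x1 j0) (y2 i0 - z * x2 j0)) \<partial>G)"
      by (rule nn_integral_cmult) measurable
    also have "(\<integral>\<^sup>+z. ennreal (?B i0 (y1 i0 - z * x1 j0) (y2 i0 - z * x2 j0)) \<partial>G)
      = ennreal (bivariate (t + s * ?A x1 i0 + s * (x1 j0)\<^sup>2) (t + s * ?A x2 i0 + s * (x2 j0)\<^sup>2) (s * ?C i0 + s * (x1 j0 * x2 j0)) (y1 i0) (y2 i0))"
    proof -
      have "0 < t + s * ?A x1 i0" using s t by (intro add_pos_nonneg mult_nonneg_nonneg sum_nonneg) auto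
      then show ?thesis unfolding G_def using insert.IH s by (intro bivariate_step) auto
    qed
    also have "(\<Prod>i\<in>UNIV - {i0}. ennreal (?B i (y1 i) (y2 i))) * \<dots> = ?R (insert q S) y1 y2"
      (is "?P * ?Z = _")
    proof -
      let ?W = "\<lambda>S i. ennreal (bivariate (t + s * (\<Sum>p\<in>S. if fst p = i then (x1 (snd p))\<^sup>2 else 0))
        (t + s * (\<Sum>p\<in>S. if fst p = i then (x2 (snd p))\<^sup>2 else 0))
        (s * (\<Sum>p\<in>S. if fst p = i then x1 (snd p) * x2 (snd p) else 0)) (y1 i) (y2 i))"
      have "?R (insert q S) y1 y2 = ?W (insert q S) i0 * (\<Prod>i\<in>UNIV - {i0}. ?W (insert q S) i)"
        by (rule prod.remove) auto
      also have "(\<Prod>i\<in>UNIV - {i0}. ?W (insert q S) i) = ?P"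
        using insert(1,2) q by (intro prod.cong) auto
      also have "?W (insert q S) i0 = ?Z"
        using insert(1,2) q by (simp add: distrib_left add_ac)
      finally show ?thesis by (simp add: mult.commute)
    qed
    finally have 1: "?I (insert q S) y1 y2 = ?R (insert q S) y1 y2" unfolding G_def .
    have 2: "?D (insert q S)"
    proof
      fix i
      have IH: "0 < (t + s * ?A x1 i) * (t + s * ?A x2 i) - (s * ?C i)\<^sup>2" using insert.IH by blast
      have "0 < t + s * ?A x1 i" using s t by (intro add_pos_nonneg mult_nonneg_nonneg sum_nonneg) auto
      from bivariate_det_step[OF s this IH, of "x1 j0" "x2 j0"] IH
      show "0 < (t + s * (\<Sum>p\<in>insert q S. if fst p = i then (x1 (snd p))\<^sup>2 else 0)) *
        (t + s * (\<Sum>p\<in>insert q S. if fst p = i then (x2 (snd p))\<^sup>2 else 0)) -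
        (s * (\<Sum>p\<in>insert q S. if fst p = i then x1 (snd p) * x2 (snd p) else 0))\<^sup>2"
        using insert(1,2) q by (cases "i = i0") (simp_all add: distrib_left add_ac)
    qed
    show ?case using 1 2 unfolding G_def by blast
  qed
qed

section \<open>Polar coordinates\<close>

text \<open>The library states even Gaussian moments with factorials; the Gamma form is what
  duplication and log-convexity apply to later.\<close>

lemma Gamma_half_shift: "Gamma (real m + 1 / 2) = sqrt pi * (fact (2 * m) / (2 ^ (2 * m) * fact m))"
proof (induction m)
  case 0
  then show ?case by (simp add: Gamma_one_half_real)
next
  case (Suc m)
  have "Gamma ((real m + 1 / 2) + 1) = (real m + 1 / 2) * Gamma (real m + 1 / 2)"
    by (rule Gamma_plus1) (auto elim!: nonpos_Ints_cases simp: field_simps)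
  then have "Gamma (real (Suc m) + 1 / 2) = (real m + 1 / 2) * (sqrt pi * (fact (2 * m) / (2 ^ (2 * m) * fact m)))"
    using Suc by (simp add: add_ac)
  also have "\<dots> = sqrt pi * (((2 * real m + 2) * (2 * real m + 1) * fact (2 * m)) / (4 * 2 ^ (2 * m) * ((real m + 1) * fact m)))"
  proof -
    have "(real m + 1 / 2) * (s * (a / (p * b))) = s * (((2 * real m + 2) * (2 * real m + 1) * a) / (4 * p * ((real m + 1) * b)))"
      if "b \<noteq> 0" "p \<noteq> 0" for s a p b :: real
      using that by (simp add: divide_simps add_eq_0_iff) (simp add: algebra_simps)
    then show ?thesis by simp
  qed
  also have "\<dots> = sqrt pi * (fact (2 * Suc m) / (2 ^ (2 * Suc m) * fact (Suc m)))"
    by (simp add: algebra_simps)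
  finally show ?case .
qed

lemma half_line_gaussian_moment:
  assumes "0 < c"
  shows "(\<integral>\<^sup>+r. ennreal (r ^ (2 * m) * exp (- (c * r\<^sup>2))) * indicator {0..} r \<partial>lborel)
     = ennreal (Gamma (real m + 1 / 2) / 2 / sqrt c ^ (2 * m + 1))"
proof -
  let ?f = "\<lambda>x. ennreal (x ^ (2 * m) * exp (- (c * x\<^sup>2))) * indicator {0..} x"
  let ?g = "\<lambda>x. ennreal ((0 + sqrt c * x) ^ (2 * m) * exp (- (0 + sqrt c * x)\<^sup>2)) * indicator {0..} (0 + sqrt c * x)"
  define K where "K = Gamma (real m + 1 / 2) / 2"
  have K0: "0 \<le> K" by (simp add: K_def Gamma_real_pos less_imp_le add_pos_pos add_nonneg_pos)
  have sc: "0 < sqrt c" using assms by simp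
  have hb: "has_bochner_integral lborel (\<lambda>x::real. indicator {0..} x *\<^sub>R (exp (- x\<^sup>2) * x ^ (2 * m))) K"
    using gaussian_moment_even_pos[of m] by (simp add: K_def Gamma_half_shift mult_ac)
  have b: "(\<integral>\<^sup>+x. ennreal (x ^ (2 * m) * exp (- x\<^sup>2)) * indicator {0..} x \<partial>lborel) = ennreal K"
  proof -
    have "(\<integral>\<^sup>+x. ennreal (x ^ (2 * m) * exp (- x\<^sup>2)) * indicator {0..} x \<partial>lborel)
      = (\<integral>\<^sup>+x. ennreal (indicator {0..} x *\<^sub>R (exp (- x\<^sup>2) * x ^ (2 * m))) \<partial>lborel)"
      by (intro nn_integral_cong) (simp split: split_indicator add: mult.commute)
    also have "\<dots> = ennreal K"
      using hb by (subst nn_integral_eq_integral) (auto simp: has_bochner_integral_iff)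
    finally show ?thesis .
  qed
  have "ennreal K = ennreal (sqrt c) * (\<integral>\<^sup>+x. ?g x \<partial>lborel)"
    unfolding b[symmetric] using sc by (subst nn_integral_real_affine[where c="sqrt c" and t=0]) auto
  also have "(\<integral>\<^sup>+x. ?g x \<partial>lborel)
     = (\<integral>\<^sup>+x. ennreal (sqrt c ^ (2 * m)) * (?f x) \<partial>lborel)"
  proof (intro nn_integral_cong)
    fix x :: real
    have "(sqrt c * x)\<^sup>2 = c * x\<^sup>2" using assms by (simp add: power_mult_distrib)
    moreover have "indicator {0..} (sqrt c * x) = (indicator {0..} x :: ennreal)"
      using sc by (simp add: indicator_def zero_le_mult_iff)
    ultimately show "?g x
      = ennreal (sqrt c ^ (2 * m)) * (?f x)"
      using sc by (simp add: power_mult_distrib mult.assoc[symmetric] ennreal_mult'[symmetric])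
  qed
  also have "\<dots> = ennreal (sqrt c ^ (2 * m)) * (\<integral>\<^sup>+x. ?f x \<partial>lborel)"
    by (rule nn_integral_cmult) measurable
  finally have e: "ennreal K = ennreal (sqrt c ^ (2 * m + 1)) * (\<integral>\<^sup>+x. ?f x \<partial>lborel)"
    using sc by (simp add: mult.assoc[symmetric] ennreal_mult'[symmetric])
  have q: "ennreal (1 / sqrt c ^ (2 * m + 1)) * ennreal (sqrt c ^ (2 * m + 1)) = 1"
    using sc by (subst ennreal_mult'[symmetric]) auto
  have "ennreal (1 / sqrt c ^ (2 * m + 1)) * ennreal K = (ennreal (1 / sqrt c ^ (2 * m + 1)) * ennreal (sqrt c ^ (2 * m + 1))) * (\<integral>\<^sup>+x. ?f x \<partial>lborel)"
    unfolding e by (simp only: mult.assoc)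
  then show ?thesis unfolding q
    using sc K0 by (subst (asm) ennreal_mult'[symmetric]) (auto simp: K_def mult_ac)
qed

lemma half_line_cauchy_integral:
  assumes "0 < s"
  shows "(\<integral>\<^sup>+r. ennreal (1 / (1 + (r / s)\<^sup>2)) * indicator {0..} r \<partial>lborel) = ennreal (pi * s / 2)"
proof -
  have "(\<integral>\<^sup>+r. ennreal (1 / (1 + (r / s)\<^sup>2)) * indicator {0..} r \<partial>lborel) = ennreal (s * (pi / 2) - s * arctan (0 / s))"
  proof (rule nn_integral_FTC_atLeast)
    fix x :: real
    have "1 + (x / s)\<^sup>2 > 0" by (intro add_pos_nonneg) auto
    then show "DERIV (\<lambda>r. s * arctan (r / s)) x :> 1 / (1 + (x / s)\<^sup>2)" "0 \<le> 1 / (1 + (x / s)\<^sup>2)"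
      using assms by (auto intro!: derivative_eq_intros simp: inverse_eq_divide)
    have "((\<lambda>r. arctan (r / s)) \<longlongrightarrow> pi / 2) at_top"
      using filterlim_compose[OF tendsto_arctan_at_top filterlim_tendsto_pos_mult_at_top[OF tendsto_const[of "1 / s"] _ filterlim_ident]] assms
      by simp
    then show "((\<lambda>r. s * arctan (r / s)) \<longlongrightarrow> s * (pi / 2)) at_top" by (intro tendsto_intros)
  qed measurable
  then show ?thesis by (simp add: mult.commute)
qed

text \<open>The image of Lebesgue measure under the norm is determined by the sets
  \<open>{..b}\<close>, whose masses are the ball volumes \<open>V * b ^ k\<close>; the density on
  the half line is their derivative.\<close>

lemma nn_integral_radial:
  fixes h :: "real \<Rightarrow> ennreal"
  assumes [measurable]: "h \<in> borel_measurable borel"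
  shows "(\<integral>\<^sup>+y. h (norm y) \<partial>(lborel :: 'a::euclidean_space measure))
    = (\<integral>\<^sup>+r. ennreal (DIM('a) * unit_ball_vol (real DIM('a)) * r ^ (DIM('a) - 1)) * indicator {0..} r * h r \<partial>lborel)"
proof -
  let ?k = "DIM('a)"
  define V where "V = unit_ball_vol (real ?k)"
  have V: "0 < V" by (simp add: V_def)
  define f where "f = (\<lambda>r::real. real ?k * V * r ^ (?k - 1))"
  have [measurable]: "f \<in> borel_measurable borel" unfolding f_def by measurable
  have kpos: "0 < ?k" by simp
  have fA: "emeasure (density lborel (\<lambda>r. ennreal (f r) * indicator {0..} r)) {..b} = (if 0 \<le> b then ennreal (V * b ^ ?k) else 0)" for b
  proof (cases "0 \<le> b")
    case True
    have "emeasure (density lborel (\<lambda>r. ennreal (f r) * indicator {0..} r)) {..b} = (\<integral>\<^sup>+r. ennreal (f r) * indicator {0..b} r \<partial>lborel)"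
      by (subst emeasure_density) (auto intro!: nn_integral_cong split: split_indicator)
    also have "\<dots> = ennreal (V * b ^ ?k - V * 0 ^ ?k)"
    proof (rule nn_integral_FTC_Icc)
      fix x :: real assume "x \<in> {0..b}"
      show "DERIV (\<lambda>r. V * r ^ ?k) x :> f x"
        unfolding f_def by (auto intro!: derivative_eq_intros)
      show "0 \<le> f x" using \<open>x \<in> {0..b}\<close> V by (simp add: f_def)
    qed (use True in auto)
    finally show ?thesis using True kpos by (simp add: zero_power)
  next
    case False
    then have z: "(ennreal (f r) * indicator {0..} r) * indicator {..b} r = 0" for r
      by (auto split: split_indicator)
    have "emeasure (density lborel (\<lambda>r. ennreal (f r) * indicator {0..} r)) {..b}
        = (\<integral>\<^sup>+r. (ennreal (f r) * indicator {0..} r) * indicator {..b} r \<partial>lborel)"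
      by (rule emeasure_density) auto
    then have "emeasure (density lborel (\<lambda>r. ennreal (f r) * indicator {0..} r)) {..b} = 0"
      unfolding z by simp
    then show ?thesis using False by simp
  qed
  have dA: "emeasure (distr (lborel :: 'a measure) borel norm) {..b} = (if 0 \<le> b then ennreal (V * b ^ ?k) else 0)" for b
  proof -
    have "norm -` {..b} = (cball 0 b :: 'a set)" by auto
    then show ?thesis
      by (cases "0 \<le> b") (auto simp: emeasure_distr emeasure_cball V_def cball_empty)
  qed
  have "distr (lborel :: 'a measure) borel norm = density lborel (\<lambda>r. ennreal (f r) * indicator {0..} r)"
  proof (rule measure_eqI_generator_eq[where E="range (\<lambda>b::real. {..b})" and \<Omega>=UNIV and A="\<lambda>i::nat. {..real i}"])
    show "Int_stable (range (\<lambda>b::real. {..b}))" by (auto simp: Int_stable_def Int_atMost intro!: image_eqI)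
    show "sets (distr (lborel :: 'a measure) borel norm) = sigma_sets UNIV (range (\<lambda>b::real. {..b}))"
      by (simp add: borel_eq_atMost)
    show "sets (density lborel (\<lambda>r. ennreal (f r) * indicator {0..} r)) = sigma_sets UNIV (range (\<lambda>b::real. {..b}))"
      by (simp add: borel_eq_atMost)
    show "(\<Union>i::nat. {..real i}) = UNIV" by (auto simp: real_arch_simple)
    show "emeasure (distr (lborel :: 'a measure) borel norm) {..real i} \<noteq> \<infinity>" for i unfolding dA by simp
  qed (auto simp: dA fA)
  then have "(\<integral>\<^sup>+r. h r \<partial>distr (lborel :: 'a measure) borel norm) = (\<integral>\<^sup>+r. h r \<partial>density lborel (\<lambda>r. ennreal (f r) * indicator {0..} r))"
    by simp
  then show ?thesis
    by (simp add: nn_integral_distr nn_integral_density f_def V_def mult.assoc)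
qed

section \<open>Gamma estimates for the polar constant\<close>

text \<open>Log-convexity of Gamma at the midpoint of \<open>x\<close> and \<open>x + 1\<close>,
  followed by the recursion.\<close>

lemma Gamma_half_step_le:
  assumes "0 < (x::real)"
  shows "Gamma (x + 1 / 2) \<le> sqrt x * Gamma x"
proof -
  have "(ln \<circ> Gamma) ((1/2) *\<^sub>R x + (1/2) *\<^sub>R (x + 1)) \<le> (1/2) * (ln \<circ> Gamma) x + (1/2) * (ln \<circ> Gamma) (x + 1)"
    using convex_onD[OF log_convex_Gamma_real, of "1/2" x "x + 1"] assms by simp
  moreover have "(1/2) *\<^sub>R x + (1/2) *\<^sub>R (x + 1) = x + 1 / 2" by (simp add: field_simps)
  moreover have "Gamma (x + 1) = x * Gamma x" using assms by (intro Gamma_plus1) (auto elim!: nonpos_Ints_cases)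
  ultimately have "ln (Gamma (x + 1/2)) \<le> 1/2 * ln (Gamma x) + 1/2 * ln (x * Gamma x)" by simp
  also have "\<dots> = ln (sqrt x * Gamma x)"
    using assms by (simp add: ln_mult ln_sqrt add_divide_distrib)
  finally show ?thesis using assms by (subst (asm) ln_le_cancel_iff) auto
qed

text \<open>Raising \<open>k\<close> by one moves the pair of arguments half a step: the larger old
  argument becomes the smaller new one and the other is shifted by 1, so the recursion of Gamma
  suffices.\<close>

lemma Gamma_duplication_nat:
  "1 \<le> k \<Longrightarrow> Gamma (real k / 2) * Gamma (real k / 2 + 1 / 2) = 2 * sqrt pi * Gamma (real k) / 2 ^ k"
proof (induction k rule: nat_induct_at_least)
  case base
  then show ?case by (simp add: Gamma_one_half_real)
next
  case (Suc k)
  have "Gamma (real k / 2 + 1) = (real k / 2) * Gamma (real k / 2)"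
    using Suc by (intro Gamma_plus1) (auto elim!: nonpos_Ints_cases)
  moreover have "Gamma (real k + 1) = real k * Gamma (real k)"
    using Suc by (intro Gamma_plus1) (auto elim!: nonpos_Ints_cases)
  moreover have "real (Suc k) / 2 = real k / 2 + 1 / 2" "real (Suc k) / 2 + 1 / 2 = real k / 2 + 1" "real (Suc k) = real k + 1"
    by (simp_all add: field_simps)
  ultimately have "Gamma (real (Suc k) / 2) * Gamma (real (Suc k) / 2 + 1 / 2)
      = real k / 2 * (Gamma (real k / 2) * Gamma (real k / 2 + 1 / 2))" "Gamma (real (Suc k)) = real k * Gamma (real k)"
    by (simp_all only: mult_ac)
  then show ?case unfolding Suc.IH by simp
qed

text \<open>The constant produced by integrating in polar coordinates against the Cauchy weight.\<close>
lemma polar_constant_bound: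
  assumes "1 \<le> k"
  shows "pi * sqrt (real (2 * k - 1)) * Gamma (real k - 1 / 2) / (2 ^ k * sqrt 2 * (Gamma (real k / 2))\<^sup>2) \<le> 3 / 4 * sqrt (real k)"
proof (cases "k = 1")
  case True
  have "pi * sqrt pi / (2 * sqrt 2 * pi) = sqrt (pi / 8)"
    by (simp add: real_sqrt_divide real_sqrt_mult[of 4 2, simplified])
  also have "\<dots> \<le> 3 / 4" using pi_less_4 by (intro real_le_lsqrt) (auto simp: power2_eq_square)
  finally show ?thesis using True by (simp add: Gamma_one_half_real)
next
  case False
  define g where "g = Gamma (real k / 2)"
  define w where "w = sqrt (real (2 * k - 1))"
  have k2: "2 \<le> k" using assms False by simp
  have g: "0 < g" using assms by (simp add: g_def)
  have w: "0 < w" "w * w = 2 * real k - 1" using assms by (auto simp: w_def of_nat_diff)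
  have "Gamma ((real k - 1 / 2) + 1) = (real k - 1 / 2) * Gamma (real k - 1 / 2)"
    using assms by (intro Gamma_plus1) (auto elim!: nonpos_Ints_cases)
  then have G1: "w * w * Gamma (real k - 1 / 2) = 2 * Gamma (real k + 1 / 2)" unfolding w by (simp add: algebra_simps)
  \<comment> \<open>Duplication expresses \<open>Gamma k\<close> through \<open>g\<^sup>2\<close>,
    up to a half step that costs \<open>sqrt (k / 2)\<close>; a second half step leads to
    \<open>Gamma (k + 1 / 2)\<close>.\<close>
  have "Gamma (real k) = 2 ^ k / (2 * sqrt pi) * (g * Gamma (real k / 2 + 1 / 2))"
    unfolding g_def using Gamma_duplication_nat[OF assms] by (simp add: field_simps)
  also have "\<dots> \<le> 2 ^ k / (2 * sqrt pi) * (g * (sqrt (real k / 2) * g))"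
    using g Gamma_half_step_le[of "real k / 2"] assms by (intro mult_left_mono) (auto simp: g_def)
  finally have G2: "Gamma (real k) \<le> 2 ^ k / (2 * sqrt pi) * (g * (sqrt (real k / 2) * g))" .
  have "Gamma (real k + 1 / 2) \<le> sqrt (real k) * Gamma (real k)"
    using assms by (intro Gamma_half_step_le) auto
  also have "\<dots> \<le> sqrt (real k) * (2 ^ k / (2 * sqrt pi) * (g * (sqrt (real k / 2) * g)))"
    using G2 by (intro mult_left_mono) auto
  also have "\<dots> = real k * 2 ^ k / (2 * sqrt pi * sqrt 2) * g\<^sup>2"
    by (simp add: real_sqrt_divide power2_eq_square)
  finally have G3: "Gamma (real k + 1 / 2) \<le> real k * 2 ^ k / (2 * sqrt pi * sqrt 2) * g\<^sup>2" .
  have "pi * w * Gamma (real k - 1 / 2) / (2 ^ k * sqrt 2 * g\<^sup>2) = pi * (w * w * Gamma (real k - 1 / 2)) / (w * (2 ^ k * sqrt 2 * g\<^sup>2))"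
    using w g by (simp add: field_simps)
  also have "\<dots> \<le> pi * (2 * (real k * 2 ^ k / (2 * sqrt pi * sqrt 2) * g\<^sup>2)) / (w * (2 ^ k * sqrt 2 * g\<^sup>2))"
    unfolding G1 using G3 w g by (intro divide_right_mono mult_left_mono) auto
  also have "\<dots> = (pi / sqrt pi) * real k / (2 * w)"
    using w g by (simp add: field_simps)
  also have "\<dots> = sqrt pi * real k / (2 * w)" by (simp add: real_div_sqrt)
  also have "\<dots> \<le> 3 / 4 * sqrt (real k)"
  proof -
    \<comment> \<open>True from \<open>k = 2\<close> on but false at \<open>k = 1\<close>, hence the
      separate computation of that case.\<close>
    have "pi * real k * 4 \<le> 9 * (2 * real k - 1)"
    proof -
      have "pi * real k \<le> 16 / 5 * real k" using pi_approx by (intro mult_right_mono) auto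
      then have "pi * real k * 4 \<le> 16 / 5 * real k * 4" by (rule mult_right_mono) simp
      also have "\<dots> \<le> 9 * (2 * real k - 1)" using k2 by simp
      finally show ?thesis .
    qed
    then have "sqrt (pi * real k * 4) \<le> sqrt (9 * (2 * real k - 1))" by simp
    moreover have "sqrt (9::real) = 3" by (rule real_sqrt_unique) auto
    then have "sqrt (9 * (2 * real k - 1)) = 3 * w"
      using assms unfolding real_sqrt_mult w_def by (simp add: of_nat_diff)
    moreover have "sqrt (pi * real k * 4) = 2 * (sqrt pi * sqrt (real k))" by (simp add: real_sqrt_mult)
    ultimately have "2 * (sqrt pi * sqrt (real k)) \<le> 3 * w" by simp
    then have le: "2 * (sqrt pi * sqrt (real k)) * sqrt (real k) \<le> 3 * w * sqrt (real k)" by (intro mult_right_mono) auto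
    have eq: "2 * (sqrt pi * sqrt (real k)) * sqrt (real k) = 2 * (sqrt pi * real k)" by simp
    have "2 * (sqrt pi * real k) \<le> 3 * w * sqrt (real k)" using le unfolding eq .
    then show ?thesis using w by (simp add: field_simps)
  qed
  finally show ?thesis by (simp add: w_def g_def)
qed

section \<open>Weighted radial integrals of pair densities\<close>

text \<open>Density at \<open>(y, y)\<close>, where \<open>y\<close> has \<open>k\<close> coordinates and norm \<open>r\<close>, of \<open>k\<close> independent Gaussian pairs.\<close>
definition pair_density :: "nat \<Rightarrow> real \<Rightarrow> real \<Rightarrow> real \<Rightarrow> real \<Rightarrow> real" where
  "pair_density k a b c r = exp (- ((a + b - 2 * c) * r\<^sup>2) / (2 * (a * b - c\<^sup>2))) / (2 * pi * sqrt (a * b - c\<^sup>2)) ^ k"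

text \<open>Closed form of the half-line integral of \<open>(1 + (r / s)\<^sup>2) * r ^ (2 * (k -
  1)) * pair_density k a b c r\<close>. The exponent is twice that of the polar Jacobian, which
  Cauchy--Schwarz squares. The dependence on \<open>c\<close> is isolated in the two factors that
  \<open>correlation_bounds\<close> treats.\<close>

definition radial_weight :: "nat \<Rightarrow> real \<Rightarrow> real \<Rightarrow> real \<Rightarrow> real \<Rightarrow> real" where
  "radial_weight k s a b c =
     (Gamma (real k - 1 / 2) / 2 * sqrt 2 ^ (2 * k - 1)
        * ((sqrt (a * b - c\<^sup>2) / (a + b - 2 * c)) ^ (k - 1) / sqrt (a + b - 2 * c))
      + Gamma (real k + 1 / 2) / 2 * sqrt 2 ^ (2 * k + 1) / s\<^sup>2
        * ((sqrt (a * b - c\<^sup>2) / (a + b - 2 * c)) ^ (k + 1) * sqrt (a + b - 2 * c))) / (2 * pi) ^ k"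

lemma nn_integral_pair_density_radial:
  assumes D: "0 < a * b - c\<^sup>2" and u: "0 < a + b - 2 * c" and s: "0 < s" and k: "1 \<le> k"
  shows "(\<integral>\<^sup>+r. ennreal ((1 + (r / s)\<^sup>2) * r ^ (2 * (k - 1)) * pair_density k a b c r) * indicator {0..} r \<partial>lborel)
    = ennreal (radial_weight k s a b c)"
proof -
  define d where "d = sqrt (a * b - c\<^sup>2)"
  define q where "q = sqrt (a + b - 2 * c)"
  have dq: "0 < d" "0 < q" using D u by (auto simp: d_def q_def)
  have d2: "a * b - c\<^sup>2 = d\<^sup>2" and q2: "a + b - 2 * c = q\<^sup>2" using D u by (simp_all add: d_def q_def)
  obtain j where j: "k = Suc j" using k by (cases k) auto
  define \<kappa> where "\<kappa> = q\<^sup>2 / (2 * d\<^sup>2)"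
  have \<kappa>: "0 < \<kappa>" using dq by (simp add: \<kappa>_def)
  have sk: "sqrt \<kappa> = q / (sqrt 2 * d)" using dq by (simp add: \<kappa>_def real_sqrt_divide real_sqrt_mult)
  define m where "m = (\<lambda>i r. r ^ (2 * i) * exp (- (\<kappa> * r\<^sup>2)))"
  define A where "A = 1 / (2 * pi * d) ^ k"
  have A: "0 \<le> A" using dq by (simp add: A_def)
  have G: "0 \<le> Gamma (real i + 1 / 2)" for i :: nat by (intro less_imp_le Gamma_real_pos) (simp add: add_nonneg_pos)
  have eq: "(1 + (r / s)\<^sup>2) * r ^ (2 * (k - 1)) * pair_density k a b c r = A * (m (k - 1) r + (1 / s\<^sup>2) * m k r)" for r
  proof -
    have "pair_density k a b c r = A * exp (- (\<kappa> * r\<^sup>2))"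
      unfolding pair_density_def d2 q2 using dq by (simp add: A_def \<kappa>_def)
    moreover have "(1 + (r / s)\<^sup>2) * r ^ (2 * (k - 1)) = r ^ (2 * (k - 1)) + (1 / s\<^sup>2) * r ^ (2 * k)"
      using s by (simp add: j field_simps power2_eq_square)
    ultimately show ?thesis by (simp add: m_def algebra_simps)
  qed
  have mn: "0 \<le> m i r" for i r by (simp add: m_def zero_le_even_power)
  have [measurable]: "m i \<in> borel_measurable borel" for i unfolding m_def by measurable
  have I: "(\<integral>\<^sup>+r. ennreal (m i r) * indicator {0..} r \<partial>lborel) = ennreal (Gamma (real i + 1 / 2) / 2 / sqrt \<kappa> ^ (2 * i + 1))" for i
    unfolding m_def by (rule half_line_gaussian_moment[OF \<kappa>])
  have "(\<integral>\<^sup>+r. ennreal ((1 + (r / s)\<^sup>2) * r ^ (2 * (k - 1)) * pair_density k a b c r) * indicator {0..} r \<partial>lborel)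
    = (\<integral>\<^sup>+r. ennreal A * ((ennreal (m (k - 1) r) * indicator {0..} r) + ennreal (1 / s\<^sup>2) * (ennreal (m k r) * indicator {0..} r)) \<partial>lborel)"
    unfolding eq
    by (intro nn_integral_cong)
      (auto simp: ennreal_mult'[OF A] ennreal_plus[OF mn] ennreal_mult'[of "1 / s\<^sup>2"] mn simp del: times_divide_eq_left
        split: split_indicator)
  also have "\<dots> = ennreal A * (ennreal (Gamma (real (k - 1) + 1 / 2) / 2 / sqrt \<kappa> ^ (2 * (k - 1) + 1))
      + ennreal (1 / s\<^sup>2) * ennreal (Gamma (real k + 1 / 2) / 2 / sqrt \<kappa> ^ (2 * k + 1)))"
    by (simp add: nn_integral_cmult nn_integral_add I)
  also have "\<dots> = ennreal (A * (Gamma (real (k - 1) + 1 / 2) / 2 / sqrt \<kappa> ^ (2 * (k - 1) + 1)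
      + 1 / s\<^sup>2 * (Gamma (real k + 1 / 2) / 2 / sqrt \<kappa> ^ (2 * k + 1))))"
  proof -
    have gen: "ennreal A * (ennreal x + ennreal B * ennreal y) = ennreal (A * (x + B * y))" if "0 \<le> x" "0 \<le> B" "0 \<le> y" for x B y
    proof -
      have "ennreal (B * y) = ennreal B * ennreal y" using that by (intro ennreal_mult)
      moreover have "ennreal (x + B * y) = ennreal x + ennreal (B * y)" using that by (intro ennreal_plus) auto
      moreover have "ennreal (A * (x + B * y)) = ennreal A * ennreal (x + B * y)" using A that by (intro ennreal_mult) auto
      ultimately show ?thesis by (simp only:)
    qed
    show ?thesis
      by (rule gen; intro divide_nonneg_nonneg G zero_le_power real_sqrt_ge_zero less_imp_le[OF \<kappa>] zero_le_one zero_le_numeral zero_le_power2)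
  qed
  also have "A * (Gamma (real (k - 1) + 1 / 2) / 2 / sqrt \<kappa> ^ (2 * (k - 1) + 1)
      + 1 / s\<^sup>2 * (Gamma (real k + 1 / 2) / 2 / sqrt \<kappa> ^ (2 * k + 1))) = radial_weight k s a b c"
  proof -
    \<comment> \<open>The moment of order \<open>2 * (k - 1)\<close> contributes
      \<open>d ^ (2 * k - 1)\<close> and the normalization removes \<open>d ^ k\<close>; the rest
      groups into powers of \<open>d / q\<^sup>2\<close>.\<close>
    have 1: "1 / d ^ k * (1 / sqrt \<kappa> ^ (2 * (k - 1) + 1)) = sqrt 2 ^ (2 * k - 1) * ((d / q\<^sup>2) ^ (k - 1) / q)"
    proof -
      have "1 / sqrt \<kappa> ^ (2 * j + 1) = sqrt 2 ^ (2 * j + 1) * (d ^ j * d ^ j * d) / (q\<^sup>2 ^ j * q)"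
        unfolding sk using dq by (simp add: field_simps power_divide power_mult_distrib power_add mult_2 power2_eq_square power_mult)
      then have "1 / d ^ k * (1 / sqrt \<kappa> ^ (2 * j + 1)) = 1 / (d * d ^ j) * (sqrt 2 ^ (2 * j + 1) * (d ^ j * d ^ j * d) / (q\<^sup>2 ^ j * q))"
        by (simp add: j)
      also have "\<dots> = sqrt 2 ^ (2 * j + 1) * (d ^ j / (q\<^sup>2 ^ j * q))" using dq by simp
      finally show ?thesis by (simp add: j power_divide)
    qed
    have 2: "1 / d ^ k * (1 / sqrt \<kappa> ^ (2 * k + 1)) = sqrt 2 ^ (2 * k + 1) * ((d / q\<^sup>2) ^ (k + 1) * q)"
    proof -
      have "1 / sqrt \<kappa> ^ (2 * k + 1) = sqrt 2 ^ (2 * k + 1) * (d ^ k * d ^ k * d) / (q\<^sup>2 ^ k * q)"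
        unfolding sk using dq by (simp add: field_simps power_divide power_mult_distrib power_add mult_2 power2_eq_square power_mult)
      then have "1 / d ^ k * (1 / sqrt \<kappa> ^ (2 * k + 1)) = 1 / d ^ k * (sqrt 2 ^ (2 * k + 1) * (d ^ k * d ^ k * d) / (q\<^sup>2 ^ k * q))"
        by simp
      also have "\<dots> = sqrt 2 ^ (2 * k + 1) * (d ^ k * d * q / (q\<^sup>2 ^ k * q\<^sup>2))" using dq by (simp add: power2_eq_square)
      finally show ?thesis by (simp add: power_divide mult_ac)
    qed
    have Ae: "A = 1 / (2 * pi) ^ k * (1 / d ^ k)" by (simp add: A_def power_mult_distrib)
    have rk: "real (k - 1) + 1 / 2 = real k - 1 / 2" using k by (simp add: of_nat_diff)
    have "radial_weight k s a b c = 1 / (2 * pi) ^ k * (Gamma (real k - 1 / 2) / 2 * (sqrt 2 ^ (2 * k - 1) * ((d / q\<^sup>2) ^ (k - 1) / q))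
       + Gamma (real k + 1 / 2) / 2 / s\<^sup>2 * (sqrt 2 ^ (2 * k + 1) * ((d / q\<^sup>2) ^ (k + 1) * q)))"
      unfolding radial_weight_def d2 q2 using dq by (simp add: mult_ac)
    also have "\<dots> = A * (Gamma (real (k - 1) + 1 / 2) / 2 / sqrt \<kappa> ^ (2 * (k - 1) + 1)
      + 1 / s\<^sup>2 * (Gamma (real k + 1 / 2) / 2 / sqrt \<kappa> ^ (2 * k + 1)))"
      unfolding 1[symmetric] 2[symmetric] Ae rk by (simp add: algebra_simps)
    finally show ?thesis by simp
  qed
  finally show ?thesis .
qed

text \<open>\<open>s\<close> satisfies \<open>s\<^sup>2 = (2 * k - 1) * \<sigma> / 4\<close>, where
  \<open>\<sigma> = 2 * t + 2 * \<gamma>\<close> is the typical value of \<open>u\<close>. Then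
  \<open>Gamma (k + 1 / 2) / s\<^sup>2 = 2 * Gamma (k - 1 / 2) / \<sigma>\<close>, so both moments
  are of one size for every \<open>k\<close>. The second bound is crude on purpose: it makes the
  uncorrelated integral finite, hence subtractable.\<close>

lemma radial_weight_bounds:
  fixes \<gamma> t \<epsilon> \<tau>1 \<tau>2 \<rho> :: real
  assumes pos: "0 < \<gamma>" "0 < t" "0 < \<epsilon>" "\<epsilon> \<le> 1"
    and \<tau>1: "\<bar>\<tau>1 - \<gamma>\<bar> \<le> \<epsilon> * \<gamma> / 2" and \<tau>2: "\<bar>\<tau>2 - \<gamma>\<bar> \<le> \<epsilon> * \<gamma> / 2"
    and \<rho>: "\<rho>\<^sup>2 \<le> \<tau>1 * \<tau>2" and k: "1 \<le> k"
  defines "s \<equiv> sqrt (real (2 * k - 1)) * sqrt (2 * t + 2 * \<gamma>) / 2"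
  defines "F \<equiv> 2 * real k * (\<bar>\<rho>\<bar> / \<gamma>) + 4 * (\<rho> / \<gamma>)\<^sup>2 * sqrt (1 + (2 + \<epsilon>) * \<gamma> / t) ^ k"
  shows "radial_weight k s (t + \<tau>1) (t + \<tau>2) \<rho>
      \<le> radial_weight k s (t + \<tau>1) (t + \<tau>2) 0 + 3 * sqrt 2 * Gamma (real k - 1 / 2) / (2 * sqrt (2 * t + 2 * \<gamma>) * (2 * pi) ^ k) * F"
    and "radial_weight k s (t + \<tau>1) (t + \<tau>2) 0
      \<le> (Gamma (real k - 1 / 2) / 2 * sqrt 2 ^ (2 * k - 1) * (1 / sqrt t) + Gamma (real k + 1 / 2) / 2 * sqrt 2 ^ (2 * k + 1) / s\<^sup>2 * sqrt (2 * t + 3 * \<gamma>)) / (2 * pi) ^ k"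
proof -
  define a where "a = t + \<tau>1"
  define b where "b = t + \<tau>2"
  define u where "u = a + b"
  define \<sigma> where "\<sigma> = 2 * t + 2 * \<gamma>"
  define g where "g = Gamma (real k - 1 / 2)"
  have eg: "\<epsilon> * \<gamma> \<le> \<gamma>" "0 < \<epsilon> * \<gamma>" using pos by auto
  have t1: "\<tau>1 \<le> \<gamma> + \<epsilon> * \<gamma> / 2" "\<gamma> - \<epsilon> * \<gamma> / 2 \<le> \<tau>1" "0 < \<tau>1" using \<tau>1 eg unfolding abs_le_iff by linarith+
  have t2: "\<tau>2 \<le> \<gamma> + \<epsilon> * \<gamma> / 2" "\<gamma> - \<epsilon> * \<gamma> / 2 \<le> \<tau>2" "0 < \<tau>2" using \<tau>2 eg unfolding abs_le_iff by linarith+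
  have u: "2 * t + \<gamma> \<le> u" "u \<le> 2 * t + 3 * \<gamma>" "0 < u"
    using t1 t2 eg pos unfolding u_def a_def b_def by linarith+
  have ab: "0 < a" "0 < b" using t1 t2 pos by (auto simp: a_def b_def)
  have \<sigma>: "0 < \<sigma>" using pos by (simp add: \<sigma>_def)
  have g: "0 < g" unfolding g_def using k by (intro Gamma_real_pos) auto
  have k1: "real (2 * k - 1) = 2 * real k - 1" using k by (simp add: of_nat_diff)
  have "Gamma ((real k - 1 / 2) + 1) = (real k - 1 / 2) * Gamma (real k - 1 / 2)"
    using k by (intro Gamma_plus1) (auto elim!: nonpos_Ints_cases)
  then have G1: "Gamma (real k + 1 / 2) = (real k - 1 / 2) * g" unfolding g_def by (simp add: algebra_simps)
  have s2: "s\<^sup>2 = (2 * real k - 1) * \<sigma> / 4" and s0: "0 < s"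
  proof -
    have kk: "0 < 2 * real k - 1" using k by simp
    show "s\<^sup>2 = (2 * real k - 1) * \<sigma> / 4" unfolding s_def k1 \<sigma>_def[symmetric] using kk \<sigma> by (simp add: power_mult_distrib power_divide)
    show "0 < s" unfolding s_def k1 \<sigma>_def[symmetric] using kk \<sigma> by simp
  qed
  define c1 where "c1 = g / 2 * sqrt 2 ^ (2 * k - 1)"
  define c2 where "c2 = Gamma (real k + 1 / 2) / 2 * sqrt 2 ^ (2 * k + 1) / s\<^sup>2"
  have c: "0 \<le> c1" "0 \<le> c2" using g k by (auto simp: c1_def c2_def G1)
  define P where "P = (sqrt (a * b - \<rho>\<^sup>2) / (u - 2 * \<rho>)) ^ (k - 1) / sqrt (u - 2 * \<rho>)"
  define Q where "Q = (sqrt (a * b - \<rho>\<^sup>2) / (u - 2 * \<rho>)) ^ (k + 1) * sqrt (u - 2 * \<rho>)"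
  define P0 where "P0 = (sqrt (a * b) / u) ^ (k - 1) / sqrt u"
  define Q0 where "Q0 = (sqrt (a * b) / u) ^ (k + 1) * sqrt u"
  have F0: "0 \<le> F" using pos by (auto simp: F_def)
  note B = correlation_bounds[OF pos \<tau>1 \<tau>2 \<rho> k, folded a_def b_def F_def, folded u_def]
  have BP: "P \<le> P0 + (1 / 2) ^ (k - 1) / sqrt u * F" and BQ: "Q \<le> Q0 + (1 / 2) ^ (k + 1) * sqrt u * (3 / 2 * F)"
    using B by (auto simp: P_def Q_def P0_def Q0_def)
  have rw: "radial_weight k s a b \<rho> = (c1 * P + c2 * Q) / (2 * pi) ^ k" "radial_weight k s a b 0 = (c1 * P0 + c2 * Q0) / (2 * pi) ^ k"
    by (simp_all add: radial_weight_def c1_def c2_def P_def Q_def P0_def Q0_def u_def g_def)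
  have "c1 * P + c2 * Q \<le> c1 * (P0 + (1 / 2) ^ (k - 1) / sqrt u * F) + c2 * (Q0 + (1 / 2) ^ (k + 1) * sqrt u * (3 / 2 * F))"
    using c BP BQ by (intro add_mono mult_left_mono) auto
  also have "\<dots> = c1 * P0 + c2 * Q0 + (c1 * (1 / 2) ^ (k - 1) / sqrt u + 3 / 2 * (c2 * (1 / 2) ^ (k + 1) * sqrt u)) * F"
    by (simp add: algebra_simps)
  \<comment> \<open>The powers of \<open>sqrt 2\<close> from the Gaussian moments cancel those of 1
    / 2, so this factor contains no exponential in \<open>k\<close>.\<close>
  also have "c1 * (1 / 2) ^ (k - 1) / sqrt u + 3 / 2 * (c2 * (1 / 2) ^ (k + 1) * sqrt u) = g * sqrt 2 / 2 * (1 / sqrt u + 3 / 2 * sqrt u / \<sigma>)"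
  proof -
    obtain j where j: "k = Suc j" using k by (cases k) auto
    have p: "sqrt 2 ^ (2 * j) * (1 / 2) ^ j = (1::real)" by (simp add: power_mult power_mult_distrib[symmetric])
    have 1: "c1 * (1 / 2) ^ (k - 1) = g * sqrt 2 / 2"
    proof -
      have "c1 * (1 / 2) ^ (k - 1) = g / 2 * sqrt 2 * (sqrt 2 ^ (2 * j) * (1 / 2) ^ j)"
        by (simp add: c1_def j mult_ac)
      then show ?thesis unfolding p by simp
    qed
    have 2: "c2 * (1 / 2) ^ (k + 1) = g * sqrt 2 / 2 / \<sigma>"
    proof -
      have "sqrt 2 ^ (2 * k + 1) * (1 / 2) ^ (k + 1) = (sqrt 2 ^ (2 * j) * (1 / 2) ^ j) * (sqrt 2 ^ 3 / 4)"
        by (simp add: j power_add numeral_3_eq_3)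
      also have "\<dots> = sqrt 2 / 2" unfolding p by (simp add: power3_eq_cube)
      finally have pw: "sqrt 2 ^ (2 * k + 1) * (1 / 2) ^ (k + 1) = sqrt 2 / 2" .
      have "c2 * (1 / 2) ^ (k + 1) = (real k - 1 / 2) * g / 2 / s\<^sup>2 * (sqrt 2 ^ (2 * k + 1) * (1 / 2) ^ (k + 1))"
        unfolding c2_def G1 by simp
      also have "\<dots> = g * sqrt 2 / 2 / \<sigma>"
      proof -
        have "2 * real k - 1 \<noteq> 0" using k by simp
        then show ?thesis unfolding pw s2 using \<sigma> by (simp add: field_simps)
      qed
      finally show ?thesis .
    qed
    have "c1 * (1 / 2) ^ (k - 1) / sqrt u + 3 / 2 * (c2 * (1 / 2) ^ (k + 1) * sqrt u) = g * sqrt 2 / 2 / sqrt u + 3 / 2 * (g * sqrt 2 / 2 / \<sigma> * sqrt u)"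
      unfolding 1 2 ..
    then show ?thesis by (simp add: distrib_left)
  qed
  also have "c1 * P0 + c2 * Q0 + g * sqrt 2 / 2 * (1 / sqrt u + 3 / 2 * sqrt u / \<sigma>) * F \<le> c1 * P0 + c2 * Q0 + g * sqrt 2 / 2 * (3 / sqrt \<sigma>) * F"
  proof -
    \<comment> \<open>The truncation puts \<open>w\<^sup>2 = u / \<sigma>\<close> between 1 / 2 and
      3 / 2. After multiplication by \<open>w\<close>, the inequality
      \<open>1 / w + 3 / 2 * w \<le> 3\<close> is quadratic and is read off on the interval from 7 /
      10 to 13 / 10.\<close>
    define w where "w = sqrt u / sqrt \<sigma>"
    have w0: "0 < w" using u \<sigma> by (simp add: w_def)
    have w2: "w\<^sup>2 = u / \<sigma>" using u \<sigma> by (simp add: w_def power_divide)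
    have w2b: "1 / 2 \<le> w\<^sup>2" "w\<^sup>2 \<le> 3 / 2" unfolding w2 using u \<sigma> pos by (auto simp: \<sigma>_def field_simps)
    have "0 \<le> 3 * w - 1 - 3 / 2 * w\<^sup>2"
    proof -
      have "7 / 10 \<le> w" by (rule power2_le_imp_le[OF order_trans[OF _ w2b(1)]]) (use w0 in \<open>auto simp: power2_eq_square\<close>)
      moreover have "w \<le> 13 / 10" by (rule power2_le_imp_le[OF order_trans[OF w2b(2)]]) (auto simp: power2_eq_square)
      ultimately have "0 \<le> (w - 7 / 10) * (13 / 10 - w)" by simp
      then show ?thesis by (simp add: algebra_simps power2_eq_square)
    qed
    then have "1 / w + 3 / 2 * w \<le> 3" using w0 by (simp add: field_simps power2_eq_square)
    then have "(1 / w + 3 / 2 * w) / sqrt \<sigma> \<le> 3 / sqrt \<sigma>" using \<sigma> by (intro divide_right_mono) auto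
    moreover have "(1 / w + 3 / 2 * w) / sqrt \<sigma> = 1 / sqrt u + 3 / 2 * sqrt u / \<sigma>"
    proof -
      have "sqrt \<sigma> * sqrt \<sigma> = \<sigma>" using \<sigma> by simp
      moreover have "w / sqrt \<sigma> = sqrt u / (sqrt \<sigma> * sqrt \<sigma>)" by (simp only: w_def divide_divide_eq_left)
      ultimately have "w / sqrt \<sigma> = sqrt u / \<sigma>" by simp
      then have "3 / 2 * sqrt u / \<sigma> = 3 / 2 * w / sqrt \<sigma>" by (metis times_divide_eq_right)
      moreover have "1 / w / sqrt \<sigma> = 1 / sqrt u" using \<sigma> u by (simp add: w_def)
      ultimately show ?thesis by (simp add: add_divide_distrib)
    qed
    ultimately show ?thesis using g F0 by (intro add_left_mono mult_right_mono mult_left_mono) auto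
  qed
  finally have "(c1 * P + c2 * Q) / (2 * pi) ^ k \<le> (c1 * P0 + c2 * Q0 + g * sqrt 2 / 2 * (3 / sqrt \<sigma>) * F) / (2 * pi) ^ k"
    by (intro divide_right_mono) auto
  also have "\<dots> = (c1 * P0 + c2 * Q0) / (2 * pi) ^ k + 3 * sqrt 2 * g / (2 * sqrt \<sigma> * (2 * pi) ^ k) * F"
    by (simp add: add_divide_distrib mult_ac)
  finally show "radial_weight k s (t + \<tau>1) (t + \<tau>2) \<rho>
      \<le> radial_weight k s (t + \<tau>1) (t + \<tau>2) 0 + 3 * sqrt 2 * Gamma (real k - 1 / 2) / (2 * sqrt (2 * t + 2 * \<gamma>) * (2 * pi) ^ k) * F"
    unfolding rw[symmetric] a_def b_def g_def \<sigma>_def .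
  have ab4: "a * b \<le> (u / 2)\<^sup>2"
    using zero_le_power2[of "a - b"] by (simp add: u_def power2_eq_square algebra_simps)
  have "sqrt (a * b) \<le> u / 2" using ab4 u by (intro real_le_lsqrt) auto
  then have d0: "sqrt (a * b) / u \<le> 1" "0 \<le> sqrt (a * b) / u" using u ab by (auto simp: field_simps)
  have "P0 \<le> 1 / sqrt t" unfolding P0_def using d0 u pos by (intro frac_le power_le_one) auto
  moreover have "Q0 \<le> 1 * sqrt (2 * t + 3 * \<gamma>)" unfolding Q0_def using d0 u pos by (intro mult_mono power_le_one) auto
  ultimately have "(c1 * P0 + c2 * Q0) / (2 * pi) ^ k \<le> (c1 * (1 / sqrt t) + c2 * sqrt (2 * t + 3 * \<gamma>)) / (2 * pi) ^ k"
    using c by (intro divide_right_mono add_mono mult_left_mono) auto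
  then show "radial_weight k s (t + \<tau>1) (t + \<tau>2) 0
      \<le> (Gamma (real k - 1 / 2) / 2 * sqrt 2 ^ (2 * k - 1) * (1 / sqrt t) + Gamma (real k + 1 / 2) / 2 * sqrt 2 ^ (2 * k + 1) / s\<^sup>2 * sqrt (2 * t + 3 * \<gamma>)) / (2 * pi) ^ k"
    unfolding a_def[symmetric] b_def[symmetric] rw(2) unfolding c1_def c2_def g_def .
qed

lemma pair_density_nonneg: "0 < a * b - c\<^sup>2 \<Longrightarrow> 0 \<le> pair_density k a b c r"
  by (simp add: pair_density_def)

lemma borel_measurable_pair_density [measurable (raw)]:
  assumes [measurable]: "a \<in> borel_measurable M" "b \<in> borel_measurable M" "c \<in> borel_measurable M" "r \<in> borel_measurable M"
  shows "(\<lambda>x. pair_density k (a x) (b x) (c x) (r x)) \<in> borel_measurable M"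
  unfolding pair_density_def by measurable

text \<open>The noise variance \<open>t\<close> keeps the determinant and
  \<open>a + b - 2 * c\<close> away from zero, uniformly in the other arguments; this yields
  positivity of the densities and finiteness of their averages over pairs.\<close>

lemma pair_density_le:
  assumes t: "0 < t" and x: "0 \<le> x" "0 \<le> y" and c: "c\<^sup>2 \<le> x * y"
  shows "t\<^sup>2 \<le> (t + x) * (t + y) - c\<^sup>2" "2 * t \<le> (t + x) + (t + y) - 2 * c"
    and "pair_density k (t + x) (t + y) c r \<le> 1 / (2 * pi * t) ^ k"
proof -
  have "0 \<le> t * x" "0 \<le> t * y" using t x by auto
  moreover have "(t + x) * (t + y) - c\<^sup>2 = t\<^sup>2 + (t * x + t * y + (x * y - c\<^sup>2))" by (simp add: algebra_simps power2_eq_square)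
  ultimately show D: "t\<^sup>2 \<le> (t + x) * (t + y) - c\<^sup>2" using c by linarith
  have "(2 * c)\<^sup>2 \<le> (x + y)\<^sup>2"
    using c zero_le_power2[of "x - y"] by (simp add: power2_eq_square algebra_simps)
  then have "2 * c \<le> x + y" by (rule power2_le_imp_le) (use x in simp)
  then show u: "2 * t \<le> (t + x) + (t + y) - 2 * c" by simp
  have "0 < t\<^sup>2" using t by simp
  then have Dp: "0 < (t + x) * (t + y) - c\<^sup>2" using D by linarith
  have s: "t \<le> sqrt ((t + x) * (t + y) - c\<^sup>2)" using D t by (intro real_le_rsqrt) auto
  have "exp (- (((t + x) + (t + y) - 2 * c) * r\<^sup>2) / (2 * ((t + x) * (t + y) - c\<^sup>2))) \<le> 1"
  proof -
    have "0 \<le> (((t + x) + (t + y) - 2 * c) * r\<^sup>2) / (2 * ((t + x) * (t + y) - c\<^sup>2))"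
      using u t Dp by (intro divide_nonneg_nonneg mult_nonneg_nonneg) auto
    then show ?thesis by simp
  qed
  then show "pair_density k (t + x) (t + y) c r \<le> 1 / (2 * pi * t) ^ k"
    unfolding pair_density_def using s t by (intro frac_le power_mono mult_left_mono) auto
qed

section \<open>From weighted moments to the integrated standard deviation\<close>

lemma ennreal_power2_le_imp_le:
  "x\<^sup>2 \<le> (ennreal b)\<^sup>2 \<Longrightarrow> 0 \<le> b \<Longrightarrow> x \<le> ennreal b"
  by (cases x) (auto simp: ennreal_power power2_eq_square ennreal_mult'[symmetric] ennreal_mult_eq_top_iff
      top_unique intro: power2_le_imp_le)

lemma nn_integral_sqrt_Cauchy_Schwarz:
  fixes v w :: "real \<Rightarrow> real"
  assumes [measurable]: "v \<in> borel_measurable borel" "w \<in> borel_measurable borel"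
    and w: "\<And>r. 0 < w r"
    and I: "(\<integral>\<^sup>+r. ennreal (1 / w r) * indicator {0..} r \<partial>lborel) = ennreal K" "0 \<le> K"
    and B: "(\<integral>\<^sup>+r. ennreal (w r * r ^ (2 * j) * v r) * indicator {0..} r \<partial>lborel) \<le> ennreal B" "0 \<le> B"
    and c: "0 \<le> c"
  shows "(\<integral>\<^sup>+r. ennreal (c * r ^ j) * indicator {0..} r * ennreal (sqrt (v r)) \<partial>lborel) \<le> ennreal (c * sqrt (K * B))"
proof -
  define f where "f = (\<lambda>r. ennreal (sqrt (1 / w r)) * indicator {0..} r)"
  define g where "g = (\<lambda>r. ennreal (sqrt (w r) * r ^ j * sqrt (v r)) * indicator {0..} r)"
  have fg: "f r * g r = ennreal (r ^ j * sqrt (v r)) * indicator {0..} r" for r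
  proof -
    have "sqrt (1 / w r) * (sqrt (w r) * r ^ j * sqrt (v r)) = r ^ j * sqrt (v r)"
      using w[of r] by (simp add: real_sqrt_divide)
    moreover have "ennreal (sqrt (1 / w r) * (sqrt (w r) * r ^ j * sqrt (v r))) = ennreal (sqrt (1 / w r)) * ennreal (sqrt (w r) * r ^ j * sqrt (v r))"
      using w[of r] by (intro ennreal_mult') (simp add: less_imp_le)
    ultimately show ?thesis
      unfolding f_def g_def by (simp only: split: split_indicator) simp
  qed
  have f2: "f r ^ 2 = ennreal (1 / w r) * indicator {0..} r" for r
    unfolding f_def using w[of r] by (auto simp: ennreal_power less_imp_le split: split_indicator)
  have g2: "g r ^ 2 = ennreal (w r * r ^ (2 * j) * v r) * indicator {0..} r" for r
  proof (cases "0 \<le> r")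
    case True
    have p: "0 \<le> r ^ j" "0 < w r" using True w by auto
    show ?thesis
    proof (cases "0 \<le> v r")
      case True
      then show ?thesis using p \<open>0 \<le> r\<close>
        by (simp add: g_def ennreal_power power_mult_distrib less_imp_le power_mult[symmetric] mult.commute)
    next
      \<comment> \<open>\<open>sqrt\<close> is odd, hence negative at a negative \<open>v r\<close>;
        \<open>ennreal\<close> sends both sides to 0.\<close>
      case False
      have "w r * r ^ (2 * j) * v r \<le> 0" using p \<open>0 \<le> r\<close> False by (intro mult_nonneg_nonpos) auto
      moreover have "sqrt (w r) * r ^ j * sqrt (v r) \<le> 0" using p \<open>0 \<le> r\<close> False by (intro mult_nonneg_nonpos) auto
      ultimately show ?thesis by (simp add: g_def ennreal_neg)
    qed
  qed (simp add: g_def)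
  have "(\<integral>\<^sup>+r. ennreal (c * r ^ j) * indicator {0..} r * ennreal (sqrt (v r)) \<partial>lborel) = (\<integral>\<^sup>+r. ennreal c * (f r * g r) \<partial>lborel)"
    unfolding fg
  proof (intro nn_integral_cong)
    fix r
    have "ennreal (c * r ^ j) = ennreal c * ennreal (r ^ j)" using c by (rule ennreal_mult')
    moreover have "ennreal (r ^ j * sqrt (v r)) = ennreal (r ^ j) * ennreal (sqrt (v r))" if "0 \<le> r"
      using that by (intro ennreal_mult') simp
    ultimately show "ennreal (c * r ^ j) * indicator {0..} r * ennreal (sqrt (v r)) = ennreal c * (ennreal (r ^ j * sqrt (v r)) * indicator {0..} r)"
      by (auto simp: mult.assoc split: split_indicator)
  qed
  also have "\<dots> = ennreal c * (\<integral>\<^sup>+r. f r * g r \<partial>lborel)"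
    unfolding f_def g_def by (rule nn_integral_cmult) measurable
  also have "(\<integral>\<^sup>+r. f r * g r \<partial>lborel) \<le> ennreal (sqrt (K * B))"
  proof (rule ennreal_power2_le_imp_le)
    have "(\<integral>\<^sup>+r. f r * g r \<partial>lborel)\<^sup>2 \<le> (\<integral>\<^sup>+r. f r ^ 2 \<partial>lborel) * (\<integral>\<^sup>+r. g r ^ 2 \<partial>lborel)"
      unfolding f_def g_def by (rule Cauchy_Schwarz_nn_integral) measurable
    also have "\<dots> \<le> ennreal K * ennreal B"
      unfolding f2 g2 I(1) by (intro mult_left_mono B) simp
    also have "\<dots> = (ennreal (sqrt (K * B)))\<^sup>2"
      using I B by (simp add: ennreal_power ennreal_mult)
    finally show "(\<integral>\<^sup>+r. f r * g r \<partial>lborel)\<^sup>2 \<le> (ennreal (sqrt (K * B)))\<^sup>2" .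
  qed (use I B in simp)
  finally show ?thesis using c I B by (simp add: ennreal_mult mult_left_mono)
qed

text \<open>\<open>W \<rho>\<close> and \<open>W (\<lambda>_. 0)\<close> stand for the second moment
  and the squared mean of the truncated density at a point of norm \<open>r\<close>. The assumption
  \<open>le\<close> keeps their difference nonnegative, so that its weighted integral is obtained by
  cancelling that of the uncorrelated term.\<close>

lemma (in prob_space) radial_fluctuation_bound:
  fixes \<tau> :: "'a \<Rightarrow> real" and \<rho> :: "'a \<times> 'a \<Rightarrow> real" and \<gamma> t \<epsilon> :: real
  assumes \<tau>[measurable]: "\<tau> \<in> borel_measurable M" and \<rho>[measurable]: "\<rho> \<in> borel_measurable (M \<Otimes>\<^sub>M M)"
    and A[measurable]: "A \<in> sets M"
    and pos: "0 < \<gamma>" "0 < t" "0 < \<epsilon>" "\<epsilon> \<le> 1"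
    and A\<tau>: "\<And>x. x \<in> A \<Longrightarrow> \<bar>\<tau> x - \<gamma>\<bar> \<le> \<epsilon> * \<gamma> / 2"
    and CS: "\<And>x y. (\<rho> (x, y))\<^sup>2 \<le> \<tau> x * \<tau> y"
    and int: "integrable (M \<Otimes>\<^sub>M M) (\<lambda>p. \<bar>\<rho> p\<bar>)" "integrable (M \<Otimes>\<^sub>M M) (\<lambda>p. (\<rho> p)\<^sup>2)"
  defines "W \<equiv> \<lambda>c r. \<integral>\<^sup>+p. ennreal (pair_density CARD('k::finite) (t + \<tau> (fst p)) (t + \<tau> (snd p)) (c p) r) * indicator (A \<times> A) p \<partial>(M \<Otimes>\<^sub>M M)"
  assumes le: "\<And>r. 0 \<le> r \<Longrightarrow> W (\<lambda>_. 0) r \<le> W \<rho> r"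
  shows "(\<integral>\<^sup>+y. ennreal (sqrt (enn2real (W \<rho> (norm y)) - enn2real (W (\<lambda>_. 0) (norm y)))) \<partial>(lborel :: (real ^ 'k) measure))
    \<le> ennreal (3 * CARD('k) powr (3 / 4) * ((\<integral>p. \<bar>\<rho> p\<bar> \<partial>(M \<Otimes>\<^sub>M M)) / \<gamma>) powr (1 / 2)
        + 3 * CARD('k) powr (1 / 4) * (1 + (2 + \<epsilon>) * \<gamma> / t) powr (CARD('k) / 4) * (sqrt (\<integral>p. (\<rho> p)\<^sup>2 \<partial>(M \<Otimes>\<^sub>M M)) / \<gamma>))"
proof -
  let ?MM = "M \<Otimes>\<^sub>M M"
  define k where "k = CARD('k)"
  have k: "1 \<le> k" by (simp add: k_def Suc_leI)
  interpret MM: pair_prob_space M M ..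
  interpret LM: pair_sigma_finite "lborel :: real measure" "?MM"
    unfolding pair_sigma_finite_def by (auto intro: lborel.sigma_finite_measure_axioms MM.P.sigma_finite_measure_axioms)
  define s where "s = sqrt (real (2 * k - 1)) * sqrt (2 * t + 2 * \<gamma>) / 2"
  let ?p = "\<lambda>p c r. pair_density k (t + \<tau> (fst p)) (t + \<tau> (snd p)) c r"
  let ?r = "\<lambda>p c. radial_weight k s (t + \<tau> (fst p)) (t + \<tau> (snd p)) c"
  have k1: "real (2 * k - 1) = 2 * real k - 1" "0 < 2 * real k - 1" using k by (auto simp: of_nat_diff)
  have s: "0 < s" using k1 pos by (simp add: s_def)
  define R where "R = 1 + (2 + \<epsilon>) * \<gamma> / t"
  have R: "1 \<le> R" using pos by (simp add: R_def)
  define F where "F = (\<lambda>p. 2 * real k * (\<bar>\<rho> p\<bar> / \<gamma>) + 4 * (\<rho> p / \<gamma>)\<^sup>2 * sqrt R ^ k)"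
  define K1 where "K1 = 3 * sqrt 2 * Gamma (real k - 1 / 2) / (2 * sqrt (2 * t + 2 * \<gamma>) * (2 * pi) ^ k)"
  define C0 where "C0 = (Gamma (real k - 1 / 2) / 2 * sqrt 2 ^ (2 * k - 1) * (1 / sqrt t) + Gamma (real k + 1 / 2) / 2 * sqrt 2 ^ (2 * k + 1) / s\<^sup>2 * sqrt (2 * t + 3 * \<gamma>)) / (2 * pi) ^ k"
  have Gp: "0 < Gamma (real k - 1 / 2)" using k by (intro Gamma_real_pos) auto
  have K1: "0 \<le> K1" using Gp pos by (simp add: K1_def)
  have F0: "0 \<le> F p" for p using pos R by (simp add: F_def)
  have [measurable]: "F \<in> borel_measurable ?MM" unfolding F_def by measurable
  have AA[measurable]: "A \<times> A \<in> sets ?MM" by simp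
  have pd: "t\<^sup>2 \<le> (t + \<tau> (fst p)) * (t + \<tau> (snd p)) - c\<^sup>2" "2 * t \<le> (t + \<tau> (fst p)) + (t + \<tau> (snd p)) - 2 * c"
    "0 \<le> ?p p c r" "?p p c r \<le> 1 / (2 * pi * t) ^ k"
    if p: "p \<in> A \<times> A" and c: "c = 0 \<or> c = \<rho> p" for p c r
  proof -
    have eg: "\<epsilon> * \<gamma> \<le> \<gamma>" using pos by simp
    have "0 \<le> \<tau> x" if "x \<in> A" for x using A\<tau>[OF that] eg pos by linarith
    then have n: "0 \<le> \<tau> (fst p)" "0 \<le> \<tau> (snd p)" using p by auto
    have c2: "c\<^sup>2 \<le> \<tau> (fst p) * \<tau> (snd p)"
      using c CS[of "fst p" "snd p"] n by auto
    note q = pair_density_le(1,2)[OF pos(2) n c2] pair_density_le(3)[OF pos(2) n c2, of k r]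
    show "t\<^sup>2 \<le> (t + \<tau> (fst p)) * (t + \<tau> (snd p)) - c\<^sup>2" "2 * t \<le> (t + \<tau> (fst p)) + (t + \<tau> (snd p)) - 2 * c"
      "?p p c r \<le> 1 / (2 * pi * t) ^ k"
      using q by auto
    have "0 < t\<^sup>2" using pos by simp
    then show "0 \<le> ?p p c r"
      using q(1) by (intro pair_density_nonneg) linarith
  qed
  have Wfin: "W c r < \<infinity>" if "c = (\<lambda>_. 0) \<or> c = \<rho>" for c r
  proof -
    have "W c r \<le> (\<integral>\<^sup>+p. ennreal (1 / (2 * pi * t) ^ k) \<partial>?MM)"
      unfolding W_def k_def[symmetric] using that pd
      by (intro nn_integral_mono) (auto split: split_indicator intro!: ennreal_leI)
    also have "\<dots> < \<infinity>" by (simp add: MM.P.emeasure_space_1)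
    finally show ?thesis .
  qed
  have Wm[measurable]: "W c \<in> borel_measurable borel" if [measurable]: "c \<in> borel_measurable ?MM" for c
    unfolding W_def by measurable
  define w where "w = (\<lambda>r. 1 + (r / s)\<^sup>2)"
  have [measurable]: "w \<in> borel_measurable borel" unfolding w_def by measurable
  have w: "0 < w r" for r unfolding w_def by (intro add_pos_nonneg) auto
  define v where "v = (\<lambda>r. enn2real (W \<rho> r) - enn2real (W (\<lambda>_. 0) r))"
  have [measurable]: "v \<in> borel_measurable borel" unfolding v_def by measurable
  \<comment> \<open>Exchanging the radial integral with the average over pairs makes each inner
    integral a \<open>radial_weight\<close>.\<close>
  have Fub: "(\<integral>\<^sup>+r. ennreal (w r * r ^ (2 * (k - 1))) * indicator {0..} r * W c r \<partial>lborel)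
      = (\<integral>\<^sup>+p. ennreal (?r p (c p)) * indicator (A \<times> A) p \<partial>?MM)"
    if c: "c = (\<lambda>_. 0) \<or> c = \<rho>" for c
  proof -
    have [measurable]: "c \<in> borel_measurable ?MM" using c by auto
    have "(\<integral>\<^sup>+r. ennreal (w r * r ^ (2 * (k - 1))) * indicator {0..} r * W c r \<partial>lborel)
      = (\<integral>\<^sup>+r. (\<integral>\<^sup>+p. ennreal (w r * r ^ (2 * (k - 1))) * indicator {0..} r * (ennreal (?p p (c p) r) * indicator (A \<times> A) p) \<partial>?MM) \<partial>lborel)"
      unfolding W_def k_def[symmetric] by (intro nn_integral_cong nn_integral_cmult[symmetric]) measurable
    also have "\<dots> = (\<integral>\<^sup>+p. (\<integral>\<^sup>+r. ennreal (w r * r ^ (2 * (k - 1))) * indicator {0..} r * (ennreal (?p p (c p) r) * indicator (A \<times> A) p) \<partial>lborel) \<partial>?MM)"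
      by (rule LM.Fubini'[symmetric]) measurable
    also have "\<dots> = (\<integral>\<^sup>+p. ennreal (?r p (c p)) * indicator (A \<times> A) p \<partial>?MM)"
    proof (intro nn_integral_cong)
      fix p
      show "(\<integral>\<^sup>+r. ennreal (w r * r ^ (2 * (k - 1))) * indicator {0..} r * (ennreal (?p p (c p) r) * indicator (A \<times> A) p) \<partial>lborel)
        = ennreal (?r p (c p)) * indicator (A \<times> A) p"
      proof (cases "p \<in> A \<times> A")
        case True
        have cp: "c p = 0 \<or> c p = \<rho> p" using c by auto
        have "0 < t\<^sup>2" "0 < 2 * t" using pos by auto
        then have D: "0 < (t + \<tau> (fst p)) * (t + \<tau> (snd p)) - (c p)\<^sup>2" "0 < (t + \<tau> (fst p)) + (t + \<tau> (snd p)) - 2 * c p"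
          using pd(1,2)[OF True cp] by linarith+
        have "(\<integral>\<^sup>+r. ennreal (w r * r ^ (2 * (k - 1))) * indicator {0..} r * (ennreal (?p p (c p) r) * indicator (A \<times> A) p) \<partial>lborel)
          = (\<integral>\<^sup>+r. ennreal ((1 + (r / s)\<^sup>2) * r ^ (2 * (k - 1)) * ?p p (c p) r) * indicator {0..} r \<partial>lborel)"
        proof (intro nn_integral_cong)
          fix r
          have "0 \<le> w r * r ^ (2 * (k - 1))" using w[of r] by (simp add: zero_le_even_power)
          then have "ennreal (w r * r ^ (2 * (k - 1)) * ?p p (c p) r) = ennreal (w r * r ^ (2 * (k - 1))) * ennreal (?p p (c p) r)"
            by (rule ennreal_mult')
          then show "ennreal (w r * r ^ (2 * (k - 1))) * indicator {0..} r * (ennreal (?p p (c p) r) * indicator (A \<times> A) p)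
             = ennreal ((1 + (r / s)\<^sup>2) * r ^ (2 * (k - 1)) * ?p p (c p) r) * indicator {0..} r"
            using True unfolding w_def[symmetric, THEN fun_cong] by (simp add: w_def mult_ac)
        qed
        also have "\<dots> = ennreal (?r p (c p))"
          by (rule nn_integral_pair_density_radial[OF D s k])
        finally show ?thesis using True by simp
      qed simp
    qed
    finally show ?thesis .
  qed
  define B where "B = K1 * (2 * real k * ((\<integral>p. \<bar>\<rho> p\<bar> \<partial>?MM) / \<gamma>) + 4 * sqrt R ^ k * ((\<integral>p. (\<rho> p)\<^sup>2 \<partial>?MM) / \<gamma>\<^sup>2))"
  have Ebeta: "0 \<le> (\<integral>p. \<bar>\<rho> p\<bar> \<partial>?MM)" "0 \<le> (\<integral>p. (\<rho> p)\<^sup>2 \<partial>?MM)" by auto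
  have B0: "0 \<le> B" using Ebeta K1 pos R by (auto simp: B_def intro!: mult_nonneg_nonneg add_nonneg_nonneg)
  have IF: "(\<integral>\<^sup>+p. ennreal (K1 * F p) \<partial>?MM) = ennreal B"
  proof -
    have "has_bochner_integral ?MM (\<lambda>p. K1 * (2 * real k * (\<bar>\<rho> p\<bar> / \<gamma>) + 4 * sqrt R ^ k * ((\<rho> p)\<^sup>2 / \<gamma>\<^sup>2))) B"
      unfolding B_def using int
      by (intro has_bochner_integral_mult_right has_bochner_integral_add has_bochner_integral_divide has_bochner_integral_integrable)
    moreover have "K1 * (2 * real k * (\<bar>\<rho> p\<bar> / \<gamma>) + 4 * sqrt R ^ k * ((\<rho> p)\<^sup>2 / \<gamma>\<^sup>2)) = K1 * F p" for p
      by (simp add: F_def power_divide mult_ac)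
    ultimately have "has_bochner_integral ?MM (\<lambda>p. K1 * F p) B" by (simp only:)
    then show ?thesis using K1 F0 by (subst nn_integral_eq_integral) (auto simp: has_bochner_integral_iff)
  qed
  let ?w = "\<lambda>r. ennreal (w r * r ^ (2 * (k - 1))) * indicator {0..} r"
  define I0 where "I0 = (\<integral>\<^sup>+r. ?w r * W (\<lambda>_. 0) r \<partial>lborel)"
  have pA: "\<bar>\<tau> (fst p) - \<gamma>\<bar> \<le> \<epsilon> * \<gamma> / 2" "\<bar>\<tau> (snd p) - \<gamma>\<bar> \<le> \<epsilon> * \<gamma> / 2" "(\<rho> p)\<^sup>2 \<le> \<tau> (fst p) * \<tau> (snd p)"
    if "p \<in> A \<times> A" for p using that A\<tau> CS by auto
  \<comment> \<open>Finiteness permits cancelling \<open>I0\<close> below; the bound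
    \<open>C0\<close> is the same for all pairs.\<close>
  have I0: "I0 < \<infinity>"
  proof -
    have "I0 \<le> (\<integral>\<^sup>+p. ennreal C0 \<partial>?MM)"
      unfolding I0_def Fub[of "\<lambda>_. 0", OF disjI1[OF refl]]
    proof (intro nn_integral_mono)
      fix p
      have "?r p 0 \<le> C0" if "p \<in> A \<times> A"
        using radial_weight_bounds(2)[OF pos pA[OF that] k] unfolding C0_def s_def .
      then show "ennreal (?r p 0) * indicator (A \<times> A) p \<le> ennreal C0"
        by (cases "p \<in> A \<times> A") (simp_all add: ennreal_leI)
    qed
    also have "\<dots> < \<infinity>" by (simp add: MM.P.emeasure_space_1)
    finally show ?thesis .
  qed
  have I1: "(\<integral>\<^sup>+r. ?w r * W \<rho> r \<partial>lborel) \<le> I0 + ennreal B"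
  proof -
    have "(\<integral>\<^sup>+r. ?w r * W \<rho> r \<partial>lborel)
      \<le> (\<integral>\<^sup>+p. ennreal (?r p 0) * indicator (A \<times> A) p + ennreal (K1 * F p) \<partial>?MM)"
      unfolding Fub[of \<rho>, OF disjI2[OF refl]]
    proof (intro nn_integral_mono)
      fix p
      show "ennreal (?r p (\<rho> p)) * indicator (A \<times> A) p
        \<le> ennreal (?r p 0) * indicator (A \<times> A) p + ennreal (K1 * F p)"
      proof (cases "p \<in> A \<times> A")
        case True
        have "ennreal (?r p (\<rho> p))
          \<le> ennreal (?r p 0 + K1 * F p)"
          using radial_weight_bounds(1)[OF pos pA[OF True] k] unfolding F_def s_def R_def K1_def
          by (rule ennreal_leI)
        also have "\<dots> \<le> ennreal (?r p 0) + ennreal (K1 * F p)"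
          using K1 F0 by (auto simp: ennreal_plus_if intro!: ennreal_leI)
        finally show ?thesis using True by simp
      qed simp
    qed
    also have "\<dots> = I0 + ennreal B"
      unfolding I0_def Fub[of "\<lambda>_. 0", OF disjI1[OF refl]] IF[symmetric]
      by (rule nn_integral_add) (auto simp: radial_weight_def)
    finally show ?thesis .
  qed
  \<comment> \<open>Subtraction in \<open>ennreal\<close> truncates, so \<open>v\<close> is
    integrated by adding the uncorrelated integral to both sides.\<close>
  have Bv: "(\<integral>\<^sup>+r. ennreal (w r * r ^ (2 * (k - 1)) * v r) * indicator {0..} r \<partial>lborel) \<le> ennreal B"
  proof -
    have "(\<integral>\<^sup>+r. ennreal (w r * r ^ (2 * (k - 1)) * v r) * indicator {0..} r \<partial>lborel) + I0
      = (\<integral>\<^sup>+r. ennreal (w r * r ^ (2 * (k - 1)) * v r) * indicator {0..} r + ?w r * W (\<lambda>_. 0) r \<partial>lborel)"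
      unfolding I0_def by (rule nn_integral_add[symmetric]) measurable
    also have "\<dots> = (\<integral>\<^sup>+r. ?w r * W \<rho> r \<partial>lborel)"
    proof (intro nn_integral_cong)
      fix r
      show "ennreal (w r * r ^ (2 * (k - 1)) * v r) * indicator {0..} r + ?w r * W (\<lambda>_. 0) r = ?w r * W \<rho> r"
      proof (cases "0 \<le> r")
        case True
        have e: "ennreal (enn2real (W c r)) = W c r" if "c = (\<lambda>_. 0) \<or> c = \<rho>" for c
          using Wfin[OF that] by simp
        have "enn2real (W (\<lambda>_. 0) r) \<le> enn2real (W \<rho> r)" using le[OF True] Wfin by (intro enn2real_mono) auto
        then have v0: "0 \<le> v r" by (simp add: v_def)
        have "W \<rho> r = ennreal (v r + enn2real (W (\<lambda>_. 0) r))" using e by (simp add: v_def)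
        also have "\<dots> = ennreal (v r) + W (\<lambda>_. 0) r" using v0 e by (subst ennreal_plus) auto
        finally have "W \<rho> r = ennreal (v r) + W (\<lambda>_. 0) r" .
        moreover have "0 \<le> w r * r ^ (2 * (k - 1))" using w[of r] by (simp add: zero_le_even_power)
        then have "ennreal (w r * r ^ (2 * (k - 1)) * v r) = ennreal (w r * r ^ (2 * (k - 1))) * ennreal (v r)"
          by (rule ennreal_mult')
        ultimately show ?thesis using True by (simp add: distrib_left)
      qed simp
    qed
    also have "\<dots> \<le> I0 + ennreal B" by (rule I1)
    finally show ?thesis using I0 by (metis add.commute ennreal_add_left_cancel_le less_irrefl infinity_ennreal_def)
  qed
  define c where "c = real k * unit_ball_vol (real k)"
  have c0: "0 \<le> c" by (simp add: c_def)
  have "(\<integral>\<^sup>+y. ennreal (sqrt (v (norm y))) \<partial>(lborel :: (real ^ 'k) measure))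
    = (\<integral>\<^sup>+r. ennreal (c * r ^ (k - 1)) * indicator {0..} r * ennreal (sqrt (v r)) \<partial>lborel)"
    by (subst nn_integral_radial) (auto simp: k_def c_def)
  also have "\<dots> \<le> ennreal (c * sqrt (pi * s / 2 * B))"
  proof (rule nn_integral_sqrt_Cauchy_Schwarz[where w=w])
    show "(\<integral>\<^sup>+r. ennreal (1 / w r) * indicator {0..} r \<partial>lborel) = ennreal (pi * s / 2)"
      unfolding w_def by (rule half_line_cauchy_integral[OF s])
  qed (use s B0 c0 w Bv in auto)
  also have "\<dots> \<le> ennreal (3 * CARD('k) powr (3 / 4) * ((\<integral>p. \<bar>\<rho> p\<bar> \<partial>?MM) / \<gamma>) powr (1 / 2)
        + 3 * CARD('k) powr (1 / 4) * (1 + (2 + \<epsilon>) * \<gamma> / t) powr (CARD('k) / 4) * (sqrt (\<integral>p. (\<rho> p)\<^sup>2 \<partial>?MM) / \<gamma>))"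
  proof (rule ennreal_leI)
    define b1 where "b1 = (\<integral>p. \<bar>\<rho> p\<bar> \<partial>?MM) / \<gamma>"
    define b2 where "b2 = (\<integral>p. (\<rho> p)\<^sup>2 \<partial>?MM) / \<gamma>\<^sup>2"
    have b: "0 \<le> b1" "0 \<le> b2" using Ebeta pos by (auto simp: b1_def b2_def)
    \<comment> \<open>\<open>c\<close> is the area of the unit sphere. The scale
      \<open>sqrt (2 * t + 2 * \<gamma>)\<close> cancels between \<open>s\<close> and
      \<open>K1\<close>, and what remains is 3 times the expression in
      \<open>polar_constant_bound\<close>.\<close>
    have cK: "c\<^sup>2 * (pi * s / 2) * K1 \<le> 9 / 4 * sqrt (real k)"
    proof -
      define g where "g = Gamma (real k / 2)"
      have g: "0 < g" using k by (simp add: g_def)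
      have Gg: "Gamma (real k / 2 + 1) = real k / 2 * g" unfolding g_def using k by (intro Gamma_plus1) (auto elim!: nonpos_Ints_cases)
      have "c = 2 * pi powr (real k / 2) / g" unfolding c_def unit_ball_vol_def Gg using k g by simp
      moreover have "(pi powr (real k / 2))\<^sup>2 = pi ^ k"
        by (simp add: power2_eq_square powr_add[symmetric] powr_realpow)
      ultimately have c2: "c\<^sup>2 = 4 * pi ^ k / g\<^sup>2" by (simp add: power_divide power_mult_distrib)
      define q where "q = sqrt (2 * t + 2 * \<gamma>)"
      have q: "0 < q" using pos by (simp add: q_def)
      have "c\<^sup>2 * (pi * s / 2) * K1 = 3 * (pi * sqrt (real (2 * k - 1)) * Gamma (real k - 1 / 2) * (sqrt 2 / 2) / (2 ^ k * g\<^sup>2))"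
        unfolding c2 s_def K1_def q_def[symmetric] using q g by (simp add: field_simps power_mult_distrib)
      also have "sqrt 2 / 2 = 1 / sqrt (2::real)" by (simp add: field_simps)
      also have "3 * (pi * sqrt (real (2 * k - 1)) * Gamma (real k - 1 / 2) * (1 / sqrt 2) / (2 ^ k * g\<^sup>2))
        = 3 * (pi * sqrt (real (2 * k - 1)) * Gamma (real k - 1 / 2) / (2 ^ k * sqrt 2 * g\<^sup>2))" by simp
      also have "\<dots> \<le> 3 * (3 / 4 * sqrt (real k))"
        unfolding g_def by (intro mult_left_mono polar_constant_bound k) simp
      finally show ?thesis by simp
    qed
    define G where "G = 2 * real k * b1 + 4 * sqrt R ^ k * b2"
    have G: "0 \<le> G" using b R by (simp add: G_def)
    have "c * sqrt (pi * s / 2 * B) = sqrt (c\<^sup>2 * (pi * s / 2) * K1 * G)"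
    proof -
      have "B = K1 * G" unfolding B_def G_def b1_def b2_def ..
      then have "c\<^sup>2 * (pi * s / 2) * K1 * G = c\<^sup>2 * (pi * s / 2 * B)" by (simp only: mult.assoc)
      moreover have "sqrt (c\<^sup>2 * x) = c * sqrt x" for x using c0 by (simp add: real_sqrt_mult)
      ultimately show ?thesis by (simp only:)
    qed
    also have "\<dots> \<le> sqrt (9 / 4 * sqrt (real k) * G)" using cK G by (intro real_sqrt_le_mono mult_right_mono)
    \<comment> \<open>The quadratic coefficient 4 gives exactly \<open>9 / 4 * 4 = 9\<close>; the
      linear one is rounded up from 9 / 2.\<close>
    also have "\<dots> \<le> sqrt (9 * (sqrt (real k) * real k * b1) + 9 * (sqrt (real k) * sqrt R ^ k * b2))"
    proof (rule real_sqrt_le_mono)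
      have "0 \<le> sqrt (real k) * real k * b1" using b by simp
      then show "9 / 4 * sqrt (real k) * G \<le> 9 * (sqrt (real k) * real k * b1) + 9 * (sqrt (real k) * sqrt R ^ k * b2)"
        unfolding G_def by (simp add: algebra_simps)
    qed
    also have "\<dots> \<le> sqrt (9 * (sqrt (real k) * real k * b1)) + sqrt (9 * (sqrt (real k) * sqrt R ^ k * b2))"
      using b R by (intro sqrt_add_le_add_sqrt) auto
    also have "sqrt (9 * (sqrt (real k) * real k * b1)) = 3 * real k powr (3 / 4) * b1 powr (1 / 2)"
    proof -
      have "sqrt (real k) * real k = real k powr (1 / 2) * real k powr 1" using k by (simp add: powr_half_sqrt)
      also have "\<dots> = real k powr (3 / 2)" unfolding powr_add[symmetric] by simp
      finally have "sqrt (sqrt (real k) * real k) = (real k powr (3 / 2)) powr (1 / 2)" by (simp add: powr_half_sqrt)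
      also have "\<dots> = real k powr (3 / 4)" unfolding powr_powr by simp
      finally have 1: "sqrt (sqrt (real k) * real k) = real k powr (3 / 4)" .
      have "sqrt (9 * (sqrt (real k) * real k * b1)) = sqrt 9 * sqrt (sqrt (real k) * real k) * sqrt b1"
        by (simp only: real_sqrt_mult mult.assoc)
      moreover have "sqrt (9::real) = 3" by (rule real_sqrt_unique) auto
      ultimately show ?thesis unfolding 1 using b by (simp add: powr_half_sqrt)
    qed
    also have "sqrt (9 * (sqrt (real k) * sqrt R ^ k * b2)) = 3 * real k powr (1 / 4) * R powr (real k / 4) * sqrt b2"
    proof -
      have 1: "sqrt (sqrt (real k)) = real k powr (1 / 4)"
        by (simp add: powr_half_sqrt[symmetric] powr_powr)
      have "sqrt R ^ k = R powr (real k / 2)" using R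
        by (simp add: powr_half_sqrt[symmetric] powr_powr powr_realpow[symmetric])
      then have 2: "sqrt (sqrt R ^ k) = R powr (real k / 4)" by (simp add: powr_half_sqrt[symmetric] powr_powr)
      have "sqrt (9 * (sqrt (real k) * sqrt R ^ k * b2)) = sqrt 9 * sqrt (sqrt (real k)) * sqrt (sqrt R ^ k) * sqrt b2"
        by (simp only: real_sqrt_mult mult.assoc)
      moreover have "sqrt (9::real) = 3" by (rule real_sqrt_unique) auto
      ultimately show ?thesis unfolding 1 2 by simp
    qed
    also have "sqrt b2 = sqrt (\<integral>p. (\<rho> p)\<^sup>2 \<partial>?MM) / \<gamma>" using pos by (simp add: b2_def real_sqrt_divide)
    finally show "c * sqrt (pi * s / 2 * B) \<le> 3 * CARD('k) powr (3 / 4) * ((\<integral>p. \<bar>\<rho> p\<bar> \<partial>?MM) / \<gamma>) powr (1 / 2)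
        + 3 * CARD('k) powr (1 / 4) * (1 + (2 + \<epsilon>) * \<gamma> / t) powr (CARD('k) / 4) * (sqrt (\<integral>p. (\<rho> p)\<^sup>2 \<partial>?MM) / \<gamma>)"
      unfolding b1_def R_def k_def .
  qed
  finally show ?thesis unfolding v_def .
qed

section \<open>Projections and relative entropy\<close>

lemma bivariate_uncorrelated:
  assumes "0 < a" "0 < b"
  shows "bivariate a b 0 x y = normal_density 0 (sqrt a) x * normal_density 0 (sqrt b) y"
proof -
  have e: "- (b * x\<^sup>2 - 2 * 0 * x * y + a * y\<^sup>2) / (2 * (a * b - 0\<^sup>2)) = - x\<^sup>2 / (2 * a) + - y\<^sup>2 / (2 * b)"
    using assms by (simp add: field_simps)
  have "sqrt (2 * pi * a) * sqrt (2 * pi * b) = 2 * pi * sqrt (a * b)"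
  proof -
    have "sqrt (2 * pi) * sqrt (2 * pi) = 2 * pi" by simp
    then show ?thesis
      unfolding real_sqrt_mult[of "2 * pi" a] real_sqrt_mult[of "2 * pi" b] real_sqrt_mult[of a b]
      by (metis mult.assoc mult.left_commute)
  qed
  then show ?thesis
    unfolding bivariate_def e exp_add using assms by (simp add: normal_density_def)
qed

text \<open>On the diagonal the quadratic form collapses to \<open>a + b - 2 * c\<close> times a
  square, so only the norm enters.\<close>

lemma prod_bivariate_eq_pair_density:
  fixes y :: "real ^ 'k"
  shows "(\<Prod>i\<in>UNIV. bivariate a b c (y $ i) (y $ i)) = pair_density CARD('k) a b c (norm y)"
proof -
  have "(\<Prod>i\<in>UNIV. bivariate a b c (y $ i) (y $ i))
    = (\<Prod>i\<in>(UNIV::'k set). exp (- ((a + b - 2 * c) * (y $ i)\<^sup>2) / (2 * (a * b - c\<^sup>2)))) / (2 * pi * sqrt (a * b - c\<^sup>2)) ^ CARD('k)"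
    by (simp add: bivariate_def prod_dividef power2_eq_square algebra_simps)
  also have "(\<Prod>i\<in>(UNIV::'k set). exp (- ((a + b - 2 * c) * (y $ i)\<^sup>2) / (2 * (a * b - c\<^sup>2))))
     = exp (\<Sum>i\<in>UNIV. - ((a + b - 2 * c) * (y $ i)\<^sup>2) / (2 * (a * b - c\<^sup>2)))"
    by (simp add: exp_sum)
  also have "(\<Sum>i\<in>UNIV. - ((a + b - 2 * c) * (y $ i)\<^sup>2) / (2 * (a * b - c\<^sup>2))) = - ((a + b - 2 * c) * (norm y)\<^sup>2) / (2 * (a * b - c\<^sup>2))"
  proof -
    have "(norm y)\<^sup>2 = (\<Sum>i\<in>UNIV. (y $ i)\<^sup>2)"
      unfolding power2_norm_eq_inner by (simp add: inner_vec_def power2_eq_square)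
    then show ?thesis by (simp add: sum_divide_distrib[symmetric] sum_negf sum_distrib_left[symmetric])
  qed
  finally show ?thesis by (simp add: pair_density_def)
qed

lemma pair_density_uncorrelated:
  fixes y :: "real ^ 'k"
  assumes "0 < a" "0 < b"
  shows "pair_density CARD('k) a b 0 (norm y) = gauss a y * gauss b y"
  using assms gauss_shift_eq_prod[of a y 0] gauss_shift_eq_prod[of b y 0]
  by (simp add: prod_bivariate_eq_pair_density[symmetric] bivariate_uncorrelated prod.distrib)

lemma sum_UNIV_prod_fst:
  fixes g :: "'k::finite \<times> 'n::finite \<Rightarrow> 'c::comm_monoid_add"
  shows "(\<Sum>p\<in>UNIV. if fst p = i then g p else 0) = (\<Sum>j\<in>UNIV. g (i, j))"
proof -
  have "(\<Sum>p\<in>UNIV. if fst p = i then g p else 0) = (\<Sum>i'\<in>UNIV. \<Sum>j\<in>UNIV. if i' = i then g (i', j) else 0)"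
    unfolding UNIV_Times_UNIV[symmetric] sum.cartesian_product by (intro sum.cong) auto
  also have "\<dots> = (\<Sum>i'\<in>UNIV. if i' = i then (\<Sum>j\<in>UNIV. g (i', j)) else 0)"
    by (intro sum.cong) auto
  finally show ?thesis by (simp add: sum.delta)
qed

text \<open>For a fixed matrix the factors are densities at \<open>y\<close> of two noisy
  observations, of \<open>x1\<close> and of \<open>x2\<close>, with independent noises; each row
  contributes an uncorrelated pair. Averaging over the entries adds \<open>s\<close> times the Gram
  matrix of \<open>x1\<close> and \<open>x2\<close> to the covariance.\<close>

lemma (in prob_space) gaussian_projection_second_moment:
  fixes \<Theta> :: "'a \<Rightarrow> real ^ 'n ^ 'k" and x1 x2 :: "real ^ 'n" and y :: "real ^ 'k"
  assumes \<Theta>[measurable]: "\<Theta> \<in> borel_measurable M"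
    and ind: "indep_vars (\<lambda>_. borel) (\<lambda>(i, j) \<omega>. \<Theta> \<omega> $ i $ j) (UNIV :: ('k \<times> 'n) set)"
    and dist: "\<And>i j. distributed M lborel (\<lambda>\<omega>. \<Theta> \<omega> $ i $ j) (\<lambda>x. ennreal (normal_density 0 (sqrt s) x))"
    and s: "0 < s" and t: "0 < t"
  shows "(\<integral>\<^sup>+\<omega>. ennreal (gauss t (y - \<Theta> \<omega> *v x1) * gauss t (y - \<Theta> \<omega> *v x2)) \<partial>M)
    = ennreal (pair_density CARD('k) (t + s * (x1 \<bullet> x1)) (t + s * (x2 \<bullet> x2)) (s * (x1 \<bullet> x2)) (norm y))"
proof -
  define G where "G = density lborel (\<lambda>\<theta>. ennreal (normal_density 0 (sqrt s) \<theta>))"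
  let ?Z = "\<lambda>p \<omega>. \<Theta> \<omega> $ fst p $ snd p"
  define H where "H = (\<lambda>\<theta>. \<Prod>i\<in>UNIV. ennreal (bivariate t t 0
           (y $ i - (\<Sum>p\<in>(UNIV::('k \<times> 'n) set). if fst p = i then \<theta> p * x1 $ (snd p) else 0))
           (y $ i - (\<Sum>p\<in>(UNIV::('k \<times> 'n) set). if fst p = i then \<theta> p * x2 $ (snd p) else 0))))"
  have [measurable]: "H \<in> borel_measurable (PiM UNIV (\<lambda>_. borel))"
    unfolding H_def bivariate_def by measurable
  have Zm[measurable]: "?Z p \<in> borel_measurable M" for p
    using distributed_measurable[OF dist[of "fst p" "snd p"]] by simp
  have "indep_vars (\<lambda>_. borel) ?Z UNIV" using ind by (simp add: case_prod_beta')
  then have "distr M (PiM UNIV (\<lambda>_. borel)) (\<lambda>\<omega>. \<lambda>p\<in>UNIV. ?Z p \<omega>) = PiM UNIV (\<lambda>p. distr M borel (?Z p))"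
    by (subst (asm) indep_vars_iff_distr_eq_PiM') auto
  moreover have "distr M borel (?Z p) = G" for p
  proof -
    have "distr M borel (?Z p) = distr M lborel (?Z p)" by (rule distr_cong) auto
    then show ?thesis using distributed_distr_eq_density[OF dist[of "fst p" "snd p"]] by (simp add: G_def)
  qed
  ultimately have d: "distr M (PiM UNIV (\<lambda>_. borel)) (\<lambda>\<omega>. \<lambda>p\<in>UNIV. ?Z p \<omega>) = PiM UNIV (\<lambda>_. G)" by simp
  have eq: "ennreal (gauss t (y - \<Theta> \<omega> *v x1) * gauss t (y - \<Theta> \<omega> *v x2)) = H (\<lambda>p. ?Z p \<omega>)" for \<omega>
  proof -
    have mv: "(\<Theta> \<omega> *v x) $ i = (\<Sum>p\<in>UNIV. if fst p = i then ?Z p \<omega> * x $ snd p else 0)" for x i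
      unfolding sum_UNIV_prod_fst by (simp add: matrix_vector_mult_def)
    have nd: "normal_density m (sqrt t) z = normal_density 0 (sqrt t) (z - m)" for m z :: real by (simp add: normal_density_def)
    have "gauss t (y - \<Theta> \<omega> *v x1) * gauss t (y - \<Theta> \<omega> *v x2)
       = (\<Prod>i\<in>UNIV. bivariate t t 0 (y $ i - (\<Theta> \<omega> *v x1) $ i) (y $ i - (\<Theta> \<omega> *v x2) $ i))"
      using t unfolding gauss_shift_eq_prod[OF t] bivariate_uncorrelated[OF t t] prod.distrib[symmetric]
      by (subst (1 2) nd) simp
    also have "ennreal \<dots> = H (\<lambda>p. ?Z p \<omega>)"
      unfolding H_def mv by (subst prod_ennreal) (auto simp: bivariate_uncorrelated[OF t t])
    finally show ?thesis .
  qed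
  have "(\<integral>\<^sup>+\<omega>. H (\<lambda>p\<in>UNIV. ?Z p \<omega>) \<partial>M) = (\<integral>\<^sup>+\<theta>. H \<theta> \<partial>distr M (PiM UNIV (\<lambda>_. borel)) (\<lambda>\<omega>. \<lambda>p\<in>UNIV. ?Z p \<omega>))"
    by (subst nn_integral_distr) auto
  also have "\<dots> = (\<integral>\<^sup>+\<theta>. H \<theta> \<partial>PiM UNIV (\<lambda>_. G))" unfolding d ..
  also have "\<dots> = (\<Prod>i\<in>UNIV. ennreal (bivariate (t + s * (x1 \<bullet> x1)) (t + s * (x2 \<bullet> x2)) (s * (x1 \<bullet> x2)) (y $ i) (y $ i)))"
    unfolding H_def G_def
    by (subst conjunct1[OF nn_integral_PiM_bivariate[OF s t]])
       (simp add: sum_UNIV_prod_fst inner_vec_def power2_eq_square)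
  also have "\<dots> = ennreal (\<Prod>i\<in>UNIV. bivariate (t + s * (x1 \<bullet> x1)) (t + s * (x2 \<bullet> x2)) (s * (x1 \<bullet> x2)) (y $ i) (y $ i))"
  proof (rule prod_ennreal)
    have "(s * (x1 \<bullet> x2))\<^sup>2 \<le> (s * (x1 \<bullet> x1)) * (s * (x2 \<bullet> x2))"
      using Cauchy_Schwarz_ineq[of x1 x2] s by (simp add: power_mult_distrib power2_eq_square mult_left_mono mult_ac)
    from pair_density_le(1)[OF t _ _ this] s have "t\<^sup>2 \<le> (t + s * (x1 \<bullet> x1)) * (t + s * (x2 \<bullet> x2)) - (s * (x1 \<bullet> x2))\<^sup>2"
      by simp
    moreover have "0 < t\<^sup>2" using t by simp
    ultimately have "0 < (t + s * (x1 \<bullet> x1)) * (t + s * (x2 \<bullet> x2)) - (s * (x1 \<bullet> x2))\<^sup>2" by linarith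
    then show "0 \<le> bivariate (t + s * (x1 \<bullet> x1)) (t + s * (x2 \<bullet> x2)) (s * (x1 \<bullet> x2)) (y $ i) (y $ i)" for i
      unfolding bivariate_def by (auto intro!: divide_nonneg_nonneg mult_nonneg_nonneg)
  qed
  finally show ?thesis
    unfolding eq prod_bivariate_eq_pair_density by (simp add: restrict_UNIV)
qed

text \<open>The case \<open>x2 = 0\<close> of the second moment: the second factor is then the
  positive constant \<open>gauss t y\<close>, which cancels.\<close>

lemma (in prob_space) gaussian_projection_mean:
  fixes \<Theta> :: "'a \<Rightarrow> real ^ 'n ^ 'k" and x :: "real ^ 'n" and y :: "real ^ 'k"
  assumes \<Theta>[measurable]: "\<Theta> \<in> borel_measurable M"
    and ind: "indep_vars (\<lambda>_. borel) (\<lambda>(i, j) \<omega>. \<Theta> \<omega> $ i $ j) (UNIV :: ('k \<times> 'n) set)"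
    and dist: "\<And>i j. distributed M lborel (\<lambda>\<omega>. \<Theta> \<omega> $ i $ j) (\<lambda>x. ennreal (normal_density 0 (sqrt s) x))"
    and s: "0 < s" and t: "0 < t"
  shows "(\<integral>\<^sup>+\<omega>. ennreal (gauss t (y - \<Theta> \<omega> *v x)) \<partial>M) = ennreal (gauss (t + s * (x \<bullet> x)) y)"
proof -
  have a: "0 < t + s * (x \<bullet> x)" using s t by (simp add: add_pos_nonneg)
  have c: "0 < gauss t y" using t by (rule gauss_pos)
  have [measurable]: "(\<lambda>\<omega>. \<Theta> \<omega> *v x) \<in> borel_measurable M"
  proof -
    have "continuous_on UNIV (\<lambda>A::real ^ 'n ^ 'k. A *v x)"
      unfolding matrix_vector_mult_def by (intro continuous_on_vec_lambda continuous_intros)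
    then show ?thesis using measurable_compose[OF \<Theta> borel_measurable_continuous_onI] by simp
  qed
  have "(\<integral>\<^sup>+\<omega>. ennreal (gauss t (y - \<Theta> \<omega> *v x)) \<partial>M) * ennreal (gauss t y)
     = (\<integral>\<^sup>+\<omega>. ennreal (gauss t (y - \<Theta> \<omega> *v x) * gauss t (y - \<Theta> \<omega> *v 0)) \<partial>M)"
    using t by (subst nn_integral_multc[symmetric]) (auto simp: ennreal_mult' gauss_nonneg)
  also have "\<dots> = ennreal (gauss (t + s * (x \<bullet> x)) y) * ennreal (gauss t y)"
    unfolding gaussian_projection_second_moment[OF \<Theta> ind dist s t]
    using pair_density_uncorrelated[OF a t, of y] a by (simp add: ennreal_mult' gauss_nonneg)
  finally show ?thesis using c
    by (simp add: mult.commute[of _ "ennreal (gauss t y)"] ennreal_mult_cancel_left)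
qed

section \<open>Relative entropy of densities\<close>

lemma ln_gauss: "0 < v \<Longrightarrow> ln (gauss v (y :: real ^ 'k)) = - (y \<bullet> y) / (2 * v) - CARD('k) / 2 * ln (2 * pi * v)"
  by (simp add: gauss_def ln_div ln_sqrt ln_realpow)

text \<open>The logarithm of a quotient of Gaussians is a quadratic polynomial, so the integral
  combines the second moments of the first density about \<mu> and about 0 with the total
  masses.\<close>

lemma nn_integral_ell_gauss:
  fixes \<mu> :: "real ^ 'k"
  assumes a: "0 < a" and v: "0 < v"
  shows "(\<integral>\<^sup>+y. ennreal (ell (gauss a (y - \<mu>)) (gauss v y)) \<partial>lborel)
    = ennreal (CARD('k) / 2 * (ln (v / a) + a / v - 1) + (\<mu> \<bullet> \<mu>) / (2 * v))"
proof -
  let ?k = "real CARD('k)"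
  let ?g = "\<lambda>y. gauss a (y - \<mu>)"
  have e: "ell (?g y) (gauss v y) = (- 1 / (2 * a)) * (?g y * ((y - \<mu>) \<bullet> (y - \<mu>))) + (1 / (2 * v)) * (?g y * ((y - 0) \<bullet> (y - 0)))
      + (?k / 2 * ln (v / a) - 1) * ?g y + gauss v (y - 0)" for y
  proof -
    have L: "ln (?g y / gauss v y) = - ((y - \<mu>) \<bullet> (y - \<mu>)) / (2 * a) + (y \<bullet> y) / (2 * v) + ?k / 2 * ln (v / a)"
    proof -
      have A1: "ln (?g y / gauss v y) = ln (?g y) - ln (gauss v y)" 
        using gauss_pos[OF a, of "y - \<mu>"] gauss_pos[OF v, of y] by (simp add: ln_div)
      have A2: "ln (v / a) = ln (2 * pi * v) - ln (2 * pi * a)"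
        using a v by (simp add: ln_div ln_mult)
      show ?thesis unfolding A1 A2 ln_gauss[OF a] ln_gauss[OF v] by (simp add: algebra_simps)
    qed
    have "g * (- Q / (2 * a) + S / (2 * v) + L) - g + h = (- 1 / (2 * a)) * (g * Q) + (1 / (2 * v)) * (g * S) + (L - 1) * g + h"
      for g h Q S L :: real by (simp add: algebra_simps)
    then show ?thesis unfolding ell_def L diff_0_right .
  qed
  have "has_bochner_integral lborel (\<lambda>y. ell (?g y) (gauss v y))
     ((- 1 / (2 * a)) * (?k * a + (\<mu> - \<mu>) \<bullet> (\<mu> - \<mu>)) + (1 / (2 * v)) * (?k * a + (\<mu> - 0) \<bullet> (\<mu> - 0)) + (?k / 2 * ln (v / a) - 1) * 1 + 1)"
    unfolding e
    by (intro has_bochner_integral_add has_bochner_integral_mult_right gauss_second_moment[OF a, of \<mu> \<mu>]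
        gauss_second_moment[OF a, of \<mu> 0] gauss_integral a v)
  also have "((- 1 / (2 * a)) * (?k * a + (\<mu> - \<mu>) \<bullet> (\<mu> - \<mu>)) + (1 / (2 * v)) * (?k * a + (\<mu> - 0) \<bullet> (\<mu> - 0)) + (?k / 2 * ln (v / a) - 1) * 1 + 1)
     = ?k / 2 * (ln (v / a) + a / v - 1) + (\<mu> \<bullet> \<mu>) / (2 * v)"
    using a v by (simp add: field_simps)
  finally show ?thesis
    using ell_nonneg[OF gauss_nonneg[OF a] gauss_pos[OF v]]
    by (subst nn_integral_eq_integral) (auto simp: has_bochner_integral_iff)
qed

text \<open>\<open>ell\<close> differs from the entropy integrand by \<open>g - f\<close>, whose
  integral vanishes. If the right side is finite, the entropy density is integrable and the
  real-valued branch of \<open>rel_entropy\<close> applies; positivity of \<open>g\<close> provides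
  absolute continuity.\<close>

lemma rel_entropy_density_le:
  fixes f g :: "'b \<Rightarrow> real"
  assumes M: "sigma_finite_measure M"
    and f: "has_bochner_integral M f 1" "\<And>y. 0 \<le> f y"
    and g: "has_bochner_integral M g 1" "\<And>y. 0 < g y"
  shows "rel_entropy (density M (\<lambda>y. ennreal (f y))) (density M (\<lambda>y. ennreal (g y))) \<le> (\<integral>\<^sup>+y. ennreal (ell (f y) (g y)) \<partial>M)"
proof (cases "(\<integral>\<^sup>+y. ennreal (ell (f y) (g y)) \<partial>M) = \<infinity>")
  case False
  interpret sigma_finite_measure M by fact
  have [measurable]: "f \<in> borel_measurable M" "g \<in> borel_measurable M"
    using f g by (auto simp: has_bochner_integral_iff)
  have [measurable]: "(\<lambda>y. ell (f y) (g y)) \<in> borel_measurable M" unfolding ell_def by measurable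
  have l0: "0 \<le> ell (f y) (g y)" for y using f g by (intro ell_nonneg) auto
  have il: "integrable M (\<lambda>y. ell (f y) (g y))"
    using False l0 by (intro integrableI_nonneg) (auto simp: top.not_eq_extremum)
  have fi: "integrable M f" "integrable M g" "(\<integral>y. f y \<partial>M) = 1" "(\<integral>y. g y \<partial>M) = 1"
    using f g by (auto simp: has_bochner_integral_iff)
  have eq: "f y * ln (f y / g y) = ell (f y) (g y) + f y - g y" for y by (simp add: ell_def)
  have ifl: "integrable M (\<lambda>y. f y * ln (f y / g y))" unfolding eq using il fi by auto
  have ifv: "(\<integral>y. f y * ln (f y / g y) \<partial>M) = (\<integral>y. ell (f y) (g y) \<partial>M)"
    unfolding eq using il fi by simp
  let ?P = "density M (\<lambda>y. ennreal (f y))" and ?Q = "density M (\<lambda>y. ennreal (g y))"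
  interpret Q: sigma_finite_measure ?Q
    by (subst sigma_finite_iff_density_finite) auto
  have gn: "g y \<noteq> 0" for y using g(2)[of y] by simp
  have PQ: "?P = density ?Q (\<lambda>y. ennreal (f y / g y))"
    using f g gn by (subst density_density_divide) (simp_all add: less_imp_le)
  have ac: "absolutely_continuous ?Q ?P" unfolding PQ by (rule absolutely_continuousI_density) measurable
  have "density ?Q (RN_deriv ?Q ?P) = density ?Q (\<lambda>y. ennreal (f y / g y))"
    using Q.density_RN_deriv[OF ac] by (simp add: PQ)
  then have "AE y in ?Q. RN_deriv ?Q ?P y = ennreal (f y / g y)"
    by (intro Q.density_unique) auto
  then have "AE y in M. RN_deriv ?Q ?P y = ennreal (f y / g y)"
    using g(2) by (simp add: AE_density)
  then have ed: "AE y in M. entropy_density (exp 1) ?Q ?P y = ln (f y / g y)"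
    by eventually_elim (use f g in \<open>simp add: entropy_density_def log_ln[symmetric] less_imp_le\<close>)
  have [measurable]: "entropy_density (exp 1) ?Q ?P \<in> borel_measurable M"
    using measurable_entropy_density[of "exp 1" ?Q ?P] by simp
  have "integrable M (\<lambda>y. f y * entropy_density (exp 1) ?Q ?P y)"
    by (rule integrable_cong_AE_imp[OF ifl]) (use ed in \<open>auto elim: eventually_mono\<close>)
  then have int: "integrable ?P (entropy_density (exp 1) ?Q ?P)"
    using f by (subst integrable_real_density) auto
  have "KL_divergence (exp 1) ?Q ?P = (\<integral>y. f y * log (exp 1) (f y / g y) \<partial>M)"
    using f g gn by (intro KL_density_density) (simp_all add: less_imp_le)
  also have "\<dots> = (\<integral>y. ell (f y) (g y) \<partial>M)" unfolding log_ln[symmetric] ifv ..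
  finally have "rel_entropy ?P ?Q = ennreal (\<integral>y. ell (f y) (g y) \<partial>M)"
    using ac int by (simp add: rel_entropy_def)
  then show ?thesis using il l0 by (subst nn_integral_eq_integral) auto
qed simp

section \<open>The conditional distribution\<close>

text \<open>The hypothesis speaks of boxes only. With \<open>A\<close> fixed, one uniqueness
  argument extends it to all measurable sets of the last two coordinates; a second one adds the
  first coordinate.\<close>

lemma distr_indep_triple:
  assumes "prob_space M" and ind: "indep_triple M S X T Y U Z"
  shows "distr M (S \<Otimes>\<^sub>M (T \<Otimes>\<^sub>M U)) (\<lambda>\<omega>. (X \<omega>, Y \<omega>, Z \<omega>)) = distr M S X \<Otimes>\<^sub>M (distr M T Y \<Otimes>\<^sub>M distr M U Z)"
proof -
  interpret prob_space M by fact
  have X[measurable]: "X \<in> measurable M S" and Y[measurable]: "Y \<in> measurable M T" and Z[measurable]: "Z \<in> measurable M U"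
    using ind by (auto simp: indep_triple_def)
  have rect: "emeasure M {\<omega> \<in> space M. X \<omega> \<in> A \<and> Y \<omega> \<in> B \<and> Z \<omega> \<in> C}
      = emeasure (distr M S X) A * (emeasure (distr M T Y) B * emeasure (distr M U Z) C)"
    if "A \<in> sets S" "B \<in> sets T" "C \<in> sets U" for A B C
  proof -
    have vi: "V -` D \<inter> space M = {\<omega> \<in> space M. V \<omega> \<in> D}" for V :: "'a \<Rightarrow> 'z" and D by auto
    have "measure M {\<omega> \<in> space M. X \<omega> \<in> A \<and> Y \<omega> \<in> B \<and> Z \<omega> \<in> C} =
        measure M {\<omega> \<in> space M. X \<omega> \<in> A} * measure M {\<omega> \<in> space M. Y \<omega> \<in> B} * measure M {\<omega> \<in> space M. Z \<omega> \<in> C}"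
      using ind that by (auto simp: indep_triple_def)
    moreover have "emeasure (distr M S X) A = ennreal (measure M {\<omega> \<in> space M. X \<omega> \<in> A})"
      "emeasure (distr M T Y) B = ennreal (measure M {\<omega> \<in> space M. Y \<omega> \<in> B})"
      "emeasure (distr M U Z) C = ennreal (measure M {\<omega> \<in> space M. Z \<omega> \<in> C})"
      using that by (simp_all add: emeasure_distr emeasure_eq_measure vimage_def Int_def conj_commute)
    ultimately show ?thesis by (simp add: emeasure_eq_measure ennreal_mult mult.assoc)
  qed
  interpret TY: prob_space "distr M T Y" by (rule prob_space_distr) measurable
  interpret UZ: prob_space "distr M U Z" by (rule prob_space_distr) measurable
  interpret SX: prob_space "distr M S X" by (rule prob_space_distr) measurable
  interpret YZ: pair_prob_space "distr M T Y" "distr M U Z" ..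
  let ?S = "distr M S X" and ?T = "distr M T Y" and ?U = "distr M U Z"
  show ?thesis
  proof (rule pair_measure_eqI[symmetric])
    show "sigma_finite_measure (?S)" "sigma_finite_measure (?T \<Otimes>\<^sub>M ?U)"
      by (simp_all add: SX.sigma_finite_measure_axioms YZ.P.sigma_finite_measure_axioms)
    show "sets (?S \<Otimes>\<^sub>M (?T \<Otimes>\<^sub>M ?U)) = sets (distr M (S \<Otimes>\<^sub>M (T \<Otimes>\<^sub>M U)) (\<lambda>\<omega>. (X \<omega>, Y \<omega>, Z \<omega>)))"
      by (simp cong: sets_pair_measure_cong)
    fix A C assume "A \<in> sets (?S)" and "C \<in> sets (?T \<Otimes>\<^sub>M ?U)"
    then have A[measurable]: "A \<in> sets S" and C[measurable]: "C \<in> sets (T \<Otimes>\<^sub>M U)"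
      by (simp_all cong: sets_pair_measure_cong)
    define a where "a = emeasure (?S) A"
    \<comment> \<open>Restricting \<open>M\<close> to the event that \<open>X\<close> lies in
      \<open>A\<close> makes the inner claim an identity of product measures; the mass
      \<open>a\<close> is moved into the first factor by scaling.\<close>
    define D where "D = density M (indicator (X -` A \<inter> space M))"
    let ?D = "distr D (T \<Otimes>\<^sub>M U) (\<lambda>\<omega>. (Y \<omega>, Z \<omega>))"
    have XA[measurable]: "X -` A \<inter> space M \<in> sets M" by measurable
    have D: "emeasure ?D E = emeasure M {\<omega> \<in> space M. X \<omega> \<in> A \<and> (Y \<omega>, Z \<omega>) \<in> E}"
      if E[measurable]: "E \<in> sets (T \<Otimes>\<^sub>M U)" for E
    proof -
      have "emeasure ?D E = emeasure D ((\<lambda>\<omega>. (Y \<omega>, Z \<omega>)) -` E \<inter> space M)"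
        by (subst emeasure_distr) (auto simp: D_def)
      also have "\<dots> = (\<integral>\<^sup>+\<omega>. indicator (X -` A \<inter> space M) \<omega> * indicator ((\<lambda>\<omega>. (Y \<omega>, Z \<omega>)) -` E \<inter> space M) \<omega> \<partial>M)"
        unfolding D_def by (rule emeasure_density) measurable
      also have "\<dots> = (\<integral>\<^sup>+\<omega>. indicator {\<omega> \<in> space M. X \<omega> \<in> A \<and> (Y \<omega>, Z \<omega>) \<in> E} \<omega> \<partial>M)"
        by (intro nn_integral_cong) (auto split: split_indicator)
      also have "\<dots> = emeasure M {\<omega> \<in> space M. X \<omega> \<in> A \<and> (Y \<omega>, Z \<omega>) \<in> E}"
        by (rule nn_integral_indicator) measurable
      finally show ?thesis .
    qed
    have af: "a < \<infinity>" by (simp add: a_def less_top[symmetric])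
    have fin: "finite_measure (scale_measure a (?T))"
      by (rule finite_measureI) (use af in \<open>simp add: ennreal_mult_eq_top_iff less_top emeasure_eq_measure\<close>)
    have "scale_measure a (?T) \<Otimes>\<^sub>M ?U = ?D"
    proof (rule pair_measure_eqI)
      show "sigma_finite_measure (scale_measure a (?T))" using fin by (rule finite_measure.axioms(1))
      show "sigma_finite_measure (?U)" by (rule UZ.sigma_finite_measure_axioms)
      show "sets (scale_measure a (?T) \<Otimes>\<^sub>M ?U) = sets ?D"
        by (simp cong: sets_pair_measure_cong)
      fix B C assume "B \<in> sets (scale_measure a (?T))" "C \<in> sets (?U)"
      then have BC: "B \<in> sets T" "C \<in> sets U" by auto
      then have "emeasure ?D (B \<times> C) = a * (emeasure (?T) B * emeasure (?U) C)"
        unfolding a_def by (subst D) (auto simp: rect[OF A BC, symmetric])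
      then show "emeasure (scale_measure a (?T)) B * emeasure (?U) C = emeasure ?D (B \<times> C)"
        by (simp add: mult.assoc)
    qed
    then have "emeasure ?D C = emeasure (scale_measure a (?T) \<Otimes>\<^sub>M ?U) C" by simp
    also have "\<dots> = a * emeasure (?T \<Otimes>\<^sub>M ?U) C"
    proof -
      have C': "C \<in> sets (?T \<Otimes>\<^sub>M ?U)" "C \<in> sets (scale_measure a (?T) \<Otimes>\<^sub>M ?U)"
        using C by (simp_all cong: sets_pair_measure_cong)
      have [measurable]: "(\<lambda>x. emeasure (?U) (Pair x -` C)) \<in> borel_measurable (?T)"
        by (rule UZ.measurable_emeasure_Pair[OF C'(1)])
      show ?thesis
        unfolding UZ.emeasure_pair_measure_alt[OF C'(1)] UZ.emeasure_pair_measure_alt[OF C'(2)]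
        by (subst nn_integral_scale_measure) auto
    qed
    finally have "emeasure M {\<omega> \<in> space M. X \<omega> \<in> A \<and> (Y \<omega>, Z \<omega>) \<in> C} = a * emeasure (?T \<Otimes>\<^sub>M ?U) C"
      unfolding D[OF C] .
    moreover have "emeasure (distr M (S \<Otimes>\<^sub>M (T \<Otimes>\<^sub>M U)) (\<lambda>\<omega>. (X \<omega>, Y \<omega>, Z \<omega>))) (A \<times> C)
       = emeasure M {\<omega> \<in> space M. X \<omega> \<in> A \<and> (Y \<omega>, Z \<omega>) \<in> C}"
      by (subst emeasure_distr) (auto simp: vimage_def Int_def conj_commute)
    ultimately show "emeasure (?S) A * emeasure (?T \<Otimes>\<^sub>M ?U) C
       = emeasure (distr M (S \<Otimes>\<^sub>M (T \<Otimes>\<^sub>M U)) (\<lambda>\<omega>. (X \<omega>, Y \<omega>, Z \<omega>))) (A \<times> C)"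
      unfolding a_def by simp
  qed
qed

section \<open>Uniqueness of conditional distributions\<close>

text \<open>Finite intersections of a countable basis are again countably many, and
  \<open>UNIV\<close> is the empty intersection. Countability lets a single null set serve all sets
  of the generator.\<close>

lemma borel_countable_generator:
  obtains \<E> :: "'a::second_countable_topology set set"
  where "countable \<E>" "Int_stable \<E>" "UNIV \<in> \<E>" "sets borel = sigma_sets UNIV \<E>"
proof -
  obtain B :: "'a set set" where B: "countable B" "topological_basis B"
    using ex_countable_basis by blast
  define \<E> where "\<E> = Inter ` {F. finite F \<and> F \<subseteq> B}"
  show ?thesis
  proof
    show "countable \<E>" unfolding \<E>_def using countable_Collect_finite_subset[OF B(1)] by (rule countable_image)
    show "Int_stable \<E>" unfolding Int_stable_def \<E>_def
    proof safe
      fix F F' assume "finite F" "F \<subseteq> B" "finite F'" "F' \<subseteq> B"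
      then show "\<Inter> F \<inter> \<Inter> F' \<in> Inter ` {F. finite F \<and> F \<subseteq> B}"
        by (intro image_eqI[of _ _ "F \<union> F'"]) auto
    qed
    show "UNIV \<in> \<E>" unfolding \<E>_def by (intro image_eqI[of _ _ "{}"]) auto
    show "sets borel = sigma_sets UNIV \<E>"
    proof (rule antisym)
      have "B \<subseteq> \<E>" unfolding \<E>_def by (auto intro!: image_eqI[of _ _ "{_}"])
      then show "sets borel \<subseteq> sigma_sets UNIV \<E>"
        unfolding borel_eq_countable_basis[OF B] by (simp add: sigma_sets_mono')
      have "E \<in> sets borel" if "E \<in> \<E>" for E
      proof -
        obtain F where F: "finite F" "F \<subseteq> B" "E = \<Inter> F" using \<open>E \<in> \<E>\<close> by (auto simp: \<E>_def)
        then have "open E" using topological_basis_open[OF B(2)] by (auto intro!: open_Inter)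
        then show ?thesis by simp
      qed
      then show "sigma_sets UNIV \<E> \<subseteq> sets borel"
        using sets.sigma_sets_subset[of \<E> borel] by auto
    qed
  qed
qed

text \<open>On each set of a countable generator the two kernels have equal integrals over all
  events of \<open>Z\<close>, hence agree almost surely; outside one null set they agree on the
  whole intersection-stable generator. The given kernel may thus be replaced by an explicit
  one.\<close>

lemma regular_cond_distr_unique:
  fixes K K' :: "'z \<Rightarrow> 'y::second_countable_topology measure"
  assumes "prob_space M" and Z[measurable]: "Z \<in> measurable M S"
    and K: "regular_cond_distr M S Z borel Y K" and K': "regular_cond_distr M S Z borel Y K'"
  shows "AE \<omega> in M. K (Z \<omega>) = K' (Z \<omega>)"
proof -
  interpret prob_space M by fact
  interpret D: prob_space "distr M S Z" by (rule prob_space_distr) measurable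
  obtain \<E> :: "'y set set" where E: "countable \<E>" "Int_stable \<E>" "UNIV \<in> \<E>" "sets borel = sigma_sets UNIV \<E>"
    by (rule borel_countable_generator)
  have [measurable]: "K \<in> measurable S (prob_algebra borel)" "K' \<in> measurable S (prob_algebra borel)"
    using K K' by (auto simp: regular_cond_distr_def)
  have Eb: "B \<in> sets borel" if "B \<in> \<E>" for B using that unfolding E(4) by auto
  have Km[measurable]: "(\<lambda>z. emeasure (K z) B) \<in> borel_measurable S" "(\<lambda>z. emeasure (K' z) B) \<in> borel_measurable S" if [measurable]: "B \<in> sets borel" for B
    using measurable_prob_algebraD[of K S borel] measurable_prob_algebraD[of K' S borel]
    by (auto intro!: measurable_compose[OF _ measurable_emeasure_subprob_algebra])
  have "AE z in distr M S Z. emeasure (K z) B = emeasure (K' z) B" if "B \<in> \<E>" for B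
  proof (rule D.density_unique2)
    have B: "B \<in> sets borel" by (rule Eb[OF that])
    show "(\<lambda>z. emeasure (K z) B) \<in> borel_measurable (distr M S Z)" "(\<lambda>z. emeasure (K' z) B) \<in> borel_measurable (distr M S Z)"
      using B by auto
    fix A assume "A \<in> sets (distr M S Z)"
    then have A[measurable]: "A \<in> sets S" by simp
    have "emeasure M {\<omega> \<in> space M. Z \<omega> \<in> A \<and> Y \<omega> \<in> B} = (\<integral>\<^sup>+\<omega>. emeasure (K (Z \<omega>)) B * indicator A (Z \<omega>) \<partial>M)"
      using K A B by (simp add: regular_cond_distr_def)
    moreover have "emeasure M {\<omega> \<in> space M. Z \<omega> \<in> A \<and> Y \<omega> \<in> B} = (\<integral>\<^sup>+\<omega>. emeasure (K' (Z \<omega>)) B * indicator A (Z \<omega>) \<partial>M)"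
      using K' A B by (simp add: regular_cond_distr_def)
    ultimately have "(\<integral>\<^sup>+\<omega>. emeasure (K (Z \<omega>)) B * indicator A (Z \<omega>) \<partial>M) = (\<integral>\<^sup>+\<omega>. emeasure (K' (Z \<omega>)) B * indicator A (Z \<omega>) \<partial>M)"
      by simp
    then show "(\<integral>\<^sup>+z\<in>A. emeasure (K z) B \<partial>distr M S Z) = (\<integral>\<^sup>+z\<in>A. emeasure (K' z) B \<partial>distr M S Z)"
      using B by (subst (1 2) nn_integral_distr) auto
  qed
  then have "AE z in distr M S Z. \<forall>B\<in>\<E>. emeasure (K z) B = emeasure (K' z) B"
    using E(1) by (simp add: AE_ball_countable)
  then have "AE \<omega> in M. \<forall>B\<in>\<E>. emeasure (K (Z \<omega>)) B = emeasure (K' (Z \<omega>)) B"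
    by (rule AE_distrD[OF Z])
  moreover have "AE \<omega> in M. \<omega> \<in> space M" by (rule AE_space)
  ultimately show ?thesis
  proof (eventually_elim, goal_cases)
    case (1 \<omega>)
    then have "Z \<omega> \<in> space S" using Z by (auto intro: measurable_space)
    then have "K (Z \<omega>) \<in> space (prob_algebra borel)" "K' (Z \<omega>) \<in> space (prob_algebra borel)"
      by (auto intro: measurable_space)
    then have KK: "prob_space (K (Z \<omega>))" "sets (K (Z \<omega>)) = sets borel" "sets (K' (Z \<omega>)) = sets borel"
      by (auto simp: space_prob_algebra)
    interpret KZ: prob_space "K (Z \<omega>)" by (rule KK)
    show ?case
    proof (rule measure_eqI_generator_eq[where E=\<E> and \<Omega>=UNIV and A="\<lambda>_. UNIV"])
      show "emeasure (K (Z \<omega>)) UNIV \<noteq> \<infinity>" by simp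
    qed (use 1 E KK in auto)
  qed
qed

section \<open>The kernel of the Gaussian channel\<close>

lemma borel_measurable_matrix_vector_mult [measurable (raw)]:
  fixes A :: "'b \<Rightarrow> real ^ 'n ^ 'k" and x :: "'b \<Rightarrow> real ^ 'n"
  assumes "A \<in> borel_measurable M" "x \<in> borel_measurable M"
  shows "(\<lambda>\<omega>. A \<omega> *v x \<omega>) \<in> borel_measurable M"
proof (rule borel_measurable_continuous_Pair[OF assms])
  show "continuous_on UNIV (\<lambda>p. fst p *v snd p :: real ^ 'k)"
    unfolding matrix_vector_mult_def by (intro continuous_on_vec_lambda continuous_intros)
qed

lemma nn_integral_gauss_affine:
  fixes m :: "real ^ 'k" and h :: "real ^ 'k \<Rightarrow> ennreal"
  assumes [measurable]: "h \<in> borel_measurable borel" and t: "0 < t"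
  shows "(\<integral>\<^sup>+z. ennreal (gauss 1 z) * h (m + sqrt t *\<^sub>R z) \<partial>lborel) = (\<integral>\<^sup>+y. ennreal (gauss t (y - m)) * h y \<partial>lborel)"
proof -
  have c: "sqrt t \<noteq> 0" using t by simp
  have g: "sqrt t ^ CARD('k) * gauss t (sqrt t *\<^sub>R z) = gauss 1 z" for z :: "real ^ 'k"
  proof -
    have "sqrt ((2 * pi * t) ^ CARD('k)) = sqrt ((2 * pi) ^ CARD('k)) * sqrt t ^ CARD('k)"
      by (simp add: power_mult_distrib real_sqrt_mult real_sqrt_power)
    moreover have "(sqrt t *\<^sub>R z) \<bullet> (sqrt t *\<^sub>R z) = t * (z \<bullet> z)" using t by (simp add: mult.assoc[symmetric])
    ultimately show ?thesis using t by (simp add: gauss_def del: inner_scaleR_left inner_scaleR_right)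
  qed
  have "(\<integral>\<^sup>+y. ennreal (gauss t (y - m)) * h y \<partial>lborel)
     = (\<integral>\<^sup>+y. ennreal (gauss t (y - m)) * h y \<partial>density (distr lborel borel (\<lambda>x. m + sqrt t *\<^sub>R x)) (\<lambda>_. ennreal (\<bar>sqrt t\<bar> ^ DIM(real ^ 'k))))"
    by (subst lborel_affine[OF c, of m]) (rule refl)
  also have "\<dots> = (\<integral>\<^sup>+z. ennreal (sqrt t ^ CARD('k)) * (ennreal (gauss t (sqrt t *\<^sub>R z)) * h (m + sqrt t *\<^sub>R z)) \<partial>lborel)"
    using t by (simp add: nn_integral_density nn_integral_distr)
  also have "\<dots> = (\<integral>\<^sup>+z. ennreal (gauss 1 z) * h (m + sqrt t *\<^sub>R z) \<partial>lborel)"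
    unfolding g[symmetric] using t by (simp add: ennreal_mult' mult.assoc)
  finally show ?thesis by simp
qed

text \<open>The peak value of the Gaussian dominates uniformly in the centre; the last bound later
  makes first and second moments over the matrix finite.\<close>

lemma (in prob_space) gaussian_mixture_integrable:
  fixes x :: "'a \<Rightarrow> real ^ 'k"
  assumes [measurable]: "x \<in> borel_measurable M" "A \<in> sets M" and t: "0 < t"
  shows "integrable M (\<lambda>\<omega>. indicator A \<omega> * gauss t (y - x \<omega>))"
    and "ennreal (\<integral>\<omega>. indicator A \<omega> * gauss t (y - x \<omega>) \<partial>M) = (\<integral>\<^sup>+\<omega>. indicator A \<omega> * ennreal (gauss t (y - x \<omega>)) \<partial>M)"
    and "0 \<le> (\<integral>\<omega>. indicator A \<omega> * gauss t (y - x \<omega>) \<partial>M)"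
    and "(\<integral>\<omega>. indicator A \<omega> * gauss t (y - x \<omega>) \<partial>M) \<le> 1 / sqrt ((2 * pi * t) ^ CARD('k))"
proof -
  let ?h = "\<lambda>\<omega>. indicator A \<omega> * gauss t (y - x \<omega>)"
  have h: "0 \<le> ?h \<omega>" "?h \<omega> \<le> 1 / sqrt ((2 * pi * t) ^ CARD('k))" for \<omega>
    using gauss_le[OF t, of "y - x \<omega>"] gauss_nonneg[OF t, of "y - x \<omega>"] t by (auto split: split_indicator)
  show i: "integrable M ?h"
    by (rule integrable_const_bound[where B="1 / sqrt ((2 * pi * t) ^ CARD('k))"]) (use h in auto)
  have "(\<integral>\<^sup>+\<omega>. ennreal (?h \<omega>) \<partial>M) = ennreal (\<integral>\<omega>. ?h \<omega> \<partial>M)"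
    using i h by (intro nn_integral_eq_integral) auto
  moreover have "ennreal (?h \<omega>) = indicator A \<omega> * ennreal (gauss t (y - x \<omega>))" for \<omega>
    by (auto split: split_indicator)
  ultimately show "ennreal (\<integral>\<omega>. ?h \<omega> \<partial>M) = (\<integral>\<^sup>+\<omega>. indicator A \<omega> * ennreal (gauss t (y - x \<omega>)) \<partial>M)" by simp
  show "0 \<le> (\<integral>\<omega>. ?h \<omega> \<partial>M)" using h by simp
  show "(\<integral>\<omega>. ?h \<omega> \<partial>M) \<le> 1 / sqrt ((2 * pi * t) ^ CARD('k))"
    using i h by (intro integral_le_const) auto
qed

text \<open>Given the matrix \<theta> and the signal \<open>x\<close>, the output is Gaussian about
  \<open>\<theta> *v x\<close>. Independence turns the joint law into iterated integrals, and
  integrating out \<open>x\<close> gives the mixture density.\<close>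

lemma gaussian_channel_cond_distr:
  fixes X :: "'a \<Rightarrow> real ^ 'n" and \<Theta> :: "'a \<Rightarrow> real ^ 'n ^ 'k" and N :: "'a \<Rightarrow> real ^ 'k"
  assumes M: "prob_space M" and ind: "indep_triple M borel X borel \<Theta> borel N"
    and N: "distr M borel N = mv_normal 0 (mat 1)" and t: "0 < t"
  shows "regular_cond_distr M borel \<Theta> borel (\<lambda>\<omega>. \<Theta> \<omega> *v X \<omega> + sqrt t *\<^sub>R N \<omega>)
    (\<lambda>\<theta> :: real ^ 'n ^ 'k. density lborel (\<lambda>y. \<integral>\<^sup>+\<omega>. ennreal (gauss t (y - \<theta> *v X \<omega>)) \<partial>M))"
proof -
  interpret prob_space M by fact
  have X[measurable]: "X \<in> borel_measurable M" and \<Theta>[measurable]: "\<Theta> \<in> borel_measurable M" and Nm[measurable]: "N \<in> borel_measurable M"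
    using ind by (auto simp: indep_triple_def)
  define f where "f = (\<lambda>(\<theta> :: real ^ 'n ^ 'k) y. \<integral>\<^sup>+\<omega>. ennreal (gauss t (y - \<theta> *v X \<omega>)) \<partial>M)"
  have fm [measurable]: "(\<lambda>p. f (fst p) (snd p)) \<in> borel_measurable (borel \<Otimes>\<^sub>M borel)"
    unfolding f_def by measurable
  have [measurable]: "f \<theta> \<in> borel_measurable borel" for \<theta> unfolding f_def by measurable
  let ?J = "\<lambda>\<theta> x B. \<integral>\<^sup>+y. ennreal (gauss t (y - \<theta> *v x)) * indicator B y \<partial>lborel"
  let ?Y = "\<lambda>\<omega>. \<Theta> \<omega> *v X \<omega> + sqrt t *\<^sub>R N \<omega>"
  define K where "K = (\<lambda>\<theta>. density lborel (f \<theta>))"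
  have Ke: "emeasure (K \<theta>) B = (\<integral>\<^sup>+y. f \<theta> y * indicator B y \<partial>lborel)" if "B \<in> sets borel" for \<theta> B
    unfolding K_def using that by (subst emeasure_density) auto
  interpret lb: pair_sigma_finite M "lborel :: (real ^ 'k) measure"
    by (intro pair_sigma_finite.intro sigma_finite_measure_axioms lborel.sigma_finite_measure_axioms)
  have fub: "(\<integral>\<^sup>+y. f \<theta> y * indicator B y \<partial>lborel) = (\<integral>\<^sup>+\<omega>. ?J \<theta> (X \<omega>) B \<partial>M)"
    if [measurable]: "B \<in> sets borel" for \<theta> B
  proof -
    have "(\<integral>\<^sup>+y. f \<theta> y * indicator B y \<partial>lborel) = (\<integral>\<^sup>+y. (\<integral>\<^sup>+\<omega>. ennreal (gauss t (y - \<theta> *v X \<omega>)) * indicator B y \<partial>M) \<partial>lborel)"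
      unfolding f_def by (intro nn_integral_cong nn_integral_multc[symmetric]) measurable
    also have "\<dots> = (\<integral>\<^sup>+\<omega>. ?J \<theta> (X \<omega>) B \<partial>M)"
      by (rule lb.Fubini') measurable
    finally show ?thesis .
  qed
  have Kp: "prob_space (K \<theta>)" for \<theta>
  proof
    have one: "(\<integral>\<^sup>+y. ennreal (gauss t (y - \<theta> *v X \<omega>)) \<partial>lborel) = 1" for \<omega>
      using gauss_integral[OF t, of "\<theta> *v X \<omega>"] gauss_nonneg[OF t]
      by (subst nn_integral_eq_integral) (auto simp: has_bochner_integral_iff)
    have "emeasure (K \<theta>) UNIV = (\<integral>\<^sup>+\<omega>. (\<integral>\<^sup>+y. ennreal (gauss t (y - \<theta> *v X \<omega>)) \<partial>lborel) \<partial>M)"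
      using Ke[of UNIV \<theta>] fub[of UNIV \<theta>] by simp
    also have "\<dots> = 1" unfolding one by (simp add: emeasure_space_1)
    finally show "emeasure (K \<theta>) (space (K \<theta>)) = 1" by (simp add: K_def)
  qed
  have Km: "K \<in> measurable borel (prob_algebra borel)"
  proof (rule measurable_prob_algebraI[OF Kp])
    show "K \<in> measurable borel (subprob_algebra borel)"
    proof (rule measurable_subprob_algebra)
      show "subprob_space (K \<theta>)" for \<theta> by (rule prob_space_imp_subprob_space[OF Kp])
      show "sets (K \<theta>) = sets borel" for \<theta> by (simp add: K_def)
      show "(\<lambda>\<theta>. emeasure (K \<theta>) B) \<in> borel_measurable borel" if [measurable]: "B \<in> sets borel" for B
        using that by (simp add: Ke) measurable
    qed
  qed
  let ?\<mu> = "distr M borel X" and ?\<nu> = "distr M borel \<Theta>" and ?\<eta> = "distr M borel N"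
  interpret \<mu>: prob_space ?\<mu> by (rule prob_space_distr) measurable
  interpret \<nu>: prob_space ?\<nu> by (rule prob_space_distr) measurable
  interpret \<eta>: prob_space ?\<eta> by (rule prob_space_distr) measurable
  interpret \<nu>\<eta>: pair_prob_space ?\<nu> ?\<eta> ..
  interpret \<mu>\<nu>: pair_prob_space ?\<nu> ?\<mu> ..
  have joint: "emeasure M {\<omega> \<in> space M. \<Theta> \<omega> \<in> A \<and> ?Y \<omega> \<in> B}
      = (\<integral>\<^sup>+\<omega>. emeasure (K (\<Theta> \<omega>)) B * indicator A (\<Theta> \<omega>) \<partial>M)"
    if A[measurable]: "A \<in> sets borel" and B[measurable]: "B \<in> sets borel" for A B
  proof -
    define h where "h = (\<lambda>p :: (real ^ 'n) \<times> (real ^ 'n ^ 'k) \<times> (real ^ 'k).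
      indicator A (fst (snd p)) * indicator B (fst (snd p) *v fst p + sqrt t *\<^sub>R snd (snd p)) :: ennreal)"
    have [measurable]: "h \<in> borel_measurable (borel \<Otimes>\<^sub>M (borel \<Otimes>\<^sub>M borel))" unfolding h_def by measurable
    have "emeasure M {\<omega> \<in> space M. \<Theta> \<omega> \<in> A \<and> ?Y \<omega> \<in> B}
      = (\<integral>\<^sup>+\<omega>. indicator {\<omega> \<in> space M. \<Theta> \<omega> \<in> A \<and> ?Y \<omega> \<in> B} \<omega> \<partial>M)"
      by (rule nn_integral_indicator[symmetric]) measurable
    also have "\<dots> = (\<integral>\<^sup>+\<omega>. h (X \<omega>, \<Theta> \<omega>, N \<omega>) \<partial>M)"
      by (intro nn_integral_cong) (auto simp: h_def split: split_indicator)
    also have "\<dots> = (\<integral>\<^sup>+p. h p \<partial>distr M (borel \<Otimes>\<^sub>M (borel \<Otimes>\<^sub>M borel)) (\<lambda>\<omega>. (X \<omega>, \<Theta> \<omega>, N \<omega>)))"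
      by (rule nn_integral_distr[symmetric]) measurable
    also have "\<dots> = (\<integral>\<^sup>+p. h p \<partial>(?\<mu> \<Otimes>\<^sub>M (?\<nu> \<Otimes>\<^sub>M ?\<eta>)))"
      unfolding distr_indep_triple[OF M ind] ..
    also have "\<dots> = (\<integral>\<^sup>+x. (\<integral>\<^sup>+q. h (x, q) \<partial>(?\<nu> \<Otimes>\<^sub>M ?\<eta>)) \<partial>?\<mu>)"
      by (rule \<nu>\<eta>.P.nn_integral_fst[symmetric]) measurable
    also have "\<dots> = (\<integral>\<^sup>+x. (\<integral>\<^sup>+\<theta>. (\<integral>\<^sup>+z. h (x, \<theta>, z) \<partial>?\<eta>) \<partial>?\<nu>) \<partial>?\<mu>)"
      by (intro nn_integral_cong \<eta>.nn_integral_fst[symmetric]) measurable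
    also have "\<dots> = (\<integral>\<^sup>+\<theta>. (\<integral>\<^sup>+x. (\<integral>\<^sup>+z. h (x, \<theta>, z) \<partial>?\<eta>) \<partial>?\<mu>) \<partial>?\<nu>)"
      by (rule \<mu>\<nu>.Fubini') measurable
    also have "\<dots> = (\<integral>\<^sup>+\<theta>. emeasure (K \<theta>) B * indicator A \<theta> \<partial>?\<nu>)"
    proof (intro nn_integral_cong)
      fix \<theta> :: "real ^ 'n ^ 'k"
      have "(\<integral>\<^sup>+z. h (x, \<theta>, z) \<partial>?\<eta>) = ?J \<theta> x B * indicator A \<theta>" for x
      proof -
        have "(\<integral>\<^sup>+z. h (x, \<theta>, z) \<partial>?\<eta>) = (\<integral>\<^sup>+z. ennreal (gauss 1 z) * h (x, \<theta>, z) \<partial>lborel)"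
          unfolding N mv_normal_mat[OF zero_less_one] by (rule nn_integral_density) measurable
        also have "\<dots> = (\<integral>\<^sup>+z. (ennreal (gauss 1 z) * indicator B (\<theta> *v x + sqrt t *\<^sub>R z)) * indicator A \<theta> \<partial>lborel)"
          by (simp add: h_def mult_ac)
        also have "\<dots> = (\<integral>\<^sup>+z. ennreal (gauss 1 z) * indicator B (\<theta> *v x + sqrt t *\<^sub>R z) \<partial>lborel) * indicator A \<theta>"
          by (rule nn_integral_multc) measurable
        also have "(\<integral>\<^sup>+z. ennreal (gauss 1 z) * indicator B (\<theta> *v x + sqrt t *\<^sub>R z) \<partial>lborel) = ?J \<theta> x B"
          by (rule nn_integral_gauss_affine[OF _ t]) measurable
        finally show ?thesis .
      qed
      then have "(\<integral>\<^sup>+x. (\<integral>\<^sup>+z. h (x, \<theta>, z) \<partial>?\<eta>) \<partial>?\<mu>)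
         = (\<integral>\<^sup>+x. ?J \<theta> x B * indicator A \<theta> \<partial>?\<mu>)" by simp
      also have "\<dots> = (\<integral>\<^sup>+x. ?J \<theta> x B \<partial>?\<mu>) * indicator A \<theta>"
        by (rule nn_integral_multc) measurable
      also have "(\<integral>\<^sup>+x. ?J \<theta> x B \<partial>?\<mu>) = emeasure (K \<theta>) B"
        unfolding Ke[OF B] fub[OF B] by (rule nn_integral_distr) measurable
      finally show "(\<integral>\<^sup>+x. (\<integral>\<^sup>+z. h (x, \<theta>, z) \<partial>?\<eta>) \<partial>?\<mu>) = emeasure (K \<theta>) B * indicator A \<theta>" .
    qed
    also have "\<dots> = (\<integral>\<^sup>+\<omega>. emeasure (K (\<Theta> \<omega>)) B * indicator A (\<Theta> \<omega>) \<partial>M)"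
      unfolding Ke[OF B] by (rule nn_integral_distr) measurable
    finally show ?thesis .
  qed
  have "regular_cond_distr M borel \<Theta> borel (\<lambda>\<omega>. \<Theta> \<omega> *v X \<omega> + sqrt t *\<^sub>R N \<omega>) K"
    unfolding regular_cond_distr_def by (intro conjI ballI Km joint)
  then show ?thesis unfolding K_def f_def .
qed

section \<open>Convexity and variance bounds\<close>

text \<open>Covers reference weights that vanish, as they do when the truncation event or its
  complement is null.\<close>

lemma ell_add_le':
  assumes "0 \<le> a" "0 \<le> a'" "0 \<le> b" "0 \<le> b'" "b = 0 \<longrightarrow> a = 0" "b' = 0 \<longrightarrow> a' = 0"
  shows "ell (a + a') (b + b') \<le> ell a b + ell a' b'"
proof (cases "b = 0 \<or> b' = 0")
  case True
  then show ?thesis using assms by (auto simp: ell_def)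
next
  case False
  then show ?thesis using assms ell_add_le[of a a' b b'] by simp
qed

text \<open>The tangent plane at the integrated values is integrated over \<open>A\<close>. By
  homogeneity the unnormalized average is compared with \<open>prob A * b\<close>, so no passage to
  a conditional measure is made.\<close>

lemma (in prob_space) ell_Jensen:
  assumes [measurable]: "A \<in> sets M" and \<phi>: "\<And>\<omega>. 0 \<le> \<phi> \<omega>" and int: "integrable M (\<lambda>\<omega>. indicator A \<omega> * \<phi> \<omega>)"
    and m[measurable]: "\<phi> \<in> borel_measurable M" and b: "0 < b"
  shows "ennreal (ell (\<integral>\<omega>. indicator A \<omega> * \<phi> \<omega> \<partial>M) (prob A * b)) \<le> (\<integral>\<^sup>+\<omega>. indicator A \<omega> * ennreal (ell (\<phi> \<omega>) b) \<partial>M)"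
proof -
  define a where "a = (\<integral>\<omega>. indicator A \<omega> * \<phi> \<omega> \<partial>M)"
  have a0: "0 \<le> a" using \<phi> by (simp add: a_def)
  have l0: "0 \<le> ell (\<phi> \<omega>) b" for \<omega> by (rule ell_nonneg[OF \<phi> b])
  have iA: "integrable M (indicator A :: 'a \<Rightarrow> real)" by (rule integrable_const_bound[where B=1]) auto
  \<comment> \<open>The tangent may be negative although \<open>ell\<close> is not; its positive
    part links the real integral with the nonnegative one.\<close>
  have le: "(\<integral>\<^sup>+\<omega>. indicator A \<omega> * ennreal (ell (\<phi> \<omega>) b) \<partial>M) \<ge> ennreal (\<integral>\<omega>. indicator A \<omega> * (\<phi> \<omega> * c + d) \<partial>M)"
    if t: "\<And>\<omega>. \<phi> \<omega> * c + d \<le> ell (\<phi> \<omega>) b \<or> (\<omega> \<in> A \<longrightarrow> False)" for c d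
  proof -
    have i: "integrable M (\<lambda>\<omega>. indicator A \<omega> * (\<phi> \<omega> * c + d))"
    proof -
      have "integrable M (\<lambda>\<omega>. (indicator A \<omega> * \<phi> \<omega>) * c + indicator A \<omega> * d)"
        using int iA by (intro Bochner_Integration.integrable_add integrable_mult_left) auto
      then show ?thesis by (simp add: algebra_simps)
    qed
    have "ennreal (\<integral>\<omega>. indicator A \<omega> * (\<phi> \<omega> * c + d) \<partial>M) \<le> ennreal (\<integral>\<omega>. max 0 (indicator A \<omega> * (\<phi> \<omega> * c + d)) \<partial>M)"
      using i by (intro ennreal_leI integral_mono integrable_max) auto
    also have "\<dots> = (\<integral>\<^sup>+\<omega>. ennreal (max 0 (indicator A \<omega> * (\<phi> \<omega> * c + d))) \<partial>M)"
      using i by (intro nn_integral_eq_integral[symmetric] integrable_max) auto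
    also have "\<dots> \<le> (\<integral>\<^sup>+\<omega>. indicator A \<omega> * ennreal (ell (\<phi> \<omega>) b) \<partial>M)"
      using t l0 by (intro nn_integral_mono) (auto split: split_indicator intro!: ennreal_leI)
    finally show ?thesis .
  qed
  show ?thesis
  proof (cases "a = 0 \<or> prob A = 0")
    case True
    \<comment> \<open>The tangent plane degenerates here: \<phi> vanishes almost everywhere on
      \<open>A\<close>, and both sides equal \<open>prob A * b\<close>.\<close>
    have "a = 0"
    proof (cases "a = 0")
      case False
      then have "AE \<omega> in M. \<omega> \<notin> A" using True by (simp add: prob_eq_0)
      then have "a = (\<integral>\<omega>. 0 \<partial>M)" unfolding a_def by (intro integral_cong_AE) auto
      then show ?thesis by simp
    qed
    then have "AE \<omega> in M. indicator A \<omega> * \<phi> \<omega> = 0"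
      unfolding a_def using int \<phi> by (subst (asm) integral_nonneg_eq_0_iff_AE) auto
    then have "(\<integral>\<^sup>+\<omega>. indicator A \<omega> * ennreal (ell (\<phi> \<omega>) b) \<partial>M) = (\<integral>\<^sup>+\<omega>. ennreal b * indicator A \<omega> \<partial>M)"
      by (intro nn_integral_cong_AE) (auto split: split_indicator simp: ell_def)
    also have "\<dots> = ennreal (prob A * b)"
      using b by (simp add: nn_integral_cmult_indicator emeasure_eq_measure ennreal_mult' mult.commute)
    finally show ?thesis using \<open>a = 0\<close> by (simp add: a_def[symmetric] ell_def)
  next
    case False
    then have p: "0 < a" "0 < prob A" using a0 by (auto simp: less_le)
    let ?c = "ln (a / (prob A * b))" and ?d = "b * (1 - a / (prob A * b))"
    have "(\<integral>\<omega>. indicator A \<omega> * (\<phi> \<omega> * ?c + ?d) \<partial>M) = (\<integral>\<omega>. (indicator A \<omega> * \<phi> \<omega>) * ?c + indicator A \<omega> * ?d \<partial>M)"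
      by (simp add: algebra_simps)
    also have "\<dots> = a * ?c + prob A * ?d"
      unfolding a_def using int iA by (subst Bochner_Integration.integral_add) auto
    also have "\<dots> = ell a (prob A * b)" using p b by (simp add: ell_def field_simps)
    finally have "ennreal (ell a (prob A * b)) = ennreal (\<integral>\<omega>. indicator A \<omega> * (\<phi> \<omega> * ?c + ?d) \<partial>M)" by simp
    also have "\<dots> \<le> (\<integral>\<^sup>+\<omega>. indicator A \<omega> * ennreal (ell (\<phi> \<omega>) b) \<partial>M)"
      using p b \<phi> by (intro le disjI1 ell_tangent) auto
    finally show ?thesis unfolding a_def .
  qed
qed

lemma (in prob_space) nn_integral_ell_le_variance:
  assumes [measurable]: "F \<in> borel_measurable M" and F: "\<And>\<omega>. 0 \<le> F \<omega>" "\<And>\<omega>. F \<omega> \<le> c" and g: "0 < g"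
  shows "(\<integral>\<^sup>+\<omega>. ennreal (ell (F \<omega>) g) \<partial>M)
    \<le> ennreal (sqrt ((\<integral>\<omega>. (F \<omega>)\<^sup>2 \<partial>M) - (\<integral>\<omega>. F \<omega> \<partial>M)\<^sup>2)) + ennreal (ell (\<integral>\<omega>. F \<omega> \<partial>M) g)"
    and "(\<integral>\<omega>. F \<omega> \<partial>M)\<^sup>2 \<le> (\<integral>\<omega>. (F \<omega>)\<^sup>2 \<partial>M)"
proof -
  define m where "m = (\<integral>\<omega>. F \<omega> \<partial>M)"
  define q where "q = (\<integral>\<omega>. (F \<omega>)\<^sup>2 \<partial>M)"
  have i1: "integrable M F" by (rule integrable_const_bound[where B=c]) (use F in auto)
  have i2: "integrable M (\<lambda>\<omega>. (F \<omega>)\<^sup>2)"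
    by (rule integrable_const_bound[where B="c\<^sup>2"]) (use F in \<open>auto intro!: power_mono\<close>)
  have "0 \<le> (\<integral>\<omega>. (F \<omega> - m)\<^sup>2 \<partial>M)" by simp
  also have "\<dots> = (\<integral>\<omega>. (F \<omega>)\<^sup>2 - 2 * m * F \<omega> + m\<^sup>2 \<partial>M)" by (simp add: power2_diff algebra_simps)
  also have "\<dots> = q - 2 * m * m + m\<^sup>2" unfolding q_def m_def using i1 i2 by (simp add: prob_space)
  finally have qm: "m\<^sup>2 \<le> q" by (simp add: power2_eq_square)
  then show "(\<integral>\<omega>. F \<omega> \<partial>M)\<^sup>2 \<le> (\<integral>\<omega>. (F \<omega>)\<^sup>2 \<partial>M)" by (simp add: m_def q_def)
  have m0: "0 \<le> m" using F by (simp add: m_def)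
  show "(\<integral>\<^sup>+\<omega>. ennreal (ell (F \<omega>) g) \<partial>M)
    \<le> ennreal (sqrt ((\<integral>\<omega>. (F \<omega>)\<^sup>2 \<partial>M) - (\<integral>\<omega>. F \<omega> \<partial>M)\<^sup>2)) + ennreal (ell (\<integral>\<omega>. F \<omega> \<partial>M) g)"
  proof (cases "m = 0")
    case True
    then have "AE \<omega> in M. F \<omega> = 0"
      unfolding m_def using i1 F by (subst (asm) integral_nonneg_eq_0_iff_AE) auto
    then have "(\<integral>\<^sup>+\<omega>. ennreal (ell (F \<omega>) g) \<partial>M) = (\<integral>\<^sup>+\<omega>. ennreal g \<partial>M)"
      by (intro nn_integral_cong_AE) (auto simp: ell_def)
    also have "\<dots> = ennreal (ell m g)" using True by (simp add: emeasure_space_1 ell_def)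
    finally show ?thesis unfolding m_def[symmetric] by simp
  next
    case False
    then have mp: "0 < m" using m0 by simp
    define a where "a = q / m\<^sup>2"
    have a: "0 < a" using mp qm by (auto simp: a_def intro!: divide_pos_pos order_less_le_trans[OF _ qm])
    \<comment> \<open>\<open>ln z \<le> z - 1\<close> at \<open>z = F / (m a)\<close>; this choice of \<open>a\<close> makes the expectation exactly \<open>m ln a + ell m g\<close>\<close>
    let ?b = "\<lambda>\<omega>. (F \<omega>)\<^sup>2 * (1 / (m * a)) + F \<omega> * (ln a + ln (m / g) - 2) + g"
    have le: "ell (F \<omega>) g \<le> ?b \<omega>" for \<omega>
    proof (cases "F \<omega> = 0")
      case False
      then have fp: "0 < F \<omega>" using F(1)[of \<omega>] by simp
      define z where "z = F \<omega> / (m * a)"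
      have z: "0 < z" using fp mp a by (simp add: z_def)
      have "ln (F \<omega> / g) = ln z + ln a + ln (m / g)"
        using fp mp a g by (simp add: z_def ln_mult ln_div)
      also have "\<dots> \<le> z - 1 + ln a + ln (m / g)" using ln_le_minus_one[OF z] by simp
      finally have "F \<omega> * ln (F \<omega> / g) \<le> F \<omega> * (z - 1 + ln a + ln (m / g))" using fp by (intro mult_left_mono) auto
      then show ?thesis by (simp add: ell_def z_def algebra_simps power2_eq_square)
    qed (simp add: ell_def)
    have ib: "integrable M ?b" using i1 i2 by auto
    have b0: "0 \<le> ?b \<omega>" for \<omega> using le[of \<omega>] ell_nonneg[OF F(1)[of \<omega>] g] by linarith
    have "(\<integral>\<^sup>+\<omega>. ennreal (ell (F \<omega>) g) \<partial>M) \<le> (\<integral>\<^sup>+\<omega>. ennreal (?b \<omega>) \<partial>M)"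
      using le by (intro nn_integral_mono ennreal_leI)
    also have "\<dots> = ennreal (\<integral>\<omega>. ?b \<omega> \<partial>M)" using ib b0 by (intro nn_integral_eq_integral) auto
    also have "(\<integral>\<omega>. ?b \<omega> \<partial>M) = q * (1 / (m * a)) + m * (ln a + ln (m / g) - 2) + g"
      unfolding q_def m_def using i1 i2 by (simp add: prob_space)
    also have "q * (1 / (m * a)) = m"
    proof -
      have "q = a * m\<^sup>2" using mp by (simp add: a_def)
      then show ?thesis using mp a by (simp add: power2_eq_square)
    qed
    also have "m + m * (ln a + ln (m / g) - 2) + g = m * ln a + ell m g" by (simp add: ell_def algebra_simps)
    \<comment> \<open>\<open>a\<close> is 1 plus the variance over \<open>m\<^sup>2\<close>; the
      square root bound on the logarithm cancels the factor \<open>m\<close>.\<close>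
    also have "\<dots> \<le> sqrt (q - m\<^sup>2) + ell m g"
    proof -
      have "a = 1 + (q - m\<^sup>2) / m\<^sup>2" using mp by (simp add: a_def field_simps)
      then have "ln a \<le> sqrt ((q - m\<^sup>2) / m\<^sup>2)" using ln_one_plus_le_sqrt[of "(q - m\<^sup>2) / m\<^sup>2"] qm by simp
      also have "\<dots> = sqrt (q - m\<^sup>2) / m" using mp by (simp add: real_sqrt_divide)
      finally show ?thesis using mp by (simp add: field_simps)
    qed
    finally have "(\<integral>\<^sup>+\<omega>. ennreal (ell (F \<omega>) g) \<partial>M) \<le> ennreal (sqrt (q - m\<^sup>2) + ell m g)"
      by (auto intro: ennreal_leI order_trans)
    also have "\<dots> = ennreal (sqrt (q - m\<^sup>2)) + ennreal (ell m g)"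
      using qm ell_nonneg[OF m0 g] by (intro ennreal_plus) auto
    finally show ?thesis unfolding m_def q_def .
  qed
qed

lemma borel_measurable_ell [measurable (raw)]:
  assumes [measurable]: "f \<in> borel_measurable M" "g \<in> borel_measurable M"
  shows "(\<lambda>x. ell (f x) (g x)) \<in> borel_measurable M"
  unfolding ell_def by measurable

section \<open>Scalar bounds for Gaussian divergences\<close>

lemma ln_one_plus_ge:
  assumes "0 < (x::real)" shows "x / (1 + x) \<le> ln (1 + x)"
proof -
  have "ln (1 / (1 + x)) \<le> 1 / (1 + x) - 1" using assms by (intro ln_le_minus_one) auto
  moreover have "ln (1 / (1 + x)) = - ln (1 + x)" using assms by (simp add: ln_div)
  moreover have "1 - 1 / (1 + x) = x / (1 + x)" using assms by (simp add: field_simps)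
  ultimately show ?thesis by linarith
qed

text \<open>Concavity of \<open>ln\<close> on the segment from \<open>t\<close> to
  \<open>\<gamma> + t\<close>, which \<open>t + \<tau>\<close> divides at the fraction
  \<open>\<tau> / \<gamma>\<close>.\<close>

lemma ln_chord:
  assumes "0 < (t::real)" "0 < \<gamma>" "0 \<le> \<tau>" "\<tau> \<le> \<gamma>"
  shows "ln ((\<gamma> + t) / (t + \<tau>)) \<le> ln (1 + \<gamma> / t) * ((\<gamma> - \<tau>) / \<gamma>)"
proof -
  define l where "l = \<tau> / \<gamma>"
  have l: "0 \<le> l" "l \<le> 1" using assms by (auto simp: l_def)
  have e: "t + \<tau> = (1 - l) *\<^sub>R t + l *\<^sub>R (\<gamma> + t)" using assms by (simp add: l_def field_simps)
  have "(1 - l) * ln t + l * ln (\<gamma> + t) \<le> ln ((1 - l) *\<^sub>R t + l *\<^sub>R (\<gamma> + t))"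
    using assms l by (intro concave_onD[OF ln_concave]) auto
  then have "ln (\<gamma> + t) - ln (t + \<tau>) \<le> (1 - l) * (ln (\<gamma> + t) - ln t)"
    unfolding e[symmetric] by (simp add: algebra_simps)
  moreover have "ln (\<gamma> + t) - ln t = ln (1 + \<gamma> / t)"
  proof -
    have "1 + \<gamma> / t = (\<gamma> + t) / t" using assms by (simp add: field_simps)
    then show ?thesis using assms by (simp add: ln_div)
  qed
  moreover have "ln ((\<gamma> + t) / (t + \<tau>)) = ln (\<gamma> + t) - ln (t + \<tau>)" using assms by (simp add: ln_div)
  moreover have "1 - l = (\<gamma> - \<tau>) / \<gamma>" using assms by (simp add: l_def field_simps)
  ultimately show ?thesis by (simp add: mult.commute)
qed

text \<open>The first left side belongs to the truncated part, the second to its complement, each in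
  units of \<open>k / 2\<close>. They share one right side so that the integrals over the two events
  add up to one over the whole space. Far from \<gamma> the quotient
  \<open>\<bar>\<tau> - \<gamma>\<bar> / (\<epsilon> * \<gamma>)\<close> exceeds 1 / 2 and thereby
  absorbs the constant \<open>L\<close>.\<close>

lemma gaussian_divergence_bounds:
  fixes t \<gamma> \<epsilon> \<tau> :: real
  assumes pos: "0 < t" "0 < \<gamma>" "0 \<le> \<tau>" "0 < \<epsilon>" "\<epsilon> \<le> 1"
  defines "v \<equiv> \<gamma> + t" and "L \<equiv> ln (1 + \<gamma> / t)"
  shows "ln (v / (t + \<tau>)) + (t + \<tau>) / v - 1 \<le> 3 * L * (\<bar>\<tau> - \<gamma>\<bar> / (\<epsilon> * \<gamma>))"
    and "\<epsilon> * \<gamma> / 2 < \<bar>\<tau> - \<gamma>\<bar> \<Longrightarrow> L + (\<tau> - \<gamma>) / v \<le> 3 * L * (\<bar>\<tau> - \<gamma>\<bar> / (\<epsilon> * \<gamma>))"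
proof -
  have v: "0 < v" using pos by (simp add: v_def)
  \<comment> \<open>\<open>x / (1 + x) \<le> ln (1 + x)\<close> at \<open>x = \<gamma> / t\<close>
    lets linear deviations be measured in units of \<open>L\<close>.\<close>
  have L: "\<gamma> / v \<le> L" "0 < L"
  proof -
    have "\<gamma> / v = (\<gamma> / t) / (1 + \<gamma> / t)" using pos by (simp add: v_def field_simps)
    also have "\<dots> \<le> L" unfolding L_def using pos by (intro ln_one_plus_ge) simp
    finally show "\<gamma> / v \<le> L" .
    then show "0 < L" using pos v by (smt (verit) divide_pos_pos)
  qed
  define D where "D = L * (\<bar>\<tau> - \<gamma>\<bar> / \<gamma>)"
  have D0: "0 \<le> D" using L pos by (simp add: D_def)
  have Dle: "D \<le> L * (\<bar>\<tau> - \<gamma>\<bar> / (\<epsilon> * \<gamma>))"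
    unfolding D_def using L pos by (intro mult_left_mono divide_left_mono) auto
  have dv: "(\<tau> - \<gamma>) / v \<le> D"
  proof -
    have "(\<tau> - \<gamma>) / v \<le> \<bar>\<tau> - \<gamma>\<bar> / v" using v by (intro divide_right_mono) auto
    also have "\<dots> = (\<gamma> / v) * (\<bar>\<tau> - \<gamma>\<bar> / \<gamma>)" using pos by simp
    also have "\<dots> \<le> D" unfolding D_def using L pos by (intro mult_right_mono) auto
    finally show ?thesis .
  qed
  have e: "(t + \<tau>) / v - 1 = (\<tau> - \<gamma>) / v" using v by (simp add: v_def field_simps)
  have "ln (v / (t + \<tau>)) + (t + \<tau>) / v - 1 \<le> D"
  proof (cases "\<tau> \<le> \<gamma>")
    case True
    have "ln (v / (t + \<tau>)) \<le> D"
      using ln_chord[OF pos(1-3) True] True by (simp add: v_def L_def D_def)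
    moreover have "(\<tau> - \<gamma>) / v \<le> 0" using True v by (simp add: divide_nonpos_pos)
    ultimately show ?thesis using e by linarith
  next
    case False
    have "ln (v / (t + \<tau>)) \<le> 0" using False pos v by (subst ln_le_zero_iff) (auto simp: v_def)
    then show ?thesis using e dv by linarith
  qed
  then show "ln (v / (t + \<tau>)) + (t + \<tau>) / v - 1 \<le> 3 * L * (\<bar>\<tau> - \<gamma>\<bar> / (\<epsilon> * \<gamma>))" using D0 Dle by linarith
  assume far: "\<epsilon> * \<gamma> / 2 < \<bar>\<tau> - \<gamma>\<bar>"
  have "1 \<le> 2 * (\<bar>\<tau> - \<gamma>\<bar> / (\<epsilon> * \<gamma>))" using far pos by (simp add: field_simps)
  then have "L * 1 \<le> L * (2 * (\<bar>\<tau> - \<gamma>\<bar> / (\<epsilon> * \<gamma>)))" using L by (intro mult_left_mono) auto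
  then show "L + (\<tau> - \<gamma>) / v \<le> 3 * L * (\<bar>\<tau> - \<gamma>\<bar> / (\<epsilon> * \<gamma>))" using dv Dle by linarith
qed

lemma (in prob_space) nn_integral_power2:
  assumes [measurable]: "h \<in> borel_measurable M"
  shows "(\<integral>\<^sup>+\<omega>. h \<omega> \<partial>M)\<^sup>2 = (\<integral>\<^sup>+p. h (fst p) * h (snd p) \<partial>(M \<Otimes>\<^sub>M M))"
proof -
  interpret MM: pair_prob_space M M ..
  have "(\<integral>\<^sup>+p. h (fst p) * h (snd p) \<partial>(M \<Otimes>\<^sub>M M)) = (\<integral>\<^sup>+x. (\<integral>\<^sup>+y. h x * h y \<partial>M) \<partial>M)"
    by (subst nn_integral_fst[symmetric]) auto
  also have "\<dots> = (\<integral>\<^sup>+x. h x * (\<integral>\<^sup>+y. h y \<partial>M) \<partial>M)" by (simp add: nn_integral_cmult)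
  also have "\<dots> = (\<integral>\<^sup>+\<omega>. h \<omega> \<partial>M) * (\<integral>\<^sup>+y. h y \<partial>M)" by (rule nn_integral_multc) measurable
  finally show ?thesis by (simp add: power2_eq_square)
qed

section \<open>Averages over the random matrix\<close>

text \<open>In the double integrals below the matrix is evaluated at one point of \<open>M\<close>
  and the signal at a separate one, which realizes the product of their laws.\<close>

locale gaussian_projection = prob_space M for M :: "'a measure" +
  fixes \<Theta> :: "'a \<Rightarrow> real ^ 'n ^ 'k" and s :: real
  assumes measurable_\<Theta> [measurable]: "\<Theta> \<in> borel_measurable M"
    and indep_\<Theta>: "indep_vars (\<lambda>_. borel) (\<lambda>(i, j) \<omega>. \<Theta> \<omega> $ i $ j) (UNIV :: ('k \<times> 'n) set)"
    and distr_\<Theta>: "\<And>i j. distributed M lborel (\<lambda>\<omega>. \<Theta> \<omega> $ i $ j) (\<lambda>x. ennreal (normal_density 0 (sqrt s) x))"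
    and s: "0 < s"
begin

lemmas projection_second_moment = gaussian_projection_second_moment[OF measurable_\<Theta> indep_\<Theta> distr_\<Theta> s]
lemmas projection_mean = gaussian_projection_mean[OF measurable_\<Theta> indep_\<Theta> distr_\<Theta> s]

sublocale lb: pair_sigma_finite M "lborel :: (real ^ 'k) measure"
  by (intro pair_sigma_finite.intro sigma_finite_measure_axioms lborel.sigma_finite_measure_axioms)

sublocale MM: pair_prob_space M M ..

sublocale MMM: pair_sigma_finite M "M \<Otimes>\<^sub>M M"
  by (intro pair_sigma_finite.intro sigma_finite_measure_axioms MM.P.sigma_finite_measure_axioms)

text \<open>The second moment of a projection with unit noise is computed twice, averaging over the
  matrix first and integrating over \<open>y\<close> first; the noise contribution \<open>k\<close>
  cancels.\<close>

lemma nn_integral_norm_projection: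
  "(\<integral>\<^sup>+\<omega>. ennreal ((\<Theta> \<omega> *v x) \<bullet> (\<Theta> \<omega> *v x)) \<partial>M) = ennreal (CARD('k) * (s * (x \<bullet> x)))"
proof -
  let ?k = "real CARD('k)"
  let ?g = "\<lambda>\<omega> y. ennreal (gauss 1 (y - \<Theta> \<omega> *v x)) * ennreal (y \<bullet> y)"
  let ?T = "\<lambda>\<omega>. (\<Theta> \<omega> *v x) \<bullet> (\<Theta> \<omega> *v x)"
  have a: "0 < 1 + s * (x \<bullet> x)" using s by (simp add: add_pos_nonneg)
  have "(\<integral>\<^sup>+y. (\<integral>\<^sup>+\<omega>. ?g \<omega> y \<partial>M) \<partial>lborel)
      = (\<integral>\<^sup>+y. ennreal (gauss (1 + s * (x \<bullet> x)) y * (y \<bullet> y)) \<partial>(lborel :: (real ^ 'k) measure))"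
    by (intro nn_integral_cong) (simp add: nn_integral_multc projection_mean ennreal_mult'' )
  also have "\<dots> = ennreal (?k * (1 + s * (x \<bullet> x)))"
    using gauss_second_moment[OF a, of 0 "0 :: real ^ 'k"]
    by (subst nn_integral_eq_integral)
      (auto simp: has_bochner_integral_iff intro!: AE_I2 mult_nonneg_nonneg gauss_nonneg[OF a])
  finally have 1: "(\<integral>\<^sup>+y. (\<integral>\<^sup>+\<omega>. ?g \<omega> y \<partial>M) \<partial>lborel) = ennreal (?k * (1 + s * (x \<bullet> x)))" .
  have "(\<integral>\<^sup>+y. (\<integral>\<^sup>+\<omega>. ?g \<omega> y \<partial>M) \<partial>lborel)
      = (\<integral>\<^sup>+\<omega>. (\<integral>\<^sup>+y. ?g \<omega> y \<partial>lborel) \<partial>M)"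
    by (rule lb.Fubini') measurable
  also have "\<dots> = (\<integral>\<^sup>+\<omega>. ennreal ?k + ennreal (?T \<omega>) \<partial>M)"
  proof (intro nn_integral_cong)
    fix \<omega>
    have "(\<integral>\<^sup>+y. ?g \<omega> y \<partial>lborel) = (\<integral>\<^sup>+y. ennreal (gauss 1 (y - \<Theta> \<omega> *v x) * ((y - 0) \<bullet> (y - 0))) \<partial>lborel)"
      by (simp add: ennreal_mult'')
    also have "\<dots> = ennreal (?k * 1 + (\<Theta> \<omega> *v x - 0) \<bullet> (\<Theta> \<omega> *v x - 0))"
      using gauss_second_moment[OF zero_less_one, of "\<Theta> \<omega> *v x" 0]
      by (subst nn_integral_eq_integral)
        (auto simp: has_bochner_integral_iff intro!: AE_I2 mult_nonneg_nonneg gauss_nonneg[OF zero_less_one])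
    finally show "(\<integral>\<^sup>+y. ?g \<omega> y \<partial>lborel) = ennreal ?k + ennreal (?T \<omega>)"
      by (simp add: ennreal_plus)
  qed
  also have "\<dots> = ennreal ?k + (\<integral>\<^sup>+\<omega>. ennreal (?T \<omega>) \<partial>M)"
    by (subst nn_integral_add) (auto simp: emeasure_space_1)
  finally have "ennreal ?k + (\<integral>\<^sup>+\<omega>. ennreal (?T \<omega>) \<partial>M) = ennreal ?k + ennreal (?k * (s * (x \<bullet> x)))"
    unfolding 1 using s by (simp add: distrib_left ennreal_plus)
  then show ?thesis by (simp add: ennreal_add_left_cancel)
qed

text \<open>By convexity the mixture costs at most the average of its components. Each component is
  Gaussian about a projected signal, and its divergence is affine in a squared norm whose mean over
  the matrix is known.\<close>

lemma nn_integral_tail_divergence: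
  fixes X :: "'a \<Rightarrow> real ^ 'n"
  assumes X[measurable]: "X \<in> borel_measurable M" and A[measurable]: "A \<in> sets M" and t: "0 < t" and v: "0 < v"
  shows "(\<integral>\<^sup>+\<omega>'. (\<integral>\<^sup>+y. ennreal (ell (\<integral>\<omega>. indicator A \<omega> * gauss t (y - \<Theta> \<omega>' *v X \<omega>) \<partial>M) (prob A * gauss v y)) \<partial>lborel) \<partial>M)
    \<le> (\<integral>\<^sup>+\<omega>. indicator A \<omega> * ennreal (CARD('k) / 2 * (ln (v / t) + t / v - 1) + CARD('k) * (s * (X \<omega> \<bullet> X \<omega>)) / (2 * v)) \<partial>M)"
proof -
  let ?k = "real CARD('k)"
  let ?c = "?k / 2 * (ln (v / t) + t / v - 1)"
  let ?q = "\<lambda>\<omega> \<omega>'. indicator A \<omega> * (ennreal ?c + ennreal (1 / (2 * v)) * ennreal ((\<Theta> \<omega>' *v X \<omega>) \<bullet> (\<Theta> \<omega>' *v X \<omega>)))"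
  let ?e = "\<lambda>\<omega> \<omega>' y. ennreal (ell (gauss t (y - \<Theta> \<omega>' *v X \<omega>)) (gauss v y))"
  have c0: "0 \<le> ?c"
  proof -
    have "ln (t / v) \<le> t / v - 1" using t v by (intro ln_le_minus_one) simp
    moreover have "ln (v / t) = - ln (t / v)" using t v by (simp add: ln_div)
    ultimately show ?thesis by simp
  qed
  have "(\<integral>\<^sup>+\<omega>'. (\<integral>\<^sup>+y. ennreal (ell (\<integral>\<omega>. indicator A \<omega> * gauss t (y - \<Theta> \<omega>' *v X \<omega>) \<partial>M) (prob A * gauss v y)) \<partial>lborel) \<partial>M)
    \<le> (\<integral>\<^sup>+\<omega>'. (\<integral>\<^sup>+y. (\<integral>\<^sup>+\<omega>. indicator A \<omega> * ?e \<omega> \<omega>' y \<partial>M) \<partial>lborel) \<partial>M)"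
    using t v by (intro nn_integral_mono ell_Jensen gaussian_mixture_integrable gauss_nonneg gauss_pos) auto
  also have "\<dots> = (\<integral>\<^sup>+\<omega>'. (\<integral>\<^sup>+\<omega>. (\<integral>\<^sup>+y. indicator A \<omega> * ?e \<omega> \<omega>' y \<partial>lborel) \<partial>M) \<partial>M)"
    by (intro nn_integral_cong lb.Fubini') measurable
  also have "\<dots> = (\<integral>\<^sup>+\<omega>'. (\<integral>\<^sup>+\<omega>. ?q \<omega> \<omega>' \<partial>M) \<partial>M)"
  proof (intro nn_integral_cong)
    fix \<omega> \<omega>'
    let ?m = "\<Theta> \<omega>' *v X \<omega>"
    have "(\<integral>\<^sup>+y. indicator A \<omega> * ennreal (ell (gauss t (y - ?m)) (gauss v y)) \<partial>lborel)
       = indicator A \<omega> * (\<integral>\<^sup>+y. ennreal (ell (gauss t (y - ?m)) (gauss v y)) \<partial>lborel)"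
      by (rule nn_integral_cmult) measurable
    also have "(\<integral>\<^sup>+y. ennreal (ell (gauss t (y - ?m)) (gauss v y)) \<partial>lborel) = ennreal (?c + (?m \<bullet> ?m) / (2 * v))"
      by (rule nn_integral_ell_gauss[OF t v])
    also have "\<dots> = ennreal ?c + ennreal (1 / (2 * v) * (?m \<bullet> ?m))"
      using c0 v by (subst ennreal_plus) auto
    also have "ennreal (1 / (2 * v) * (?m \<bullet> ?m)) = ennreal (1 / (2 * v)) * ennreal (?m \<bullet> ?m)"
      using v by (intro ennreal_mult) auto
    finally show "(\<integral>\<^sup>+y. indicator A \<omega> * ennreal (ell (gauss t (y - ?m)) (gauss v y)) \<partial>lborel)
       = indicator A \<omega> * (ennreal ?c + ennreal (1 / (2 * v)) * ennreal (?m \<bullet> ?m))" .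
  qed
  also have "\<dots> = (\<integral>\<^sup>+\<omega>. (\<integral>\<^sup>+\<omega>'. ?q \<omega> \<omega>' \<partial>M) \<partial>M)"
    by (rule MM.Fubini') measurable
  also have "\<dots> = (\<integral>\<^sup>+\<omega>. indicator A \<omega> * ennreal (?c + ?k * (s * (X \<omega> \<bullet> X \<omega>)) / (2 * v)) \<partial>M)"
  proof (intro nn_integral_cong)
    fix \<omega>
    have "(\<integral>\<^sup>+\<omega>'. ?q \<omega> \<omega>' \<partial>M)
      = indicator A \<omega> * (ennreal ?c + ennreal (1 / (2 * v)) * ennreal (?k * (s * (X \<omega> \<bullet> X \<omega>))))"
      by (simp add: nn_integral_cmult nn_integral_add emeasure_space_1 nn_integral_norm_projection)
    also have "ennreal (1 / (2 * v)) * ennreal (?k * (s * (X \<omega> \<bullet> X \<omega>))) = ennreal (?k * (s * (X \<omega> \<bullet> X \<omega>)) / (2 * v))"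
      using v s by (subst ennreal_mult[symmetric]) auto
    also have "ennreal ?c + \<dots> = ennreal (?c + ?k * (s * (X \<omega> \<bullet> X \<omega>)) / (2 * v))"
      using c0 v s by (subst ennreal_plus) auto
    finally show "(\<integral>\<^sup>+\<omega>'. ?q \<omega> \<omega>' \<partial>M)
      = indicator A \<omega> * ennreal (?c + ?k * (s * (X \<omega> \<bullet> X \<omega>)) / (2 * v))" .
  qed
  finally show ?thesis .
qed

end

context gaussian_projection
begin

text \<open>Cauchy--Schwarz dominates the square by \<open>\<tau> (fst p) * \<tau> (snd p)\<close>,
  integrable as a product over independent copies; the first power is dominated by
  \<open>1 + x\<^sup>2\<close>.\<close>

lemma integrable_inner_pair:
  fixes X :: "'a \<Rightarrow> real ^ 'n"
  assumes X[measurable]: "X \<in> borel_measurable M" and int: "integrable M (\<lambda>\<omega>. X \<omega> \<bullet> X \<omega>)"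
  shows "integrable (M \<Otimes>\<^sub>M M) (\<lambda>p. (s * (X (fst p) \<bullet> X (snd p)))\<^sup>2)"
    and "integrable (M \<Otimes>\<^sub>M M) (\<lambda>p. \<bar>s * (X (fst p) \<bullet> X (snd p))\<bar>)"
proof -
  define \<tau> where "\<tau> = (\<lambda>\<omega>. s * (X \<omega> \<bullet> X \<omega>))"
  have [measurable]: "\<tau> \<in> borel_measurable M" unfolding \<tau>_def by measurable
  have \<tau>0: "0 \<le> \<tau> \<omega>" for \<omega> using s by (simp add: \<tau>_def)
  have i\<tau>: "integrable M \<tau>" unfolding \<tau>_def using int by simp
  have "(\<integral>\<^sup>+p. ennreal (\<tau> (fst p)) * ennreal (\<tau> (snd p)) \<partial>(M \<Otimes>\<^sub>M M)) = (\<integral>\<^sup>+\<omega>. ennreal (\<tau> \<omega>) \<partial>M)\<^sup>2"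
    by (rule nn_integral_power2[symmetric]) measurable
  also have "\<dots> < \<infinity>" using i\<tau> \<tau>0 by (subst nn_integral_eq_integral) (auto simp: ennreal_power)
  finally have "integrable (M \<Otimes>\<^sub>M M) (\<lambda>p. \<tau> (fst p) * \<tau> (snd p))"
    using \<tau>0 by (intro integrableI_nonneg) (auto simp: ennreal_mult)
  then show i2: "integrable (M \<Otimes>\<^sub>M M) (\<lambda>p. (s * (X (fst p) \<bullet> X (snd p)))\<^sup>2)"
  proof (rule Bochner_Integration.integrable_bound)
    have "(s * (x \<bullet> y))\<^sup>2 \<le> (s * (x \<bullet> x)) * (s * (y \<bullet> y))" for x y :: "real ^ 'n"
      using Cauchy_Schwarz_ineq[of x y] s by (simp add: power_mult_distrib power2_eq_square mult_left_mono mult_ac)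
    then show "AE p in M \<Otimes>\<^sub>M M. norm ((s * (X (fst p) \<bullet> X (snd p)))\<^sup>2) \<le> norm (\<tau> (fst p) * \<tau> (snd p))"
      using s by (intro AE_I2) (simp add: \<tau>_def abs_mult)
  qed measurable
  have "integrable (M \<Otimes>\<^sub>M M) (\<lambda>p. 1 + (s * (X (fst p) \<bullet> X (snd p)))\<^sup>2)" using i2 by simp
  then show "integrable (M \<Otimes>\<^sub>M M) (\<lambda>p. \<bar>s * (X (fst p) \<bullet> X (snd p))\<bar>)"
  proof (rule Bochner_Integration.integrable_bound)
    have "\<bar>x\<bar> \<le> 1 + x\<^sup>2" for x :: real
      using zero_le_power2[of "\<bar>x\<bar> - 1"] by (simp add: power2_diff)
    then show "AE p in M \<Otimes>\<^sub>M M. norm \<bar>s * (X (fst p) \<bullet> X (snd p))\<bar> \<le> norm (1 + (s * (X (fst p) \<bullet> X (snd p)))\<^sup>2)"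
      by (intro AE_I2) (simp add: order_trans[OF _ abs_ge_self])
  qed measurable
qed

text \<open>The matrix average \<open>m\<close> of the truncated density is a mixture of centred
  Gaussians of variance \<open>t + \<tau>\<close>. In radial form its square and the second moment
  \<open>q\<close> are both instances of \<open>W\<close>, which hands the variance to
  \<open>radial_fluctuation_bound\<close>; convexity bounds the divergence of \<open>m\<close> by
  that of its components.\<close>

lemma nn_integral_core_divergence:
  fixes X :: "'a \<Rightarrow> real ^ 'n" and \<gamma> t \<epsilon> v :: real
  assumes X[measurable]: "X \<in> borel_measurable M" and A[measurable]: "A \<in> sets M"
    and pos: "0 < \<gamma>" "0 < t" "0 < \<epsilon>" "\<epsilon> \<le> 1" and v: "0 < v"
    and int: "integrable M (\<lambda>\<omega>. X \<omega> \<bullet> X \<omega>)"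
    and A\<gamma>: "\<And>\<omega>. \<omega> \<in> A \<Longrightarrow> \<bar>s * (X \<omega> \<bullet> X \<omega>) - \<gamma>\<bar> \<le> \<epsilon> * \<gamma> / 2"
  shows "(\<integral>\<^sup>+\<omega>'. (\<integral>\<^sup>+y. ennreal (ell (\<integral>\<omega>. indicator A \<omega> * gauss t (y - \<Theta> \<omega>' *v X \<omega>) \<partial>M) (prob A * gauss v y)) \<partial>lborel) \<partial>M)
    \<le> ennreal (3 * CARD('k) powr (3 / 4) * ((\<integral>p. \<bar>s * (X (fst p) \<bullet> X (snd p))\<bar> \<partial>(M \<Otimes>\<^sub>M M)) / \<gamma>) powr (1 / 2)
        + 3 * CARD('k) powr (1 / 4) * (1 + (2 + \<epsilon>) * \<gamma> / t) powr (CARD('k) / 4)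
          * (sqrt (\<integral>p. (s * (X (fst p) \<bullet> X (snd p)))\<^sup>2 \<partial>(M \<Otimes>\<^sub>M M)) / \<gamma>))
      + (\<integral>\<^sup>+\<omega>. indicator A \<omega> * ennreal (CARD('k) / 2 * (ln (v / (t + s * (X \<omega> \<bullet> X \<omega>))) + (t + s * (X \<omega> \<bullet> X \<omega>)) / v - 1)) \<partial>M)"
proof -
  define \<tau> where "\<tau> = (\<lambda>\<omega>. s * (X \<omega> \<bullet> X \<omega>))"
  define \<rho> where "\<rho> = (\<lambda>p. s * (X (fst p) \<bullet> X (snd p)))"
  have [measurable]: "\<tau> \<in> borel_measurable M" "\<rho> \<in> borel_measurable (M \<Otimes>\<^sub>M M)" unfolding \<tau>_def \<rho>_def by measurable
  let ?h = "\<lambda>\<omega>' y \<omega>. indicator A \<omega> * ennreal (gauss t (y - \<Theta> \<omega>' *v X \<omega>))"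
  let ?m = "\<lambda>y \<omega>. indicator A \<omega> * ennreal (gauss (t + \<tau> \<omega>) y)"
  let ?j = "\<lambda>y :: real ^ 'k. \<lambda>\<omega>. indicator A \<omega> * ennreal (ell (gauss (t + \<tau> \<omega>) y) (gauss v y))"
  have \<tau>0: "0 \<le> \<tau> \<omega>" for \<omega> using s by (simp add: \<tau>_def)
  have t\<tau>: "0 < t + \<tau> \<omega>" for \<omega> using \<tau>0[of \<omega>] pos by linarith
  define f where "f = (\<lambda>\<omega>' y. \<integral>\<omega>. indicator A \<omega> * gauss t (y - \<Theta> \<omega>' *v X \<omega>) \<partial>M)"
  let ?e = "\<lambda>\<omega>' y. ennreal (ell (f \<omega>' y) (prob A * gauss v y))"
  note mix = gaussian_mixture_integrable[OF _ A pos(2)]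
  have f0: "0 \<le> f \<omega>' y" and fle: "f \<omega>' y \<le> 1 / sqrt ((2 * pi * t) ^ CARD('k))"
    and fe: "ennreal (f \<omega>' y) = (\<integral>\<^sup>+\<omega>. ?h \<omega>' y \<omega> \<partial>M)" for \<omega>' y
    unfolding f_def by (rule mix; measurable)+
  have fm[measurable]: "(\<lambda>p. f (fst p) (snd p)) \<in> borel_measurable (M \<Otimes>\<^sub>M borel)"
    unfolding f_def by measurable
  have [measurable]: "(\<lambda>\<omega>'. f \<omega>' y) \<in> borel_measurable M" for y unfolding f_def by measurable
  define m where "m = (\<lambda>y. \<integral>\<omega>'. f \<omega>' y \<partial>M)"
  define q where "q = (\<lambda>y. \<integral>\<omega>'. (f \<omega>' y)\<^sup>2 \<partial>M)"
  define W where "W = (\<lambda>c r. \<integral>\<^sup>+p. ennreal (pair_density CARD('k) (t + \<tau> (fst p)) (t + \<tau> (snd p)) (c p) r) * indicator (A \<times> A) p \<partial>(M \<Otimes>\<^sub>M M))"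
  have m_eq: "m y = (\<integral>\<omega>. indicator A \<omega> * gauss (t + \<tau> \<omega>) y \<partial>M)"
    and m_e: "ennreal (m y) = (\<integral>\<^sup>+\<omega>. ?m y \<omega> \<partial>M)"
    and int_m: "integrable M (\<lambda>\<omega>. indicator A \<omega> * gauss (t + \<tau> \<omega>) y)" for y
  proof -
    have gm[measurable]: "(\<lambda>\<omega>. gauss (t + \<tau> \<omega>) y) \<in> borel_measurable M" unfolding gauss_def by measurable
    have g0: "0 \<le> gauss (t + \<tau> \<omega>) y" for \<omega> by (rule gauss_nonneg[OF t\<tau>])
    have if1: "integrable M (\<lambda>\<omega>'. f \<omega>' y)"
      by (rule integrable_const_bound[where B="1 / sqrt ((2 * pi * t) ^ CARD('k))"]) (use f0 fle in auto)
    have "ennreal (m y) = (\<integral>\<^sup>+\<omega>'. ennreal (f \<omega>' y) \<partial>M)"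
      unfolding m_def using if1 f0 by (intro nn_integral_eq_integral[symmetric]) auto
    also have "\<dots> = (\<integral>\<^sup>+\<omega>'. (\<integral>\<^sup>+\<omega>. ?h \<omega>' y \<omega> \<partial>M) \<partial>M)"
      unfolding fe ..
    also have "\<dots> = (\<integral>\<^sup>+\<omega>. (\<integral>\<^sup>+\<omega>'. ?h \<omega>' y \<omega> \<partial>M) \<partial>M)"
      by (rule MM.Fubini') measurable
    also have "\<dots> = (\<integral>\<^sup>+\<omega>. ?m y \<omega> \<partial>M)"
      by (simp add: nn_integral_cmult projection_mean[OF pos(2)] \<tau>_def)
    finally show e: "ennreal (m y) = (\<integral>\<^sup>+\<omega>. ?m y \<omega> \<partial>M)" .
    also have "\<dots> = (\<integral>\<^sup>+\<omega>. ennreal (indicator A \<omega> * gauss (t + \<tau> \<omega>) y) \<partial>M)"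
      by (intro nn_integral_cong) (auto split: split_indicator)
    finally have e': "(\<integral>\<^sup>+\<omega>. ennreal (indicator A \<omega> * gauss (t + \<tau> \<omega>) y) \<partial>M) = ennreal (m y)" ..
    then show "integrable M (\<lambda>\<omega>. indicator A \<omega> * gauss (t + \<tau> \<omega>) y)"
      using g0 by (intro integrableI_nonneg) auto
    then have "ennreal (m y) = ennreal (\<integral>\<omega>. indicator A \<omega> * gauss (t + \<tau> \<omega>) y \<partial>M)"
      unfolding e'[symmetric] using g0 by (intro nn_integral_eq_integral) auto
    moreover have "0 \<le> m y" unfolding m_def using f0 by simp
    moreover have "0 \<le> (\<integral>\<omega>. indicator A \<omega> * gauss (t + \<tau> \<omega>) y \<partial>M)" using g0 by simp
    ultimately show "m y = (\<integral>\<omega>. indicator A \<omega> * gauss (t + \<tau> \<omega>) y \<partial>M)" by simp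
  qed
  have m0: "0 \<le> m y" for y unfolding m_def using f0 by simp
  have q0: "0 \<le> q y" for y unfolding q_def by simp
  \<comment> \<open>The square of an average over signals is an average over two copies; without
    correlation the pair density factors.\<close>
  have W0: "W (\<lambda>_. 0) (norm y) = ennreal ((m y)\<^sup>2)" for y
  proof -
    have [measurable]: "(\<lambda>\<omega>. gauss (t + \<tau> \<omega>) y) \<in> borel_measurable M" unfolding gauss_def by measurable
    have "ennreal ((m y)\<^sup>2) = (\<integral>\<^sup>+\<omega>. ?m y \<omega> \<partial>M)\<^sup>2"
      unfolding m_e[symmetric] using m0 by (simp add: ennreal_power)
    also have "\<dots> = (\<integral>\<^sup>+p. ?m y (fst p) * ?m y (snd p) \<partial>(M \<Otimes>\<^sub>M M))"
      by (rule nn_integral_power2) measurable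
    also have "\<dots> = W (\<lambda>_. 0) (norm y)"
      unfolding W_def pair_density_uncorrelated[OF t\<tau> t\<tau>]
      by (intro nn_integral_cong) (auto simp: ennreal_mult gauss_nonneg[OF t\<tau>] indicator_times mult_ac split: split_indicator)
    finally show ?thesis ..
  qed
  \<comment> \<open>Here both copies see the same matrix, which creates the covariance
    \<rho>.\<close>
  have W1: "W \<rho> (norm y) = ennreal (q y)" for y
  proof -
    have if2: "integrable M (\<lambda>\<omega>'. (f \<omega>' y)\<^sup>2)"
      by (rule integrable_const_bound[where B="(1 / sqrt ((2 * pi * t) ^ CARD('k)))\<^sup>2"])
        (use f0 fle in \<open>auto intro!: power_mono\<close>)
    have "ennreal (q y) = (\<integral>\<^sup>+\<omega>'. ennreal ((f \<omega>' y)\<^sup>2) \<partial>M)"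
      unfolding q_def using if2 by (intro nn_integral_eq_integral[symmetric]) auto
    also have "\<dots> = (\<integral>\<^sup>+\<omega>'. (\<integral>\<^sup>+\<omega>. ?h \<omega>' y \<omega> \<partial>M)\<^sup>2 \<partial>M)"
      unfolding fe[symmetric] using f0 by (simp add: ennreal_power)
    also have "\<dots> = (\<integral>\<^sup>+\<omega>'. (\<integral>\<^sup>+p. ?h \<omega>' y (fst p)
        * ?h \<omega>' y (snd p) \<partial>(M \<Otimes>\<^sub>M M)) \<partial>M)"
      by (intro nn_integral_cong nn_integral_power2) measurable
    also have "\<dots> = (\<integral>\<^sup>+p. (\<integral>\<^sup>+\<omega>'. ?h \<omega>' y (fst p)
        * ?h \<omega>' y (snd p) \<partial>M) \<partial>(M \<Otimes>\<^sub>M M))"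
      by (rule MMM.Fubini'[symmetric]) measurable
    also have "\<dots> = W \<rho> (norm y)"
      unfolding W_def
    proof (intro nn_integral_cong)
      fix p
      have "(\<integral>\<^sup>+\<omega>'. ?h \<omega>' y (fst p)
          * ?h \<omega>' y (snd p) \<partial>M)
        = (\<integral>\<^sup>+\<omega>'. ennreal (gauss t (y - \<Theta> \<omega>' *v X (fst p)) * gauss t (y - \<Theta> \<omega>' *v X (snd p))) * indicator (A \<times> A) p \<partial>M)"
        by (intro nn_integral_cong)
          (auto simp: ennreal_mult gauss_nonneg[OF pos(2)] indicator_times mult_ac split: split_indicator)
      also have "\<dots> = (\<integral>\<^sup>+\<omega>'. ennreal (gauss t (y - \<Theta> \<omega>' *v X (fst p)) * gauss t (y - \<Theta> \<omega>' *v X (snd p))) \<partial>M) * indicator (A \<times> A) p"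
        by (rule nn_integral_multc) measurable
      finally show "(\<integral>\<^sup>+\<omega>'. ?h \<omega>' y (fst p)
          * ?h \<omega>' y (snd p) \<partial>M)
        = ennreal (pair_density CARD('k) (t + \<tau> (fst p)) (t + \<tau> (snd p)) (\<rho> p) (norm y)) * indicator (A \<times> A) p"
        unfolding projection_second_moment[OF pos(2)] \<tau>_def \<rho>_def .
    qed
    finally show ?thesis ..
  qed
  have mq: "(m y)\<^sup>2 \<le> q y" for y
    unfolding m_def q_def
    by (rule nn_integral_ell_le_variance(2)[where g=1]) (use f0 fle in auto)
  have fluct: "(\<integral>\<^sup>+y. ennreal (sqrt (q y - (m y)\<^sup>2)) \<partial>lborel)
     \<le> ennreal (3 * CARD('k) powr (3 / 4) * ((\<integral>p. \<bar>\<rho> p\<bar> \<partial>(M \<Otimes>\<^sub>M M)) / \<gamma>) powr (1 / 2)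
        + 3 * CARD('k) powr (1 / 4) * (1 + (2 + \<epsilon>) * \<gamma> / t) powr (CARD('k) / 4)
          * (sqrt (\<integral>p. (\<rho> p)\<^sup>2 \<partial>(M \<Otimes>\<^sub>M M)) / \<gamma>))"
  proof -
    have "(\<integral>\<^sup>+y. ennreal (sqrt (enn2real (W \<rho> (norm y)) - enn2real (W (\<lambda>_. 0) (norm y)))) \<partial>(lborel :: (real ^ 'k) measure))
      \<le> ennreal (3 * CARD('k) powr (3 / 4) * ((\<integral>p. \<bar>\<rho> p\<bar> \<partial>(M \<Otimes>\<^sub>M M)) / \<gamma>) powr (1 / 2)
        + 3 * CARD('k) powr (1 / 4) * (1 + (2 + \<epsilon>) * \<gamma> / t) powr (CARD('k) / 4)
          * (sqrt (\<integral>p. (\<rho> p)\<^sup>2 \<partial>(M \<Otimes>\<^sub>M M)) / \<gamma>))"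
      unfolding W_def
    proof (rule radial_fluctuation_bound[OF _ _ A pos])
      show "\<bar>\<tau> x - \<gamma>\<bar> \<le> \<epsilon> * \<gamma> / 2" if "x \<in> A" for x using A\<gamma>[OF that] by (simp add: \<tau>_def)
      show "(\<rho> (x, y))\<^sup>2 \<le> \<tau> x * \<tau> y" for x y
        using Cauchy_Schwarz_ineq[of "X x" "X y"] s
        by (simp add: \<rho>_def \<tau>_def power_mult_distrib power2_eq_square mult_left_mono mult_ac)
      show "integrable (M \<Otimes>\<^sub>M M) (\<lambda>p. \<bar>\<rho> p\<bar>)" "integrable (M \<Otimes>\<^sub>M M) (\<lambda>p. (\<rho> p)\<^sup>2)"
        unfolding \<rho>_def using integrable_inner_pair[OF X int] by auto
      fix r :: real assume "0 \<le> r"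
      \<comment> \<open>The comparison is available at norms of vectors; every nonnegative
        \<open>r\<close> is such a norm.\<close>
      then obtain y :: "real ^ 'k" where "norm y = r" using vector_choose_size by blast
      then have "W (\<lambda>_. 0) r \<le> W \<rho> r" using W0[of y] W1[of y] mq[of y] by (simp add: ennreal_leI)
      then show "(\<integral>\<^sup>+p. ennreal (pair_density CARD('k) (t + \<tau> (fst p)) (t + \<tau> (snd p)) 0 r) * indicator (A \<times> A) p \<partial>(M \<Otimes>\<^sub>M M))
        \<le> (\<integral>\<^sup>+p. ennreal (pair_density CARD('k) (t + \<tau> (fst p)) (t + \<tau> (snd p)) (\<rho> p) r) * indicator (A \<times> A) p \<partial>(M \<Otimes>\<^sub>M M))"
        unfolding W_def .
    qed measurable
    then show ?thesis using q0 by (simp add: W0 W1)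
  qed
  have "(\<integral>\<^sup>+\<omega>'. (\<integral>\<^sup>+y. ?e \<omega>' y \<partial>lborel) \<partial>M)
      = (\<integral>\<^sup>+y. (\<integral>\<^sup>+\<omega>'. ?e \<omega>' y \<partial>M) \<partial>lborel)"
    by (rule lb.Fubini'[symmetric]) measurable
  also have "\<dots> \<le> (\<integral>\<^sup>+y. ennreal (sqrt (q y - (m y)\<^sup>2)) + (\<integral>\<^sup>+\<omega>. ?j y \<omega> \<partial>M) \<partial>lborel)"
  proof (intro nn_integral_mono)
    fix y :: "real ^ 'k"
    have g: "0 < gauss v y" by (rule gauss_pos[OF v])
    show "(\<integral>\<^sup>+\<omega>'. ?e \<omega>' y \<partial>M)
      \<le> ennreal (sqrt (q y - (m y)\<^sup>2)) + (\<integral>\<^sup>+\<omega>. ?j y \<omega> \<partial>M)"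
    \<comment> \<open>The variance bound requires a positive reference; for a null \<open>A\<close>
      the left integrand is \<open>ell 0 0 = 0\<close>.\<close>
    proof (cases "prob A = 0")
      case True
      then have "AE \<omega> in M. \<omega> \<notin> A" by (simp add: prob_eq_0)
      then have "f \<omega>' y = (\<integral>\<omega>. 0 \<partial>M)" for \<omega>' unfolding f_def by (intro integral_cong_AE) auto
      then show ?thesis using True by (simp add: ell_def)
    next
      case False
      then have p: "0 < prob A" by (simp add: less_le)
      have "(\<integral>\<^sup>+\<omega>'. ?e \<omega>' y \<partial>M)
        \<le> ennreal (sqrt (q y - (m y)\<^sup>2)) + ennreal (ell (m y) (prob A * gauss v y))"
        unfolding q_def m_def using p g f0 fle by (intro nn_integral_ell_le_variance(1)) auto
      also have "ennreal (ell (m y) (prob A * gauss v y)) \<le> (\<integral>\<^sup>+\<omega>. ?j y \<omega> \<partial>M)"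
        unfolding m_eq
      proof (rule ell_Jensen)
        show "(\<lambda>\<omega>. gauss (t + \<tau> \<omega>) y) \<in> borel_measurable M" unfolding gauss_def by measurable
      qed (use g int_m gauss_nonneg[OF t\<tau>] in auto)
      finally show ?thesis by (simp add: add_left_mono)
    qed
  qed
  also have "\<dots> = (\<integral>\<^sup>+y. ennreal (sqrt (q y - (m y)\<^sup>2)) \<partial>lborel)
      + (\<integral>\<^sup>+y. (\<integral>\<^sup>+\<omega>. ?j y \<omega> \<partial>M) \<partial>(lborel :: (real ^ 'k) measure))"
  proof (rule nn_integral_add)
    show "(\<lambda>y. ennreal (sqrt (q y - (m y)\<^sup>2))) \<in> borel_measurable lborel" unfolding q_def m_def f_def by measurable
    show "(\<lambda>y. \<integral>\<^sup>+\<omega>. ?j y \<omega> \<partial>M) \<in> borel_measurable lborel"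
      unfolding gauss_def by measurable
  qed
  also have "(\<integral>\<^sup>+y. (\<integral>\<^sup>+\<omega>. ?j y \<omega> \<partial>M) \<partial>(lborel :: (real ^ 'k) measure))
      = (\<integral>\<^sup>+\<omega>. (\<integral>\<^sup>+y. ?j y \<omega> \<partial>(lborel :: (real ^ 'k) measure)) \<partial>M)"
  proof (rule lb.Fubini')
    show "(\<lambda>(\<omega>, y). ?j y \<omega>) \<in> borel_measurable (M \<Otimes>\<^sub>M lborel)"
      unfolding gauss_def by measurable
  qed
  also have "\<dots> = (\<integral>\<^sup>+\<omega>. indicator A \<omega> * ennreal (CARD('k) / 2 * (ln (v / (t + \<tau> \<omega>)) + (t + \<tau> \<omega>) / v - 1)) \<partial>M)"
  proof (intro nn_integral_cong)
    fix \<omega>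
    show "(\<integral>\<^sup>+y. ?j y \<omega> \<partial>(lborel :: (real ^ 'k) measure))
      = indicator A \<omega> * ennreal (CARD('k) / 2 * (ln (v / (t + \<tau> \<omega>)) + (t + \<tau> \<omega>) / v - 1))"
      using nn_integral_ell_gauss[OF t\<tau> v, of \<omega> "0 :: real ^ 'k"]
      by (subst nn_integral_cmult) auto
  qed
  finally show ?thesis
    using add_right_mono[OF fluct] unfolding f_def \<tau>_def \<rho>_def by (rule order_trans)
qed

end

section \<open>Assembly of the bound\<close>

lemma (in prob_space) indicator_integral_null:
  "prob A = 0 \<Longrightarrow> A \<in> sets M \<Longrightarrow> h \<in> borel_measurable M \<Longrightarrow> (\<integral>\<omega>. indicator A \<omega> * h \<omega> \<partial>M) = (0::real)"
  by (subst integral_cong_AE[where g="\<lambda>_. 0"]) (auto simp: prob_eq_0)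

lemma alpha_eq:
  fixes X :: "'a \<Rightarrow> real ^ 'n"
  assumes "1 / real CARD('n) * (\<integral>\<omega>. (norm (X \<omega>))\<^sup>2 \<partial>M) = \<gamma>"
  shows "alpha M X = (\<integral>\<omega>. \<bar>1 / real CARD('n) * (X \<omega> \<bullet> X \<omega>) - \<gamma>\<bar> \<partial>M)"
proof -
  have "\<bar>1 / real CARD('n) * (X \<omega> \<bullet> X \<omega>) - \<gamma>\<bar> = 1 / real CARD('n) * \<bar>(norm (X \<omega>))\<^sup>2 - (\<integral>\<omega>. (norm (X \<omega>))\<^sup>2 \<partial>M)\<bar>" for \<omega>
  proof -
    have "1 / real CARD('n) * (X \<omega> \<bullet> X \<omega>) - \<gamma> = 1 / real CARD('n) * ((norm (X \<omega>))\<^sup>2 - (\<integral>\<omega>. (norm (X \<omega>))\<^sup>2 \<partial>M))"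
      unfolding assms[symmetric] by (simp add: power2_norm_eq_inner right_diff_distrib diff_divide_distrib)
    then show ?thesis by (simp only: abs_mult) simp
  qed
  then show ?thesis unfolding alpha_def by (simp only: integral_mult_right_zero)
qed

lemma beta_eq:
  fixes X :: "'a \<Rightarrow> real ^ 'n"
  shows "beta 1 M X = (\<integral>p. \<bar>1 / real CARD('n) * (X (fst p) \<bullet> X (snd p))\<bar> \<partial>(M \<Otimes>\<^sub>M M))"
    and "beta 2 M X = sqrt (\<integral>p. (1 / real CARD('n) * (X (fst p) \<bullet> X (snd p)))\<^sup>2 \<partial>(M \<Otimes>\<^sub>M M))"
proof -
  show "beta 1 M X = (\<integral>p. \<bar>1 / real CARD('n) * (X (fst p) \<bullet> X (snd p))\<bar> \<partial>(M \<Otimes>\<^sub>M M))"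
    unfolding beta_def by (simp add: abs_mult)
  have h: "(\<integral>p. (1 / real CARD('n) * (X (fst p) \<bullet> X (snd p)))\<^sup>2 \<partial>(M \<Otimes>\<^sub>M M))
      = (1 / real CARD('n))\<^sup>2 * (\<integral>p. \<bar>X (fst p) \<bullet> X (snd p)\<bar> ^ 2 \<partial>(M \<Otimes>\<^sub>M M))"
    unfolding power_mult_distrib power2_abs by (rule integral_mult_right_zero)
  show "beta 2 M X = sqrt (\<integral>p. (1 / real CARD('n) * (X (fst p) \<bullet> X (snd p)))\<^sup>2 \<partial>(M \<Otimes>\<^sub>M M))"
    unfolding h beta_def sqrt_def[symmetric] real_sqrt_mult by simp
qed

theorem theorem2:
  fixes M :: "'a measure"
    and X :: "'a \<Rightarrow> real ^ 'n"
    and \<Theta> :: "'a \<Rightarrow> real ^ 'n ^ 'k"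
    and N Y :: "'a \<Rightarrow> real ^ 'k"
    and P :: "real ^ 'n ^ 'k \<Rightarrow> (real ^ 'k) measure"
    and \<gamma> t \<epsilon> :: real
  assumes "prob_space M"
    and "X \<in> borel_measurable M"
    and "\<Theta> \<in> borel_measurable M"
    and "N \<in> borel_measurable M"
    and "integrable M (\<lambda>\<omega>. (norm (X \<omega>))\<^sup>2)"
    and "1 / real CARD('n) * (\<integral>\<omega>. (norm (X \<omega>))\<^sup>2 \<partial>M) = \<gamma>" and "0 < \<gamma>"
    and "prob_space.indep_vars M (\<lambda>_. borel) (\<lambda>(i, j) \<omega>. \<Theta> \<omega> $ i $ j) (UNIV :: ('k \<times> 'n) set)"
    and "\<And>i j. distributed M lborel (\<lambda>\<omega>. \<Theta> \<omega> $ i $ j)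
           (\<lambda>x. ennreal (normal_density 0 (sqrt (1 / real CARD('n))) x))"
    and "distr M borel N = mv_normal 0 (mat 1)"
    and "indep_triple M borel X borel \<Theta> borel N"
    and "0 < t"
    and "0 < \<epsilon>" and "\<epsilon> \<le> 1"
    and "Y = (\<lambda>\<omega>. \<Theta> \<omega> *v X \<omega> + sqrt t *\<^sub>R N \<omega>)"
    and "regular_cond_distr M borel \<Theta> borel Y P"
  shows "(\<integral>\<^sup>+\<omega>. rel_entropy (P (\<Theta> \<omega>)) (mv_normal 0 (mat (\<gamma> + t))) \<partial>M)
    \<le> ennreal (3 * real CARD('k) * ln (1 + \<gamma> / t) * (alpha M X / (\<epsilon> * \<gamma>))
        + 3 * real CARD('k) powr (3 / 4) * (beta 1 M X / \<gamma>) powr (1 / 2)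
        + 3 * real CARD('k) powr (1 / 4)
            * (1 + (2 + \<epsilon>) * \<gamma> / t) powr (real CARD('k) / 4) * (beta 2 M X / \<gamma>))"
proof -
  interpret prob_space M by fact
  note [measurable] = assms(2-4)
  define s where "s = 1 / real CARD('n)"
  have s: "0 < s" by (simp add: s_def)
  interpret gp: gaussian_projection M \<Theta> s
    by unfold_locales (use assms(3,8,9) s in \<open>auto simp: s_def\<close>)
  define \<tau> where "\<tau> = (\<lambda>\<omega>. s * (X \<omega> \<bullet> X \<omega>))"
  have [measurable]: "\<tau> \<in> borel_measurable M" unfolding \<tau>_def by measurable
  have \<tau>0: "0 \<le> \<tau> \<omega>" for \<omega> using s by (simp add: \<tau>_def)
  have int: "integrable M (\<lambda>\<omega>. X \<omega> \<bullet> X \<omega>)" using assms(5) by (simp add: power2_norm_eq_inner)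
  define v where "v = \<gamma> + t"
  have v: "0 < v" using assms(7,12) by (simp add: v_def)
  define L where "L = ln (1 + \<gamma> / t)"
  define A where "A = {\<omega> \<in> space M. \<bar>\<tau> \<omega> - \<gamma>\<bar> \<le> \<epsilon> * \<gamma> / 2}"
  define A' where "A' = space M - A"
  have [measurable]: "A \<in> sets M" "A' \<in> sets M" unfolding A_def A'_def by measurable
  define f where "f = (\<lambda>A \<theta> y. \<integral>\<omega>. indicator A \<omega> * gauss t (y - \<theta> *v X \<omega> :: real ^ 'k) \<partial>M)"
  note mix = gaussian_mixture_integrable[OF _ _ assms(12)]
  let ?e = "\<lambda>B \<theta> y. ennreal (ell (f B \<theta> y) (prob B * gauss v y))"
  let ?I = "\<lambda>B \<omega>. \<integral>\<^sup>+y. ?e B (\<Theta> \<omega>) y \<partial>lborel"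
  have f0: "0 \<le> f B \<theta> y" and fe: "ennreal (f B \<theta> y) = (\<integral>\<^sup>+\<omega>. indicator B \<omega> * ennreal (gauss t (y - \<theta> *v X \<omega>)) \<partial>M)"
    if [measurable]: "B \<in> sets M" for B \<theta> y
    unfolding f_def by (rule mix; measurable)+
  have fm[measurable]: "(\<lambda>p. f B (\<Theta> (fst p)) (snd p)) \<in> borel_measurable (M \<Otimes>\<^sub>M borel)" "f B \<theta> \<in> borel_measurable borel"
    if [measurable]: "B \<in> sets M" for B \<theta>
    unfolding f_def by measurable
  define K where "K = (\<lambda>\<theta> :: real ^ 'n ^ 'k. density lborel (\<lambda>y. \<integral>\<^sup>+\<omega>. ennreal (gauss t (y - \<theta> *v X \<omega>)) \<partial>M))"
  have Kreg: "regular_cond_distr M borel \<Theta> borel Y K"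
    unfolding K_def assms(15) by (rule gaussian_channel_cond_distr[OF assms(1,11,10,12)])
  have KP: "AE \<omega> in M. P (\<Theta> \<omega>) = K (\<Theta> \<omega>)"
    by (rule regular_cond_distr_unique[OF assms(1) _ assms(16) Kreg]) measurable
  have sum_f: "(\<integral>\<^sup>+\<omega>. ennreal (gauss t (y - \<theta> *v X \<omega>)) \<partial>M) = ennreal (f A \<theta> y + f A' \<theta> y)" for \<theta> y
  proof -
    have "(\<integral>\<^sup>+\<omega>. ennreal (gauss t (y - \<theta> *v X \<omega>)) \<partial>M)
      = (\<integral>\<^sup>+\<omega>. indicator A \<omega> * ennreal (gauss t (y - \<theta> *v X \<omega>)) + indicator A' \<omega> * ennreal (gauss t (y - \<theta> *v X \<omega>)) \<partial>M)"
      by (intro nn_integral_cong) (auto simp: A'_def split: split_indicator)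
    also have "\<dots> = ennreal (f A \<theta> y) + ennreal (f A' \<theta> y)"
      unfolding fe[OF \<open>A \<in> sets M\<close>] fe[OF \<open>A' \<in> sets M\<close>] by (rule nn_integral_add) measurable
    finally show ?thesis using f0 by (simp add: ennreal_plus)
  qed
  have entropy_le: "rel_entropy (K \<theta>) (mv_normal 0 (mat v)) \<le> (\<integral>\<^sup>+y. ennreal (ell (f A \<theta> y + f A' \<theta> y) (gauss v y)) \<partial>lborel)" for \<theta>
    unfolding K_def sum_f mv_normal_mat[OF v]
  proof (rule rel_entropy_density_le)
    \<comment> \<open>That the mixture density has total mass 1 is read off from its kernel being a
      probability kernel.\<close>
    have "K \<in> measurable borel (prob_algebra borel)" using Kreg by (simp add: regular_cond_distr_def)
    then have "K \<theta> \<in> space (prob_algebra borel)" by (rule measurable_space) simp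
    then have "emeasure (K \<theta>) UNIV = 1"
      using prob_space.emeasure_space_1[of "K \<theta>"] sets_eq_imp_space_eq[of "K \<theta>" borel] by (simp add: space_prob_algebra)
    then have "(\<integral>\<^sup>+y. ennreal (f A \<theta> y + f A' \<theta> y) \<partial>lborel) = 1"
      unfolding K_def sum_f by (subst (asm) emeasure_density) auto
    then show "has_bochner_integral lborel (\<lambda>y. f A \<theta> y + f A' \<theta> y) 1"
      using f0 by (intro has_bochner_integral_nn_integral) auto
    show "has_bochner_integral lborel (gauss v :: real ^ 'k \<Rightarrow> real) 1" using gauss_integral[OF v, of 0] by simp
    show "sigma_finite_measure (lborel :: (real ^ 'k) measure)" by (rule lborel.sigma_finite_measure_axioms)
  qed (use f0 gauss_pos[OF v] in \<open>auto intro: add_nonneg_nonneg\<close>)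
  have null: "f B \<theta> y = 0" if "prob B = 0" "B \<in> sets M" for B \<theta> y
    unfolding f_def using that by (rule indicator_integral_null) measurable
  have pA': "prob A' = 1 - prob A" unfolding A'_def by (rule prob_compl) measurable
  \<comment> \<open>The target is divided in the proportions \<open>prob A\<close> and
    \<open>prob A'\<close>, so that each part of the density is compared with a multiple of the
    target of its own mass.\<close>
  have split: "ennreal (ell (f A \<theta> y + f A' \<theta> y) (gauss v y))
      \<le> ?e A \<theta> y + ?e A' \<theta> y" for \<theta> y
  proof -
    have g: "0 < gauss v y" by (rule gauss_pos[OF v])
    have "ell (f A \<theta> y + f A' \<theta> y) (prob A * gauss v y + prob A' * gauss v y)
       \<le> ell (f A \<theta> y) (prob A * gauss v y) + ell (f A' \<theta> y) (prob A' * gauss v y)"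
      using g f0 null by (intro ell_add_le') auto
    also have "prob A * gauss v y + prob A' * gauss v y = gauss v y" by (simp add: pA' algebra_simps)
    finally have "ennreal (ell (f A \<theta> y + f A' \<theta> y) (gauss v y))
       \<le> ennreal (ell (f A \<theta> y) (prob A * gauss v y) + ell (f A' \<theta> y) (prob A' * gauss v y))" by (rule ennreal_leI)
    also have "\<dots> \<le> ?e A \<theta> y + ?e A' \<theta> y"
      by (auto simp: ennreal_plus_if intro!: ennreal_leI)
    finally show ?thesis .
  qed
  define B1 where "B1 = 3 * CARD('k) powr (3 / 4) * (beta 1 M X / \<gamma>) powr (1 / 2)
        + 3 * CARD('k) powr (1 / 4) * (1 + (2 + \<epsilon>) * \<gamma> / t) powr (CARD('k) / 4) * (beta 2 M X / \<gamma>)"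
  have B1: "0 \<le> B1" using assms(7) unfolding B1_def beta_eq by (intro add_nonneg_nonneg mult_nonneg_nonneg) auto
  \<comment> \<open>One integrand for both events; the factor \<open>k / 2\<close> of Gaussian
    divergence makes it twice what either estimate yields.\<close>
  define E where "E = (\<lambda>\<omega>. 3 * real CARD('k) * L * (\<bar>\<tau> \<omega> - \<gamma>\<bar> / (\<epsilon> * \<gamma>)))"
  have L0: "0 \<le> L" using assms(7,12) by (simp add: L_def)
  have E0: "0 \<le> E \<omega>" for \<omega> using L0 assms(7,13) by (simp add: E_def)
  have "(\<integral>\<^sup>+\<omega>. rel_entropy (P (\<Theta> \<omega>)) (mv_normal 0 (mat (\<gamma> + t))) \<partial>M) \<le> (\<integral>\<^sup>+\<omega>. rel_entropy (K (\<Theta> \<omega>)) (mv_normal 0 (mat v)) \<partial>M)"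
    by (rule nn_integral_mono_AE) (use KP in \<open>auto simp: v_def elim: eventually_mono\<close>)
  also have "\<dots> \<le> (\<integral>\<^sup>+\<omega>. (\<integral>\<^sup>+y. ?e A (\<Theta> \<omega>) y + ?e A' (\<Theta> \<omega>) y \<partial>lborel) \<partial>M)"
    by (intro nn_integral_mono order_trans[OF entropy_le] split)
  also have "\<dots> = (\<integral>\<^sup>+\<omega>. ?I A \<omega> + ?I A' \<omega> \<partial>M)"
    by (intro nn_integral_cong nn_integral_add) measurable
  also have "\<dots> = (\<integral>\<^sup>+\<omega>. ?I A \<omega> \<partial>M)
      + (\<integral>\<^sup>+\<omega>. ?I A' \<omega> \<partial>M)"
    by (rule nn_integral_add) measurable
  also have "\<dots> \<le> (ennreal B1 + (\<integral>\<^sup>+\<omega>. indicator A \<omega> * ennreal (E \<omega>) \<partial>M)) + (\<integral>\<^sup>+\<omega>. indicator A' \<omega> * ennreal (E \<omega>) \<partial>M)"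
  proof (rule add_mono)
    have "\<bar>s * (X \<omega> \<bullet> X \<omega>) - \<gamma>\<bar> \<le> \<epsilon> * \<gamma> / 2" if "\<omega> \<in> A" for \<omega> using that by (simp add: A_def \<tau>_def)
    from gp.nn_integral_core_divergence[OF assms(2) \<open>A \<in> sets M\<close> assms(7,12,13,14) v int this]
    have "(\<integral>\<^sup>+\<omega>. ?I A \<omega> \<partial>M)
      \<le> ennreal B1 + (\<integral>\<^sup>+\<omega>. indicator A \<omega> * ennreal (CARD('k) / 2 * (ln (v / (t + \<tau> \<omega>)) + (t + \<tau> \<omega>) / v - 1)) \<partial>M)"
      unfolding f_def B1_def beta_eq s_def \<tau>_def by blast
    also have "\<dots> \<le> ennreal B1 + (\<integral>\<^sup>+\<omega>. indicator A \<omega> * ennreal (E \<omega>) \<partial>M)"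
    proof (intro add_left_mono nn_integral_mono mult_left_mono ennreal_leI)
      fix \<omega>
      have "real CARD('k) / 2 * (ln (v / (t + \<tau> \<omega>)) + (t + \<tau> \<omega>) / v - 1) \<le> real CARD('k) / 2 * (3 * L * (\<bar>\<tau> \<omega> - \<gamma>\<bar> / (\<epsilon> * \<gamma>)))"
        unfolding v_def L_def using \<tau>0 assms(7,12,13,14) by (intro mult_left_mono gaussian_divergence_bounds) auto
      also have "\<dots> = E \<omega> / 2" by (simp add: E_def)
      finally show "real CARD('k) / 2 * (ln (v / (t + \<tau> \<omega>)) + (t + \<tau> \<omega>) / v - 1) \<le> E \<omega>" using E0[of \<omega>] by linarith
    qed simp
    finally show "(\<integral>\<^sup>+\<omega>. ?I A \<omega> \<partial>M)
      \<le> ennreal B1 + (\<integral>\<^sup>+\<omega>. indicator A \<omega> * ennreal (E \<omega>) \<partial>M)" .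
  next
    have "(\<integral>\<^sup>+\<omega>. ?I A' \<omega> \<partial>M)
      \<le> (\<integral>\<^sup>+\<omega>. indicator A' \<omega> * ennreal (CARD('k) / 2 * (ln (v / t) + t / v - 1) + CARD('k) * \<tau> \<omega> / (2 * v)) \<partial>M)"
      unfolding f_def \<tau>_def by (rule gp.nn_integral_tail_divergence[OF assms(2) \<open>A' \<in> sets M\<close> assms(12) v])
    also have "\<dots> \<le> (\<integral>\<^sup>+\<omega>. indicator A' \<omega> * ennreal (E \<omega>) \<partial>M)"
    proof (intro nn_integral_mono)
      fix \<omega>
      show "indicator A' \<omega> * ennreal (CARD('k) / 2 * (ln (v / t) + t / v - 1) + CARD('k) * \<tau> \<omega> / (2 * v)) \<le> indicator A' \<omega> * ennreal (E \<omega>)"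
      proof (cases "\<omega> \<in> A'")
        case True
        have far: "\<epsilon> * \<gamma> / 2 < \<bar>\<tau> \<omega> - \<gamma>\<bar>" using True by (auto simp: A'_def A_def)
        have "v / t = 1 + \<gamma> / t" using assms(12) by (simp add: v_def field_simps)
        then have lL: "ln (v / t) = L" by (simp add: L_def)
        have "real CARD('k) / 2 * (ln (v / t) + t / v - 1) + CARD('k) * \<tau> \<omega> / (2 * v) = real CARD('k) / 2 * (L + ((t + \<tau> \<omega>) / v - 1))"
          unfolding lL by (simp add: algebra_simps add_divide_distrib diff_divide_distrib)
        also have "(t + \<tau> \<omega>) / v - 1 = (\<tau> \<omega> - \<gamma>) / v" using v by (simp add: v_def field_simps)
        also have "real CARD('k) / 2 * (L + (\<tau> \<omega> - \<gamma>) / v) \<le> real CARD('k) / 2 * (3 * L * (\<bar>\<tau> \<omega> - \<gamma>\<bar> / (\<epsilon> * \<gamma>)))"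
          unfolding v_def L_def using \<tau>0 assms(7,12,13,14) far by (intro mult_left_mono gaussian_divergence_bounds) auto
        also have "\<dots> = E \<omega> / 2" by (simp add: E_def)
        finally have "real CARD('k) / 2 * (ln (v / t) + t / v - 1) + CARD('k) * \<tau> \<omega> / (2 * v) \<le> E \<omega>"
          using E0[of \<omega>] by linarith
        then show ?thesis by (intro mult_left_mono ennreal_leI) simp_all
      qed simp
    qed
    finally show "(\<integral>\<^sup>+\<omega>. ?I A' \<omega> \<partial>M)
      \<le> (\<integral>\<^sup>+\<omega>. indicator A' \<omega> * ennreal (E \<omega>) \<partial>M)" .
  qed
  also have "\<dots> = ennreal B1 + (\<integral>\<^sup>+\<omega>. indicator A \<omega> * ennreal (E \<omega>) + indicator A' \<omega> * ennreal (E \<omega>) \<partial>M)"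
    unfolding E_def by (subst nn_integral_add) (auto simp: add.assoc)
  \<comment> \<open>\<open>A\<close> and its complement recombine to the absolute deviation whose
    mean is \<alpha>.\<close>
  also have "(\<integral>\<^sup>+\<omega>. indicator A \<omega> * ennreal (E \<omega>) + indicator A' \<omega> * ennreal (E \<omega>) \<partial>M) = (\<integral>\<^sup>+\<omega>. ennreal (E \<omega>) \<partial>M)"
    by (intro nn_integral_cong) (auto simp: A'_def split: split_indicator)
  also have "\<dots> = ennreal (3 * real CARD('k) * L * (alpha M X / (\<epsilon> * \<gamma>)))"
  proof -
    have "integrable M \<tau>" unfolding \<tau>_def using int by simp
    then have i: "integrable M (\<lambda>\<omega>. \<bar>\<tau> \<omega> - \<gamma>\<bar>)" by auto
    have "(\<integral>\<^sup>+\<omega>. ennreal (E \<omega>) \<partial>M) = ennreal (\<integral>\<omega>. E \<omega> \<partial>M)"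
      using i E0 by (intro nn_integral_eq_integral) (auto simp: E_def)
    also have "(\<integral>\<omega>. E \<omega> \<partial>M) = 3 * real CARD('k) * L * ((\<integral>\<omega>. \<bar>\<tau> \<omega> - \<gamma>\<bar> \<partial>M) / (\<epsilon> * \<gamma>))"
      unfolding E_def using i by simp
    finally show ?thesis unfolding \<tau>_def s_def alpha_eq[OF assms(6)] .
  qed
  also have "ennreal B1 + \<dots> = ennreal (3 * real CARD('k) * L * (alpha M X / (\<epsilon> * \<gamma>)) + B1)"
  proof -
    have "0 \<le> alpha M X" unfolding alpha_def by (intro mult_nonneg_nonneg) auto
    then have "0 \<le> 3 * real CARD('k) * L * (alpha M X / (\<epsilon> * \<gamma>))"
      using L0 assms(7,13) by (intro mult_nonneg_nonneg divide_nonneg_nonneg) auto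
    then show ?thesis using B1 by (simp add: ennreal_plus add.commute)
  qed
  finally show ?thesis unfolding B1_def L_def by (simp only: add.assoc)
qed

end
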